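(* Let $\delta\in\{1,2\}$, let $\Gamma$ and $\Lambda[\delta]$ be fixed, and let $\phi=[\phi_1,\phi_2]\in\Sigma_{\Gamma,\Lambda[\delta]}$ have multiplicity $(m_1,m_2)$. Then $\phi$ is $\mathcal A[\delta]$-equivalent to some bigerm $\varphi=[\varphi_1,\varphi_2]$ of the form $$\varphi_1=\Big(t_1^{m_1},\ \sum_{\substack{j>m_1,\ \underline{j}\notin M\\ F_1(\underline{j})=\emptyset}}a_{1j}t_1^j\Big),\qquad \varphi_2=\begin{cases}\Big(\displaystyle\sum_{j>m_2,\ F_2(\underline{j})=\emptyset}a_{2j}t_2^j,\ t_2^{m_2}\Big)&\text{if }\delta=1,\\[3mm] \Big(t_2^{m_2},\ \displaystyle\sum_{j>m_2,\ F_2(\underline{j})=\emptyset}a_{2j}t_2^j\Big)&\text{if }\delta=2,\end{cases}$$ with $a_{ij}\in\mathbb C$.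
   Context: A bigerm $\phi=[\phi_1,\phi_2]$ is a pair of parametrizations $\phi_i=(\phi_{i1},\phi_{i2}):(\mathbb C,0)\to(\mathbb C^2,0)$, with parameter $t_i$, of the two (distinct) branches of a reduced germ of plane analytic curve with exactly two irreducible components; $m_i$ is the multiplicity of the $i$-th branch and $m=(m_1,m_2)$ is the multiplicity of $\phi$. The group $\mathcal A=\mathrm{Aut}(\mathbb C\{t_1\})\times\mathrm{Aut}(\mathbb C\{t_2\})\times\mathrm{Aut}(\mathbb C\{x,y\})$ (analytic coordinate changes) acts on bigerms by $(\rho_1,\rho_2,\sigma)\cdot\phi=[\sigma\circ\phi_1\circ\rho_1^{-1},\ \sigma\circ\phi_2\circ\rho_2^{-1}]$. Writing $j^k$ for $k$-jets, $\mathcal A[2]$ is the subgroup of $(\rho_1,\rho_2,\sigma)$ with $j^1\rho_i=t_i$ ($i=1,2$) and $j^1\sigma=(x+by,y)$ for some $b\in\mathbb C$; $\mathcal A[1]$ is the subgroup of $\mathcal A[2]$ where $b=0$. Bigerms in the same $\mathcal A[\delta]$-orbit are called $\mathcal A[\delta]$-equivalent. Puiseux form. The index $\delta=1$ refers to distinct tangents and $\delta=2$ to equal tangents of the two branches. A bigerm is in Puiseux form if $\phi_1=(t_1^{m_1},\sum_{i>m_1}a_{1i}t_1^i)$ and $\phi_2=(\sum_{i>m_2}a_{2i}t_2^i,\ t_2^{m_2})$ when $\delta=1$, respectively $\phi_2=(t_2^{m_2},\sum_{i>m_2}a_{2i}t_2^i)$ when $\delta=2$. Invariants. With $\mathrm{ord}\,0=\infty$: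 for $\eta\in\mathbb C\{x,y\}$, $\nu_i(\eta)=\mathrm{ord}_{t_i}(\eta\circ\phi_i)$, and the semigroup of values is $\Gamma=\{(\nu_1(\eta),\nu_2(\eta));\ \eta\in\mathbb C\{x,y\}\}$. Let $(c_1,c_2)$ be the conductor of $\Gamma$ and $c=\max\{c_1,c_2\}$. For a differential $\omega=\eta_1dx+\eta_2dy$ put $\omega\circ\phi_i=\eta_1(\phi_i)\phi_{i1}'+\eta_2(\phi_i)\phi_{i2}'$, $\nu_i(\omega)=\mathrm{ord}_{t_i}(\omega\circ\phi_i)+1$ and $\nu(\omega)=(\nu_1(\omega),\nu_2(\omega))$. Let $$\Omega[\delta]=\{\eta_1dx+(\beta(\delta-1)y+\eta_2)dy;\ \eta_1,\eta_2\in(x,y)^2\mathbb C\{x,y\},\ \beta\in\mathbb C\},\qquad \Lambda[\delta]=\{\nu(\omega)-m;\ \omega\in\Omega[\delta]\}.$$ $\Sigma_{\Gamma,\Lambda[\delta]}$ is the (finite dimensional) set of bigerms in Puiseux form of case $\delta$, with all terms of order at most $c$, having the given $\Gamma$ and the given $\Lambda[\delta]$. Fibers and maximal points. For $(a_1,a_2)\in\mathbb N^2$ and $\{i,l\}=\{1,2\}$, $F_i(a_1,a_2)=\{(b_1,b_2)\in\Lambda[\delta];\ b_i=a_i,\ b_l>a_l\}$. $M$ is the set of maximal points of $\Lambda[\delta]$, i.e. of points $(k_1,k_2)\in\Lambda[\delta]$ with $F_1(k_1,k_2)=F_2(k_1,k_2)=\emptyset$. For $j\in\mathbb N$, $\underline{j}=(j,j)$.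 *)

theory Defs
  imports "HOL-Analysis.Analysis"
begin

unbundle no vec_syntax
unbundle fps_syntax

text \<open>
  A series in two variables \<open>x\<close>, \<open>y\<close> is an element of \<^typ>\<open>complex fps fps\<close>: the outer
  variable is \<open>y\<close>, the inner one is \<open>x\<close>.
\<close>

type_synonym fps2 = "complex fps fps"

definition coef2 :: "fps2 \<Rightarrow> nat \<Rightarrow> nat \<Rightarrow> complex" where
  "coef2 F i j = F $ j $ i"  \<comment> \<open>coefficient of \<open>x^i y^j\<close>\<close>

definition series2 :: "(nat \<Rightarrow> nat \<Rightarrow> complex) \<Rightarrow> fps2" where
  "series2 f = Abs_fps (\<lambda>j. Abs_fps (\<lambda>i. f i j))"

definition const2 :: "complex \<Rightarrow> fps2" where
  "const2 c = fps_const (fps_const c)"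

definition var_x :: fps2 where
  "var_x = fps_const fps_X"

definition var_y :: fps2 where
  "var_y = fps_X"

definition conv1 :: "complex fps set" where
  "conv1 = {f. fps_conv_radius f > 0}"

definition conv2 :: "fps2 set" where
  "conv2 = {F. \<exists>r>0. (\<lambda>(i, j). norm (coef2 F i j) * r ^ i * r ^ j) summable_on UNIV}"

text \<open>The powers \<open>(x,y)^k\<close> of the maximal ideal of the ring of convergent series.\<close>

definition max_ideal_pow :: "nat \<Rightarrow> fps2 set" where
  "max_ideal_pow k = {F \<in> conv2. \<forall>i j. i + j < k \<longrightarrow> coef2 F i j = 0}"

definition jet1 :: "nat \<Rightarrow> complex fps \<Rightarrow> complex fps" where
  "jet1 k f = fps_cutoff (Suc k) f"

definition jet2 :: "nat \<Rightarrow> fps2 \<Rightarrow> fps2" where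
  "jet2 k F = series2 (\<lambda>i j. if i + j \<le> k then coef2 F i j else 0)"

text \<open>
  Substitution. The substituted series must have zero constant term; this is what makes the
  sums below finite, as higher powers do not contribute to the given coefficient.
\<close>

definition subst1 :: "fps2 \<Rightarrow> complex fps \<times> complex fps \<Rightarrow> complex fps" where
  "subst1 F \<phi> = Abs_fps (\<lambda>n. \<Sum>i\<le>n. \<Sum>j\<le>n. coef2 F i j * (fst \<phi> ^ i * snd \<phi> ^ j) $ n)"

definition subst2 :: "fps2 \<Rightarrow> fps2 \<times> fps2 \<Rightarrow> fps2" where
  "subst2 F \<sigma> = series2 (\<lambda>a b. \<Sum>i\<le>a + b. \<Sum>j\<le>a + b.
      coef2 F i j * coef2 (fst \<sigma> ^ i * snd \<sigma> ^ j) a b)"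


subsection \<open>Bigerms\<close>

type_synonym germ = "complex fps \<times> complex fps"
type_synonym bigerm = "germ \<times> germ"

definition germ_eval :: "germ \<Rightarrow> complex \<Rightarrow> complex \<times> complex" where
  "germ_eval \<phi> t = (eval_fps (fst \<phi>) t, eval_fps (snd \<phi>) t)"

text \<open>
  A parametrization of a branch is primitive, i.e. injective near the origin. Below, the bound
  on \<open>r\<close> is needed because \<^const>\<open>eval_fps\<close> is meaningless outside the disc of convergence.
\<close>

definition parametrization :: "germ \<Rightarrow> bool" where
  "parametrization \<phi> \<longleftrightarrow>
     fst \<phi> \<in> conv1 \<and> snd \<phi> \<in> conv1 \<and> fst \<phi> $ 0 = 0 \<and> snd \<phi> $ 0 = 0 \<and>
     (\<exists>r>0. ereal r \<le> fps_conv_radius (fst \<phi>) \<and> ereal r \<le> fps_conv_radius (snd \<phi>) \<and>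
            inj_on (germ_eval \<phi>) (ball 0 r))"

text \<open>
  Equality of the germs at the origin of the images of two parametrizations: the images of the
  discs \<open>ball 0 r\<close> form a basis of neighbourhoods of the origin in each branch.
\<close>

definition same_branch :: "germ \<Rightarrow> germ \<Rightarrow> bool" where
  "same_branch \<phi> \<psi> \<longleftrightarrow>
     (\<forall>r>0. \<exists>s>0. germ_eval \<phi> ` ball 0 s \<subseteq> germ_eval \<psi> ` ball 0 r \<and>
                  germ_eval \<psi> ` ball 0 s \<subseteq> germ_eval \<phi> ` ball 0 r)"

definition is_bigerm :: "bigerm \<Rightarrow> bool" where
  "is_bigerm \<phi> \<longleftrightarrow>
     parametrization (fst \<phi>) \<and> parametrization (snd \<phi>) \<and> \<not> same_branch (fst \<phi>) (snd \<phi>)"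

definition ord_t :: "complex fps \<Rightarrow> enat" where
  "ord_t f = (if f = 0 then \<infinity> else enat (subdegree f))"

definition mult_germ :: "germ \<Rightarrow> nat" where
  "mult_germ \<phi> = the_enat (min (ord_t (fst \<phi>)) (ord_t (snd \<phi>)))"


subsection \<open>The groups of coordinate changes\<close>

definition Aut1 :: "complex fps set" where
  "Aut1 = {\<rho> \<in> conv1. \<rho> $ 0 = 0 \<and>
     (\<exists>\<tau>\<in>conv1. \<tau> $ 0 = 0 \<and> \<rho> oo \<tau> = fps_X \<and> \<tau> oo \<rho> = fps_X)}"

definition end2 :: "(fps2 \<times> fps2) set" where
  "end2 = max_ideal_pow 1 \<times> max_ideal_pow 1"

definition comp2 :: "fps2 \<times> fps2 \<Rightarrow> fps2 \<times> fps2 \<Rightarrow> fps2 \<times> fps2" where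
  "comp2 \<sigma> \<tau> = (subst2 (fst \<sigma>) \<tau>, subst2 (snd \<sigma>) \<tau>)"

definition Aut2 :: "(fps2 \<times> fps2) set" where
  "Aut2 = {\<sigma> \<in> end2. \<exists>\<tau>\<in>end2. comp2 \<sigma> \<tau> = (var_x, var_y) \<and> comp2 \<tau> \<sigma> = (var_x, var_y)}"

definition A_group :: "(complex fps \<times> complex fps \<times> fps2 \<times> fps2) set" where
  "A_group = Aut1 \<times> Aut1 \<times> Aut2"

definition A_sub :: "nat \<Rightarrow> (complex fps \<times> complex fps \<times> fps2 \<times> fps2) set" where
  "A_sub \<delta> = {(\<rho>1, \<rho>2, \<sigma>) \<in> A_group.
     jet1 1 \<rho>1 = fps_X \<and> jet1 1 \<rho>2 = fps_X \<and>
     (\<exists>b. (\<delta> = 1 \<longrightarrow> b = 0) \<and>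
          jet2 1 (fst \<sigma>) = var_x + const2 b * var_y \<and> jet2 1 (snd \<sigma>) = var_y)}"

definition act_germ :: "complex fps \<Rightarrow> fps2 \<times> fps2 \<Rightarrow> germ \<Rightarrow> germ" where
  "act_germ \<rho> \<sigma> \<phi> = (subst1 (fst \<sigma>) \<phi> oo fps_inv \<rho>, subst1 (snd \<sigma>) \<phi> oo fps_inv \<rho>)"

definition A_equiv :: "nat \<Rightarrow> bigerm \<Rightarrow> bigerm \<Rightarrow> bool" where
  "A_equiv \<delta> \<phi> \<psi> \<longleftrightarrow> is_bigerm \<phi> \<and> is_bigerm \<psi> \<and>
     (\<exists>(\<rho>1, \<rho>2, \<sigma>) \<in> A_sub \<delta>. \<psi> = (act_germ \<rho>1 \<sigma> (fst \<phi>), act_germ \<rho>2 \<sigma> (snd \<phi>)))"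


subsection \<open>Invariants\<close>

definition nu :: "germ \<Rightarrow> fps2 \<Rightarrow> enat" where
  "nu \<phi> \<eta> = ord_t (subst1 \<eta> \<phi>)"

definition value_semigroup :: "bigerm \<Rightarrow> (enat \<times> enat) set" where
  "value_semigroup \<phi> = {(nu (fst \<phi>) \<eta>, nu (snd \<phi>) \<eta>) | \<eta>. \<eta> \<in> conv2}"

definition contains_quadrant :: "(enat \<times> enat) set \<Rightarrow> nat \<times> nat \<Rightarrow> bool" where
  "contains_quadrant \<Gamma> c \<longleftrightarrow> (\<forall>a1\<ge>fst c. \<forall>a2\<ge>snd c. (enat a1, enat a2) \<in> \<Gamma>)"

text \<open>
  The conductor is the least element, in the product order, among those \<open>c\<close> with
  \<open>c + \<nat>\<^sup>2 \<subseteq> \<Gamma>\<close>.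
\<close>

definition conductor :: "(enat \<times> enat) set \<Rightarrow> nat \<times> nat" where
  "conductor \<Gamma> = (THE c. contains_quadrant \<Gamma> c \<and>
     (\<forall>d. contains_quadrant \<Gamma> d \<longrightarrow> fst c \<le> fst d \<and> snd c \<le> snd d))"

text \<open>A pair \<open>(\<eta>1, \<eta>2)\<close> stands for the differential \<open>\<eta>1 dx + \<eta>2 dy\<close>.\<close>

definition pullback_form :: "fps2 \<times> fps2 \<Rightarrow> germ \<Rightarrow> complex fps" where
  "pullback_form \<omega> \<phi> =
     subst1 (fst \<omega>) \<phi> * fps_deriv (fst \<phi>) + subst1 (snd \<omega>) \<phi> * fps_deriv (snd \<phi>)"

definition nu_form :: "germ \<Rightarrow> fps2 \<times> fps2 \<Rightarrow> enat" where
  "nu_form \<phi> \<omega> = ord_t (pullback_form \<omega> \<phi>) + 1"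

definition Omega :: "nat \<Rightarrow> (fps2 \<times> fps2) set" where
  "Omega \<delta> = {(\<eta>1, const2 (\<beta> * (of_nat \<delta> - 1)) * var_y + \<eta>2) | \<eta>1 \<eta>2 \<beta>.
     \<eta>1 \<in> max_ideal_pow 2 \<and> \<eta>2 \<in> max_ideal_pow 2}"

definition Lambda :: "nat \<Rightarrow> bigerm \<Rightarrow> (enat \<times> enat) set" where
  "Lambda \<delta> \<phi> = {(nu_form (fst \<phi>) \<omega> - enat (mult_germ (fst \<phi>)),
                  nu_form (snd \<phi>) \<omega> - enat (mult_germ (snd \<phi>))) | \<omega>. \<omega> \<in> Omega \<delta>}"


subsection \<open>Puiseux forms with given invariants\<close>

definition puiseux_form :: "nat \<Rightarrow> bigerm \<Rightarrow> bool" where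
  "puiseux_form \<delta> \<phi> \<longleftrightarrow>
     (\<exists>a1 a2. (\<forall>i\<le>mult_germ (fst \<phi>). a1 $ i = 0) \<and> (\<forall>i\<le>mult_germ (snd \<phi>). a2 $ i = 0) \<and>
        fst \<phi> = (fps_X ^ mult_germ (fst \<phi>), a1) \<and>
        snd \<phi> = (if \<delta> = 1 then (a2, fps_X ^ mult_germ (snd \<phi>))
                 else (fps_X ^ mult_germ (snd \<phi>), a2)))"

definition terms_upto :: "nat \<Rightarrow> germ \<Rightarrow> bool" where
  "terms_upto c \<phi> \<longleftrightarrow> (\<forall>i>c. fst \<phi> $ i = 0 \<and> snd \<phi> $ i = 0)"

definition Sigma_set :: "nat \<Rightarrow> (enat \<times> enat) set \<Rightarrow> (enat \<times> enat) set \<Rightarrow> bigerm set" where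
  "Sigma_set \<delta> \<Gamma> \<Lambda> = {\<phi>. is_bigerm \<phi> \<and> puiseux_form \<delta> \<phi> \<and>
     (let c = max (fst (conductor \<Gamma>)) (snd (conductor \<Gamma>))
      in terms_upto c (fst \<phi>) \<and> terms_upto c (snd \<phi>)) \<and>
     value_semigroup \<phi> = \<Gamma> \<and> Lambda \<delta> \<phi> = \<Lambda>}"


subsection \<open>Fibers and maximal points\<close>

definition fiber1 :: "(enat \<times> enat) set \<Rightarrow> nat \<times> nat \<Rightarrow> (enat \<times> enat) set" where
  "fiber1 \<Lambda> a = {b \<in> \<Lambda>. fst b = enat (fst a) \<and> snd b > enat (snd a)}"

definition fiber2 :: "(enat \<times> enat) set \<Rightarrow> nat \<times> nat \<Rightarrow> (enat \<times> enat) set" where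
  "fiber2 \<Lambda> a = {b \<in> \<Lambda>. snd b = enat (snd a) \<and> fst b > enat (fst a)}"

definition maximal_points :: "(enat \<times> enat) set \<Rightarrow> (nat \<times> nat) set" where
  "maximal_points \<Lambda> = {k. (enat (fst k), enat (snd k)) \<in> \<Lambda> \<and>
     fiber1 \<Lambda> k = {} \<and> fiber2 \<Lambda> k = {}}"

end

theory Submission
  imports Defs
begin

text \<open>
  A form \<open>\<omega> = Q dx - P dy\<close> in \<open>\<Omega>[\<delta>]\<close> is dual to the vector field \<open>D = P \<partial>\<^sub>x + Q \<partial>\<^sub>y\<close>. On a branch in
  Puiseux form, \<open>D\<close> followed by the reparametrization that restores \<open>t\<^sup>m\<close> moves the other coordinate
  by \<open>\<plusminus> (\<omega> \<circ> \<phi>) / (m t\<^sup>m\<^sup>-\<^sup>1)\<close>, a series of order \<open>\<nu>(\<omega>) - m\<close>. Exponentiating \<open>D\<close> instead of applying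
  \<open>id + D\<close> makes the nonlinear corrections invisible up to that order, so a form with values
  \<open>(j, > j)\<close>, \<open>(> j, j)\<close> or \<open>(j, j)\<close> removes terms of degree \<open>j\<close>. As \<open>\<Lambda>[\<delta>]\<close> is invariant under the
  group, this can be iterated.

  Only finitely many degrees have to be treated, formally: series of high order on the two branches
  are restrictions of one convergent \<open>\<eta>\<close> in \<open>(x,y)\<^sup>2\<close> (Lagrange interpolation over the conjugates of
  the Puiseux series), so truncating a formal equivalence at high order and adding such an \<open>\<eta>\<close> to each
  component of the coordinate change gives a convergent equivalence with the truncated normal form.
\<close>

section \<open>Series in two variables\<close>

text \<open>Smallness of \<omega> on a branch says only that D is almost tangent to that branch; D
  itself need not be small there. The flow of a tangent field maps the branch to itself, so the
  error of the exponential is governed by the normal part of D alone, whereas id + D would also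
  leave the second order displacement along a curved branch. One coordinate change acts on both
  branches at once. A form with values (j, j) therefore shifts both coefficients of degree j in a
  fixed ratio and can clear only one of them. This is why a point of M removes a term on the first
  branch only; since a point of M has an empty second fiber, the shift on the second branch hits a
  coefficient that is allowed there. The forms are chosen once, on the original bigerm, and
  transported along the equivalence found so far, so values are never recomputed: all that is
  recorded about them is divisibility of pullbacks by powers of t. Working formally keeps radii of
  convergence out of the root extractions and compositions; the equivalence is made convergent only
  once, at the end.\<close>

definition order_ge :: "nat \<Rightarrow> fps2 \<Rightarrow> bool" where
  "order_ge k F \<longleftrightarrow> (\<forall>i j. i + j < k \<longrightarrow> coef2 F i j = 0)"

definition monom2 :: "complex \<Rightarrow> nat \<Rightarrow> nat \<Rightarrow> fps2" where
  "monom2 c i j = const2 c * var_x ^ i * var_y ^ j"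

text \<open>Truncation over a square of exponents instead of by total degree: it is a polynomial
  that agrees with F in all degrees up to k, and the square matches the partial sums used for norms
  and values.\<close>

definition trunc2 :: "nat \<Rightarrow> fps2 \<Rightarrow> fps2" where
  "trunc2 k F = (\<Sum>i\<le>k. \<Sum>j\<le>k. monom2 (coef2 F i j) i j)"

lemma fps2_eqI: "(\<And>i j. coef2 F i j = coef2 G i j) \<Longrightarrow> F = G"
  by (simp add: coef2_def fps_eq_iff)

lemma coef2_series2 [simp]: "coef2 (series2 f) i j = f i j"
  by (simp add: coef2_def series2_def)

lemma coef2_0 [simp]: "coef2 0 i j = 0"
  and coef2_add [simp]: "coef2 (F + G) i j = coef2 F i j + coef2 G i j"
  and coef2_diff [simp]: "coef2 (F - G) i j = coef2 F i j - coef2 G i j"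
  and coef2_uminus [simp]: "coef2 (- F) i j = - coef2 F i j"
  by (simp_all add: coef2_def)

lemma coef2_sum [simp]: "coef2 (sum f A) i j = (\<Sum>a\<in>A. coef2 (f a) i j)"
  by (simp add: coef2_def fps_sum_nth)

lemma coef2_mult:
  "coef2 (F * G) i j = (\<Sum>b\<le>j. \<Sum>a\<le>i. coef2 F a b * coef2 G (i - a) (j - b))"
  by (simp add: coef2_def fps_mult_nth fps_sum_nth atLeast0AtMost)

lemma coef2_fps_const: "coef2 (fps_const f) i j = (if j = 0 then f $ i else 0)"
  by (simp add: coef2_def)

lemma coef2_const2_mult [simp]: "coef2 (const2 c * F) i j = c * coef2 F i j"
  by (simp add: coef2_def const2_def)

lemma coef2_monom2: "coef2 (monom2 c i j) a b = (if a = i \<and> b = j then c else 0)"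
  by (simp add: monom2_def mult.assoc var_x_def var_y_def)
     (simp add: coef2_def fps_const_power fps_X_power_mult_right_nth fps_X_power_nth)

lemma const2_1 [simp]: "const2 1 = 1"
  by (simp add: const2_def)

lemma const2_0 [simp]: "const2 0 = 0"
  by (simp add: const2_def)

lemma const2_mult: "const2 (a * b) = const2 a * const2 b"
  by (simp add: const2_def)

lemma monom2_mult: "monom2 c i j * monom2 d k l = monom2 (c * d) (i + k) (j + l)"
  by (simp add: monom2_def const2_mult power_add algebra_simps)

lemma coef2_trunc2:
  "coef2 (trunc2 k F) a b = (if a \<le> k \<and> b \<le> k then coef2 F a b else 0)"
proof -
  have "coef2 (trunc2 k F) a b =
      (\<Sum>i\<le>k. \<Sum>j\<le>k. if i = a then (if j = b then coef2 F i j else 0) else 0)"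
    unfolding trunc2_def coef2_sum coef2_monom2 by (intro sum.cong refl) auto
  also have "\<dots> = (\<Sum>i\<le>k. if i = a then (\<Sum>j\<le>k. if j = b then coef2 F i j else 0) else 0)"
    by (intro sum.cong refl) simp
  also have "\<dots> = (if a \<le> k \<and> b \<le> k then coef2 F a b else 0)"
    by (simp add: sum.delta)
  finally show ?thesis .
qed

lemma order_ge_0 [simp]: "order_ge k 0"
  and order_ge_zero [simp]: "order_ge 0 F"
  by (simp_all add: order_ge_def)

lemma order_ge_add: "order_ge k F \<Longrightarrow> order_ge k G \<Longrightarrow> order_ge k (F + G)"
  and order_ge_diff: "order_ge k F \<Longrightarrow> order_ge k G \<Longrightarrow> order_ge k (F - G)"
  and order_ge_uminus: "order_ge k F \<Longrightarrow> order_ge k (- F)"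
  and order_ge_const_mult: "order_ge k F \<Longrightarrow> order_ge k (const2 c * F)"
  by (simp_all add: order_ge_def)

lemma order_ge_sum: "(\<And>a. a \<in> A \<Longrightarrow> order_ge k (f a)) \<Longrightarrow> order_ge k (sum f A)"
  by (simp add: order_ge_def)

lemma order_ge_mono: "order_ge k F \<Longrightarrow> l \<le> k \<Longrightarrow> order_ge l F"
  by (auto simp: order_ge_def)

lemma order_ge_mult: "order_ge k F \<Longrightarrow> order_ge l G \<Longrightarrow> order_ge (k + l) (F * G)"
  unfolding order_ge_def coef2_mult
proof (intro allI impI sum.neutral ballI)
  fix i j a b
  assume F: "\<forall>i j. i + j < k \<longrightarrow> coef2 F i j = 0" and G: "\<forall>i j. i + j < l \<longrightarrow> coef2 G i j = 0"
    and "i + j < k + l" "b \<in> {..j}" "a \<in> {..i}"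
  then have "a + b < k \<or> (i - a) + (j - b) < l"
    by auto
  then show "coef2 F a b * coef2 G (i - a) (j - b) = 0"
    using F G by auto
qed

lemma order_ge_mult1: "order_ge k F \<Longrightarrow> order_ge k (F * G)"
  using order_ge_mult[of k F 0 G] by simp

lemma order_ge_mult2: "order_ge k G \<Longrightarrow> order_ge k (F * G)"
  using order_ge_mult[of 0 F k G] by simp

lemma order_ge_power: "order_ge 1 F \<Longrightarrow> order_ge n (F ^ n)"
proof (induction n)
  case (Suc n)
  then show ?case
    using order_ge_mult[of 1 F n "F ^ n"] by simp
qed simp

lemma order_ge_var [unfolded One_nat_def, simp]: "order_ge 1 var_x" "order_ge 1 var_y"
  by (auto simp: order_ge_def var_x_def var_y_def coef2_def)

lemma order_ge_diff_trunc2: "order_ge (Suc k) (F - trunc2 k F)"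
  by (simp add: order_ge_def coef2_trunc2)

lemma order_ge_all_imp_0:
  assumes "\<And>k. order_ge k F"
  shows "F = 0"
proof (rule fps2_eqI)
  show "coef2 F i j = coef2 0 i j" for i j
    using assms[of "Suc (i + j)"] by (simp add: order_ge_def)
qed

text \<open>An additive map that is continuous for the adic topology is determined by its values on
  monomials.\<close>

lemma additive_eq_0_on_fps2:
  fixes f :: "fps2 \<Rightarrow> 'a :: ab_group_add"
  assumes add: "\<And>F G. f (F + G) = f F + f G"
    and mon: "\<And>c i j. f (monom2 c i j) = 0"
    and ord: "\<And>k F. order_ge (Suc k) F \<Longrightarrow> P k (f F)"
    and sep: "\<And>z. (\<And>k. P k z) \<Longrightarrow> z = 0"
  shows "f F = 0"
proof (rule sep)
  fix k
  have f0: "f 0 = 0"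
    using add[of 0 0] by simp
  have fsum: "f (sum g A) = (\<Sum>a\<in>A. f (g a))" for g :: "nat \<Rightarrow> fps2" and A
    by (induction A rule: infinite_finite_induct) (simp_all add: add f0)
  have "f F = f (trunc2 k F + (F - trunc2 k F))"
    by simp
  also have "\<dots> = f (trunc2 k F) + f (F - trunc2 k F)"
    by (rule add)
  also have "f (trunc2 k F) = 0"
    by (simp add: trunc2_def fsum mon)
  finally show "P k (f F)"
    using ord[OF order_ge_diff_trunc2[of k F]] by simp
qed


section \<open>Substitution\<close>

definition no_const :: "fps2 \<times> fps2 \<Rightarrow> bool" where
  "no_const \<sigma> \<longleftrightarrow> order_ge 1 (fst \<sigma>) \<and> order_ge 1 (snd \<sigma>)"

lemma no_const_Pair [simp]: "no_const (F, G) \<longleftrightarrow> order_ge 1 F \<and> order_ge 1 G"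
  by (simp add: no_const_def)

lemma order_ge_monomial: "no_const \<sigma> \<Longrightarrow> order_ge (i + j) (fst \<sigma> ^ i * snd \<sigma> ^ j)"
  by (intro order_ge_mult order_ge_power) (auto simp: no_const_def)

lemma coef2_monomial_0: "no_const \<sigma> \<Longrightarrow> a + b < i + j \<Longrightarrow> coef2 (fst \<sigma> ^ i * snd \<sigma> ^ j) a b = 0"
  using order_ge_monomial[of \<sigma> i j] by (auto simp: order_ge_def)

text \<open>High powers of series without constant term do not reach the given coefficient, so the
  square of exponents may be enlarged at will. A bound K common to many coefficients is what the
  estimates of whole partial sums require.\<close>

lemma coef2_subst2:
  assumes "no_const \<sigma>" "a + b \<le> K"
  shows "coef2 (subst2 F \<sigma>) a b =
    (\<Sum>i\<le>K. \<Sum>j\<le>K. coef2 F i j * coef2 (fst \<sigma> ^ i * snd \<sigma> ^ j) a b)"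
proof -
  have "(\<Sum>i\<le>a + b. \<Sum>j\<le>a + b. coef2 F i j * coef2 (fst \<sigma> ^ i * snd \<sigma> ^ j) a b) =
      (\<Sum>i\<le>a + b. \<Sum>j\<le>K. coef2 F i j * coef2 (fst \<sigma> ^ i * snd \<sigma> ^ j) a b)"
    using assms by (intro sum.cong[OF refl] sum.mono_neutral_left) (auto intro!: coef2_monomial_0)
  also have "\<dots> = (\<Sum>i\<le>K. \<Sum>j\<le>K. coef2 F i j * coef2 (fst \<sigma> ^ i * snd \<sigma> ^ j) a b)"
    using assms
    by (intro sum.mono_neutral_left) (auto intro!: sum.neutral coef2_monomial_0)
  finally show ?thesis
    by (simp add: subst2_def)
qed

lemma subst2_add: "subst2 (F + G) \<sigma> = subst2 F \<sigma> + subst2 G \<sigma>"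
  by (rule fps2_eqI) (simp add: subst2_def algebra_simps sum.distrib)

lemma subst2_0 [simp]: "subst2 0 \<sigma> = 0"
  by (rule fps2_eqI) (simp add: subst2_def)

lemma subst2_const_mult: "subst2 (const2 c * F) \<sigma> = const2 c * subst2 F \<sigma>"
  by (rule fps2_eqI) (simp add: subst2_def sum_distrib_left mult.assoc)

lemma const2_uminus_1: "const2 (- 1) * F = - F"
  by (rule fps2_eqI) simp

lemma subst2_uminus: "subst2 (- F) \<sigma> = - subst2 F \<sigma>"
  using subst2_const_mult[of "-1" F \<sigma>] by (simp add: const2_uminus_1)

lemma subst2_diff: "subst2 (F - G) \<sigma> = subst2 F \<sigma> - subst2 G \<sigma>"
  using subst2_add[of F "- G" \<sigma>] by (simp add: subst2_uminus)

lemma subst2_sum: "subst2 (sum f A) \<sigma> = (\<Sum>a\<in>A. subst2 (f a) \<sigma>)"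
  by (induction A rule: infinite_finite_induct) (simp_all add: subst2_add)

lemma order_ge_subst2: "no_const \<sigma> \<Longrightarrow> order_ge k F \<Longrightarrow> order_ge k (subst2 F \<sigma>)"
  unfolding order_ge_def
proof (intro allI impI)
  fix a b assume \<sigma>: "no_const \<sigma>" and F: "\<forall>i j. i + j < k \<longrightarrow> coef2 F i j = 0" and "a + b < k"
  then have "coef2 F i j * coef2 (fst \<sigma> ^ i * snd \<sigma> ^ j) a b = 0" for i j
    by (cases "i + j < k") (auto intro!: coef2_monomial_0)
  then show "coef2 (subst2 F \<sigma>) a b = 0"
    unfolding coef2_subst2[OF \<sigma> order.refl] coef2_0 by (intro sum.neutral ballI)
qed

lemma subst2_monom2:
  assumes "no_const \<sigma>"
  shows "subst2 (monom2 c i j) \<sigma> = const2 c * (fst \<sigma> ^ i * snd \<sigma> ^ j)"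
proof (rule fps2_eqI)
  fix a b
  define K where "K = a + b + i + j"
  have "coef2 (subst2 (monom2 c i j) \<sigma>) a b =
      (\<Sum>p\<le>K. \<Sum>q\<le>K. if p = i then (if q = j then c * coef2 (fst \<sigma> ^ i * snd \<sigma> ^ j) a b else 0) else 0)"
    unfolding coef2_subst2[OF assms, of a b K F for F, unfolded K_def, simplified, folded K_def]
    by (intro sum.cong refl) (auto simp: coef2_monom2)
  also have "\<dots> = (\<Sum>p\<le>K. if p = i then (\<Sum>q\<le>K. if q = j then c * coef2 (fst \<sigma> ^ i * snd \<sigma> ^ j) a b else 0) else 0)"
    by (intro sum.cong refl) simp
  also have "\<dots> = c * coef2 (fst \<sigma> ^ i * snd \<sigma> ^ j) a b"
    by (simp add: sum.delta K_def)
  finally show "coef2 (subst2 (monom2 c i j) \<sigma>) a b = coef2 (const2 c * (fst \<sigma> ^ i * snd \<sigma> ^ j)) a b"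
    by simp
qed

text \<open>Both sides are biadditive and adically continuous, so the density argument is applied
  twice: first in F against a fixed monomial, then in G for arbitrary F.\<close>

lemma subst2_mult:
  assumes "no_const \<sigma>"
  shows "subst2 (F * G) \<sigma> = subst2 F \<sigma> * subst2 G \<sigma>"
proof -
  have mon: "subst2 (monom2 c i j * monom2 d k l) \<sigma> = subst2 (monom2 c i j) \<sigma> * subst2 (monom2 d k l) \<sigma>"
    for c d i j k l
    unfolding monom2_mult subst2_monom2[OF assms]
    by (simp add: const2_mult power_add algebra_simps)
  have sep: "(\<And>k. order_ge k z) \<Longrightarrow> z = 0" for z
    by (rule order_ge_all_imp_0)
  note simps = subst2_add algebra_simps
  have 1: "subst2 (F * monom2 d k l) \<sigma> - subst2 F \<sigma> * subst2 (monom2 d k l) \<sigma> = 0" for F d k l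
    by (rule additive_eq_0_on_fps2[where P = order_ge
          and f = "\<lambda>F. subst2 (F * monom2 d k l) \<sigma> - subst2 F \<sigma> * subst2 (monom2 d k l) \<sigma>", OF _ _ _ sep])
       (auto simp: simps mon intro!: order_ge_diff order_ge_subst2 order_ge_mult1 assms
             elim: order_ge_mono)
  have "subst2 (F * G) \<sigma> - subst2 F \<sigma> * subst2 G \<sigma> = 0"
  proof (rule additive_eq_0_on_fps2[where f = "\<lambda>G. subst2 (F * G) \<sigma> - subst2 F \<sigma> * subst2 G \<sigma>" and P = order_ge, OF _ _ _ sep])
    show "order_ge k (subst2 (F * G) \<sigma> - subst2 F \<sigma> * subst2 G \<sigma>)" if "order_ge (Suc k) G" for k G
      using order_ge_mono[OF that, of k]
      by (auto intro!: order_ge_diff order_ge_subst2 order_ge_mult2 assms)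
  qed (use 1 in \<open>auto simp: simps\<close>)
  then show ?thesis
    by simp
qed

lemma subst2_var: 
  assumes "no_const \<sigma>"
  shows "subst2 var_x \<sigma> = fst \<sigma>" "subst2 var_y \<sigma> = snd \<sigma>"
  using subst2_monom2[OF assms, of 1 1 0] subst2_monom2[OF assms, of 1 0 1] by (simp_all add: monom2_def)

lemma subst2_1: "no_const \<sigma> \<Longrightarrow> subst2 1 \<sigma> = 1"
  using subst2_monom2[of \<sigma> 1 0 0] by (simp add: monom2_def)

lemma subst2_const2: "no_const \<sigma> \<Longrightarrow> subst2 (const2 c) \<sigma> = const2 c"
  using subst2_monom2[of \<sigma> c 0 0] by (simp add: monom2_def)

lemma subst2_power: "no_const \<sigma> \<Longrightarrow> subst2 (F ^ n) \<sigma> = subst2 F \<sigma> ^ n"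
  by (induction n) (simp_all add: subst2_1 subst2_mult)

lemma subst2_prod: "no_const \<sigma> \<Longrightarrow> subst2 (prod f A) \<sigma> = (\<Prod>a\<in>A. subst2 (f a) \<sigma>)"
  by (induction A rule: infinite_finite_induct) (simp_all add: subst2_1 subst2_mult)

lemma no_const_comp2: "no_const \<sigma> \<Longrightarrow> no_const \<tau> \<Longrightarrow> no_const (comp2 \<sigma> \<tau>)"
  by (auto simp: no_const_def[of \<sigma>] comp2_def intro!: order_ge_subst2)

lemma subst2_subst2:
  assumes "no_const \<sigma>" "no_const \<tau>"
  shows "subst2 (subst2 F \<sigma>) \<tau> = subst2 F (comp2 \<sigma> \<tau>)"
proof -
  note nc = assms no_const_comp2[OF assms]
  have "subst2 (subst2 F \<sigma>) \<tau> - subst2 F (comp2 \<sigma> \<tau>) = 0"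
  proof (rule additive_eq_0_on_fps2[where P = order_ge
        and f = "\<lambda>F. subst2 (subst2 F \<sigma>) \<tau> - subst2 F (comp2 \<sigma> \<tau>)", OF _ _ _ order_ge_all_imp_0])
    show "order_ge k (subst2 (subst2 F \<sigma>) \<tau> - subst2 F (comp2 \<sigma> \<tau>))" if "order_ge (Suc k) F" for k F
      using order_ge_mono[OF that, of k] nc by (auto intro!: order_ge_diff order_ge_subst2)
    show "subst2 (subst2 (monom2 c i j) \<sigma>) \<tau> - subst2 (monom2 c i j) (comp2 \<sigma> \<tau>) = 0" for c i j
      unfolding subst2_monom2[OF nc(1)] subst2_monom2[OF nc(3)]
      by (simp add: subst2_const_mult subst2_mult subst2_power comp2_def assms)
  qed (auto simp: subst2_add)
  then show ?thesis
    by simp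
qed

lemma comp2_assoc:
  "no_const \<sigma> \<Longrightarrow> no_const \<tau> \<Longrightarrow> comp2 (comp2 \<rho> \<sigma>) \<tau> = comp2 \<rho> (comp2 \<sigma> \<tau>)"
  by (simp add: comp2_def subst2_subst2)

lemma subst2_id: "subst2 F (var_x, var_y) = F"
proof -
  have nc: "no_const (var_x, var_y)"
    by (simp add: order_ge_var)
  have "subst2 F (var_x, var_y) - F = 0"
    by (rule additive_eq_0_on_fps2[where P = order_ge and f = "\<lambda>F. subst2 F (var_x, var_y) - F",
          OF _ _ _ order_ge_all_imp_0])
       (auto simp: subst2_add subst2_monom2[OF nc, unfolded fst_conv snd_conv] monom2_def[symmetric] mult.assoc[symmetric]
        intro!: order_ge_diff order_ge_subst2 nc elim: order_ge_mono)
  then show ?thesis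
    by simp
qed

lemma comp2_id_right: "comp2 \<sigma> (var_x, var_y) = \<sigma>"
  and comp2_id_left: "no_const \<sigma> \<Longrightarrow> comp2 (var_x, var_y) \<sigma> = \<sigma>"
  by (simp_all add: comp2_def subst2_id subst2_var)


section \<open>Substitution of germs\<close>

text \<open>Embedding \<^typ>\<open>complex fps\<close> by \<^const>\<open>fps_const\<close> makes \<^const>\<open>subst1\<close> an instance
  of \<^const>\<open>subst2\<close>.\<close>

definition germ2 :: "germ \<Rightarrow> fps2 \<times> fps2" where
  "germ2 \<phi> = (fps_const (fst \<phi>), fps_const (snd \<phi>))"

definition centered :: "germ \<Rightarrow> bool" where
  "centered \<phi> \<longleftrightarrow> fst \<phi> $ 0 = 0 \<and> snd \<phi> $ 0 = 0"

lemma centered_Pair [simp]: "centered (a, b) \<longleftrightarrow> a $ 0 = 0 \<and> b $ 0 = 0"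
  by (simp add: centered_def)

lemma fps_X_power_dvd_iff: "fps_X ^ k dvd (f :: complex fps) \<longleftrightarrow> (\<forall>i<k. f $ i = 0)"
proof
  assume "fps_X ^ k dvd f"
  then show "\<forall>i<k. f $ i = 0"
    by (auto simp: dvd_def fps_X_power_mult_nth)
next
  assume "\<forall>i<k. f $ i = 0"
  then have "f = fps_X ^ k * fps_shift k f"
    by (intro fps_ext) (auto simp: fps_X_power_mult_nth)
  then show "fps_X ^ k dvd f"
    by (metis dvd_triv_left)
qed

lemma fps_X_power_dvd_all_imp_0: "(\<And>k. fps_X ^ k dvd (f :: complex fps)) \<Longrightarrow> f = 0"
  by (rule fps_ext) (auto simp: fps_X_power_dvd_iff)

lemma order_ge_fps_const: "order_ge k (fps_const f) \<longleftrightarrow> fps_X ^ k dvd f"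
  by (auto simp: order_ge_def coef2_fps_const fps_X_power_dvd_iff)

lemma no_const_germ2: "no_const (germ2 \<phi>) \<longleftrightarrow> centered \<phi>"
  by (auto simp: germ2_def order_ge_fps_const centered_def fps_X_power_dvd_iff[of 1, simplified])

lemma subst2_germ2: "subst2 F (germ2 \<phi>) = fps_const (subst1 F \<phi>)"
  by (rule fps2_eqI)
     (simp add: subst2_def subst1_def germ2_def fps_const_power coef2_fps_const fps_const_mult)

lemma subst1_eq: "subst1 F \<phi> = subst2 F (germ2 \<phi>) $ 0"
  by (simp add: subst2_germ2)

lemma subst1_add: "subst1 (F + G) \<phi> = subst1 F \<phi> + subst1 G \<phi>"
  and subst1_diff: "subst1 (F - G) \<phi> = subst1 F \<phi> - subst1 G \<phi>"
  and subst1_uminus: "subst1 (- F) \<phi> = - subst1 F \<phi>"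
  by (simp_all add: subst1_eq subst2_add subst2_diff subst2_uminus)

lemma subst1_0 [simp]: "subst1 0 \<phi> = 0"
  using subst1_diff[of 0 0 \<phi>] by simp

lemma subst1_sum: "subst1 (sum f A) \<phi> = (\<Sum>a\<in>A. subst1 (f a) \<phi>)"
  by (induction A rule: infinite_finite_induct) (simp_all add: subst1_add)

lemma subst1_mult: "centered \<phi> \<Longrightarrow> subst1 (F * G) \<phi> = subst1 F \<phi> * subst1 G \<phi>"
  using subst2_mult[of "germ2 \<phi>" F G] by (simp add: no_const_germ2 subst2_germ2)

lemma subst1_1: "centered \<phi> \<Longrightarrow> subst1 1 \<phi> = 1"
  using subst2_1[of "germ2 \<phi>"] by (simp add: no_const_germ2 subst2_germ2)

lemma subst1_const2: "centered \<phi> \<Longrightarrow> subst1 (const2 c) \<phi> = fps_const c"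
  using subst2_const2[of "germ2 \<phi>"] by (simp add: no_const_germ2 subst2_germ2 const2_def)

lemma subst1_power: "centered \<phi> \<Longrightarrow> subst1 (F ^ n) \<phi> = subst1 F \<phi> ^ n"
  by (induction n) (simp_all add: subst1_1 subst1_mult)

lemma subst1_prod: "centered \<phi> \<Longrightarrow> subst1 (prod f A) \<phi> = (\<Prod>a\<in>A. subst1 (f a) \<phi>)"
  by (induction A rule: infinite_finite_induct) (simp_all add: subst1_1 subst1_mult)

lemma subst1_var:
  assumes "centered \<phi>"
  shows "subst1 var_x \<phi> = fst \<phi>" "subst1 var_y \<phi> = snd \<phi>"
  using subst2_var[of "germ2 \<phi>"] assms by (simp_all add: no_const_germ2 subst2_germ2) (simp_all add: germ2_def)

lemma subst1_monom2: "centered \<phi> \<Longrightarrow> subst1 (monom2 c i j) \<phi> = fps_const c * (fst \<phi> ^ i * snd \<phi> ^ j)"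
  by (simp add: monom2_def subst1_mult subst1_power subst1_var subst1_const2 mult.assoc)

lemma fps_X_power_dvd_subst1: "centered \<phi> \<Longrightarrow> order_ge k F \<Longrightarrow> fps_X ^ k dvd subst1 F \<phi>"
  using order_ge_subst2[of "germ2 \<phi>" k F] by (simp add: no_const_germ2 subst2_germ2 order_ge_fps_const)

lemma subst1_fps_const: "centered \<phi> \<Longrightarrow> subst1 (fps_const f) \<phi> = f oo fst \<phi>"
  by (rule fps_ext)
     (simp add: subst1_def fps_compose_nth coef2_fps_const if_distrib[of "\<lambda>x. x * _"]
        sum.delta atLeast0AtMost cong: if_cong)

definition germ_image :: "fps2 \<times> fps2 \<Rightarrow> germ \<Rightarrow> germ" where
  "germ_image \<sigma> \<phi> = (subst1 (fst \<sigma>) \<phi>, subst1 (snd \<sigma>) \<phi>)"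

definition germ_comp :: "germ \<Rightarrow> complex fps \<Rightarrow> germ" where
  "germ_comp \<phi> \<rho> = (fst \<phi> oo \<rho>, snd \<phi> oo \<rho>)"

lemma subst1_subst2:
  assumes "no_const \<sigma>" "centered \<phi>"
  shows "subst1 (subst2 F \<sigma>) \<phi> = subst1 F (germ_image \<sigma> \<phi>)"
proof -
  have "comp2 \<sigma> (germ2 \<phi>) = germ2 (germ_image \<sigma> \<phi>)"
    by (simp add: comp2_def subst2_germ2) (simp add: germ_image_def germ2_def)
  then show ?thesis
    using subst2_subst2[of \<sigma> "germ2 \<phi>" F] assms
    by (simp add: no_const_germ2 subst2_germ2)
qed

lemma germ_image_comp2:
  "no_const \<sigma> \<Longrightarrow> centered \<phi> \<Longrightarrow> germ_image (comp2 \<tau> \<sigma>) \<phi> = germ_image \<tau> (germ_image \<sigma> \<phi>)"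
  by (simp add: germ_image_def[of _ \<phi>] comp2_def subst1_subst2) (simp add: germ_image_def)

lemma germ_image_id: "centered \<phi> \<Longrightarrow> germ_image (var_x, var_y) \<phi> = \<phi>"
  by (simp add: germ_image_def subst1_var)

lemma centered_germ_image: "no_const \<sigma> \<Longrightarrow> centered \<phi> \<Longrightarrow> centered (germ_image \<sigma> \<phi>)"
  using fps_X_power_dvd_subst1[of \<phi> 1]
  by (auto simp: no_const_def germ_image_def fps_X_power_dvd_iff[of 1, simplified])

lemma centered_germ_comp: "centered \<phi> \<Longrightarrow> centered (germ_comp \<phi> \<rho>)"
  by (simp add: centered_def germ_comp_def)

lemma fps_X_power_dvd_compose:
  assumes "\<rho> $ 0 = 0" "fps_X ^ k dvd (f :: complex fps)"
  shows "fps_X ^ k dvd (f oo \<rho>)"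
proof -
  obtain g where "f = fps_X ^ k * g"
    using assms(2) by (auto elim: dvdE)
  then have "f oo \<rho> = \<rho> ^ k * (g oo \<rho>)"
    using assms(1) by (simp add: fps_compose_mult_distrib fps_X_power_compose)
  moreover have "fps_X ^ k dvd \<rho> ^ k"
    using assms(1) by (intro dvd_power_same) (auto simp: fps_X_power_dvd_iff[of 1, simplified])
  ultimately show ?thesis
    by simp
qed

lemma subst1_germ_comp:
  assumes "centered \<phi>" "\<rho> $ 0 = 0"
  shows "subst1 F (germ_comp \<phi> \<rho>) = subst1 F \<phi> oo \<rho>"
proof -
  note c = centered_germ_comp[OF assms(1), of \<rho>]
  have "subst1 F (germ_comp \<phi> \<rho>) - (subst1 F \<phi> oo \<rho>) = 0"
  proof (rule additive_eq_0_on_fps2[where P = "\<lambda>k f. fps_X ^ k dvd f"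
        and f = "\<lambda>F. subst1 F (germ_comp \<phi> \<rho>) - (subst1 F \<phi> oo \<rho>)", OF _ _ _ fps_X_power_dvd_all_imp_0])
    show "fps_X ^ k dvd subst1 F (germ_comp \<phi> \<rho>) - (subst1 F \<phi> oo \<rho>)" if "order_ge (Suc k) F" for k F
      using order_ge_mono[OF that, of k] assms c
      by (auto intro!: dvd_diff fps_X_power_dvd_compose fps_X_power_dvd_subst1)
    show "subst1 (monom2 a i j) (germ_comp \<phi> \<rho>) - (subst1 (monom2 a i j) \<phi> oo \<rho>) = 0" for a i j
      using c assms
      by (simp add: subst1_monom2 fps_compose_mult_distrib flip: fps_compose_power)
         (simp add: germ_comp_def fps_compose_power)
  qed (auto simp: subst1_add fps_compose_add_distrib)
  then show ?thesis
    by simp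
qed

lemma germ_image_germ_comp:
  "centered \<phi> \<Longrightarrow> \<rho> $ 0 = 0 \<Longrightarrow> germ_image \<sigma> (germ_comp \<phi> \<rho>) = germ_comp (germ_image \<sigma> \<phi>) \<rho>"
  by (simp add: germ_image_def subst1_germ_comp) (simp add: germ_comp_def)


section \<open>Partial derivatives\<close>

definition deriv_x :: "fps2 \<Rightarrow> fps2" where
  "deriv_x F = series2 (\<lambda>i j. of_nat (Suc i) * coef2 F (Suc i) j)"

definition deriv_y :: "fps2 \<Rightarrow> fps2" where
  "deriv_y F = series2 (\<lambda>i j. of_nat (Suc j) * coef2 F i (Suc j))"

lemma deriv_x_add: "deriv_x (F + G) = deriv_x F + deriv_x G"
  and deriv_y_add: "deriv_y (F + G) = deriv_y F + deriv_y G"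
  by (rule fps2_eqI; simp add: deriv_x_def deriv_y_def algebra_simps)+

lemma order_ge_deriv_x: "order_ge (Suc k) F \<Longrightarrow> order_ge k (deriv_x F)"
  and order_ge_deriv_y: "order_ge (Suc k) F \<Longrightarrow> order_ge k (deriv_y F)"
  by (simp_all add: order_ge_def deriv_x_def deriv_y_def)

lemma deriv_x_monom2: "deriv_x (monom2 c i j) = monom2 (c * of_nat i) (i - 1) j"
  and deriv_y_monom2: "deriv_y (monom2 c i j) = monom2 (c * of_nat j) i (j - 1)"
  by (rule fps2_eqI; auto simp: deriv_x_def deriv_y_def coef2_monom2)+

lemma deriv_var [simp]: "deriv_x var_x = 1" "deriv_x var_y = 0" "deriv_y var_x = 0" "deriv_y var_y = 1"
  using deriv_x_monom2[of 1 1 0] deriv_x_monom2[of 1 0 1] deriv_y_monom2[of 1 1 0] deriv_y_monom2[of 1 0 1]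
  by (simp_all add: monom2_def)

lemma subst1_chain_rule:
  assumes "centered \<phi>"
  shows "fps_deriv (subst1 F \<phi>) =
    subst1 (deriv_x F) \<phi> * fps_deriv (fst \<phi>) + subst1 (deriv_y F) \<phi> * fps_deriv (snd \<phi>)"
proof -
  have "fps_deriv (subst1 F \<phi>) -
    (subst1 (deriv_x F) \<phi> * fps_deriv (fst \<phi>) + subst1 (deriv_y F) \<phi> * fps_deriv (snd \<phi>)) = 0"
  proof (rule additive_eq_0_on_fps2[where P = "\<lambda>k f. fps_X ^ k dvd f"
        and f = "\<lambda>F. fps_deriv (subst1 F \<phi>) -
          (subst1 (deriv_x F) \<phi> * fps_deriv (fst \<phi>) + subst1 (deriv_y F) \<phi> * fps_deriv (snd \<phi>))",
        OF _ _ _ fps_X_power_dvd_all_imp_0])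
    show "fps_X ^ k dvd fps_deriv (subst1 F \<phi>) -
       (subst1 (deriv_x F) \<phi> * fps_deriv (fst \<phi>) + subst1 (deriv_y F) \<phi> * fps_deriv (snd \<phi>))"
      if F: "order_ge (Suc k) F" for k F
    proof -
      \<comment> \<open>Differentiation costs one order; the \<open>Suc k\<close> in
        \<open>additive_eq_0_on_fps2\<close> pays for it.\<close>
      have "fps_X ^ k dvd fps_deriv (subst1 F \<phi>)"
        using fps_X_power_dvd_subst1[OF assms F] unfolding fps_X_power_dvd_iff by simp
      then show ?thesis
        using order_ge_deriv_x[OF F] order_ge_deriv_y[OF F] assms
        by (auto intro!: dvd_diff dvd_add dvd_mult2 fps_X_power_dvd_subst1)
    qed
    show "fps_deriv (subst1 (monom2 c i j) \<phi>) - (subst1 (deriv_x (monom2 c i j)) \<phi> * fps_deriv (fst \<phi>) +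
        subst1 (deriv_y (monom2 c i j)) \<phi> * fps_deriv (snd \<phi>)) = 0" for c i j
      unfolding deriv_x_monom2 deriv_y_monom2 subst1_monom2[OF assms]
      by (simp add: fps_deriv_power algebra_simps fps_of_nat flip: fps_const_mult)
  qed (auto simp: subst1_add deriv_x_add deriv_y_add algebra_simps)
  then show ?thesis
    by simp
qed


section \<open>Convergence\<close>

abbreviation box_norm :: "real \<Rightarrow> nat \<Rightarrow> fps2 \<Rightarrow> real" where
  "box_norm r K F \<equiv> (\<Sum>i\<le>K. \<Sum>j\<le>K. norm (coef2 F i j) * r ^ i * r ^ j)"

text \<open>For \<open>0 \<le> r\<close> this says that the weighted l1 norm of F at radius r is at
  most C. Finite squares stand in for the infinite sum, so that all estimates are inequalities
  between finite sums.\<close>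

definition majorized :: "real \<Rightarrow> real \<Rightarrow> fps2 \<Rightarrow> bool" where
  "majorized r C F \<longleftrightarrow> (\<forall>K. box_norm r K F \<le> C)"

lemma majorizedD: "majorized r C F \<Longrightarrow> box_norm r K F \<le> C"
  by (simp add: majorized_def)

lemma majorized_nonneg: "majorized r C F \<Longrightarrow> 0 \<le> C"
  using majorizedD[of r C F 0] by (simp add: order_trans[OF norm_ge_zero])

lemma majorized_mono: "majorized r C F \<Longrightarrow> C \<le> D \<Longrightarrow> majorized r D F"
  by (auto simp: majorized_def intro: order_trans)

lemma majorized_coef_le:
  assumes "majorized r C F" "0 \<le> r" "\<And>i j. norm (coef2 G i j) \<le> norm (coef2 F i j)"
  shows "majorized r C G"
  unfolding majorized_def
proof
  fix K
  have "box_norm r K G \<le> box_norm r K F"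
    using assms by (intro sum_mono mult_right_mono) auto
  then show "box_norm r K G \<le> C"
    using majorizedD[OF assms(1), of K] by simp
qed

lemma majorized_add:
  assumes "majorized r C F" "majorized r D G" "0 \<le> r"
  shows "majorized r (C + D) (F + G)"
  unfolding majorized_def
proof
  fix K
  have "box_norm r K (F + G) \<le>
      (\<Sum>i\<le>K. \<Sum>j\<le>K. (norm (coef2 F i j) + norm (coef2 G i j)) * r ^ i * r ^ j)"
    using assms(3) by (intro sum_mono mult_right_mono) (auto intro: norm_triangle_ineq)
  also have "\<dots> \<le> C + D"
    using majorizedD[OF assms(1), of K] majorizedD[OF assms(2), of K]
    by (simp add: algebra_simps sum.distrib)
  finally show "box_norm r K (F + G) \<le> C + D" .
qed

lemma majorized_const_mult: "majorized r C F \<Longrightarrow> majorized r (norm c * C) (const2 c * F)"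
  using mult_left_mono[of "\<Sum>i\<le>K. \<Sum>j\<le>K. norm (coef2 F i j) * r ^ i * r ^ j" C "norm c" for K]
  by (simp add: majorized_def norm_mult sum_distrib_left mult.assoc)

text \<open>The pairs with sum at most K lie in the square, and the other terms of the square are
  nonnegative.\<close>

lemma sum_convolution_le:
  fixes f :: "nat \<Rightarrow> nat \<Rightarrow> real"
  assumes "\<And>a b. 0 \<le> f a b"
  shows "(\<Sum>i\<le>K. \<Sum>a\<le>i. f a (i - a)) \<le> (\<Sum>a\<le>K. \<Sum>b\<le>K. f a b)"
proof -
  have "(\<Sum>i\<le>K. \<Sum>a\<le>i. f a (i - a)) = (\<Sum>(a, b)\<in>{(a, b). a + b \<le> K}. f a b)"
    by (rule sum.triangle_reindex_eq[symmetric])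
  also have "\<dots> \<le> (\<Sum>(a, b)\<in>{..K} \<times> {..K}. f a b)"
    using assms by (intro sum_mono2) auto
  finally show ?thesis
    by (simp add: sum.cartesian_product)
qed

text \<open>The weighted l1 norm is submultiplicative. For partial sums this amounts to two uses of
  \<open>sum_convolution_le\<close>, one for each variable.\<close>

lemma majorized_mult:
  assumes F: "majorized r C F" and G: "majorized r D G" and "0 \<le> r"
  shows "majorized r (C * D) (F * G)"
  unfolding majorized_def
proof
  fix K
  define f where "f i j = norm (coef2 F i j) * r ^ i * r ^ j" for i j
  define g where "g i j = norm (coef2 G i j) * r ^ i * r ^ j" for i j
  have nn: "0 \<le> f i j" "0 \<le> g i j" for i j
    using \<open>0 \<le> r\<close> by (simp_all add: f_def g_def)
  have "norm (coef2 (F * G) i j) * r ^ i * r ^ j \<le> (\<Sum>b\<le>j. \<Sum>a\<le>i. f a b * g (i - a) (j - b))" for i j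
  proof -
    have "norm (coef2 (F * G) i j) \<le> (\<Sum>b\<le>j. \<Sum>a\<le>i. norm (coef2 F a b) * norm (coef2 G (i - a) (j - b)))"
      unfolding coef2_mult by (intro order_trans[OF norm_sum] sum_mono) (simp add: norm_mult)
    then have "norm (coef2 (F * G) i j) * (r ^ i * r ^ j) \<le>
        (\<Sum>b\<le>j. \<Sum>a\<le>i. norm (coef2 F a b) * norm (coef2 G (i - a) (j - b))) * (r ^ i * r ^ j)"
      using \<open>0 \<le> r\<close> by (intro mult_right_mono) auto
    also have "\<dots> = (\<Sum>b\<le>j. \<Sum>a\<le>i. f a b * g (i - a) (j - b))"
      unfolding sum_distrib_right
    proof (intro sum.cong refl)
      fix a b assume "b \<in> {..j}" "a \<in> {..i}"
      then have "r ^ i = r ^ a * r ^ (i - a)" "r ^ j = r ^ b * r ^ (j - b)"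
        by (simp_all flip: power_add)
      then show "norm (coef2 F a b) * norm (coef2 G (i - a) (j - b)) * (r ^ i * r ^ j) = f a b * g (i - a) (j - b)"
        by (simp add: f_def g_def)
    qed
    finally show ?thesis
      by (simp add: mult.assoc)
  qed
  then have "box_norm r K (F * G) \<le>
      (\<Sum>i\<le>K. \<Sum>j\<le>K. \<Sum>b\<le>j. \<Sum>a\<le>i. f a b * g (i - a) (j - b))"
    by (intro sum_mono)
  also have "\<dots> \<le> (\<Sum>i\<le>K. \<Sum>b\<le>K. \<Sum>d\<le>K. \<Sum>a\<le>i. f a b * g (i - a) d)"
    by (intro sum_mono sum_convolution_le[where f = "\<lambda>b d. \<Sum>a\<le>i. f a b * g (i - a) d" for i])
       (intro sum_nonneg mult_nonneg_nonneg nn)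
  also have "\<dots> = (\<Sum>b\<le>K. \<Sum>i\<le>K. \<Sum>d\<le>K. \<Sum>a\<le>i. f a b * g (i - a) d)"
    by (rule sum.swap)
  also have "\<dots> = (\<Sum>b\<le>K. \<Sum>d\<le>K. \<Sum>i\<le>K. \<Sum>a\<le>i. f a b * g (i - a) d)"
    by (rule sum.cong[OF refl], rule sum.swap)
  also have "\<dots> \<le> (\<Sum>b\<le>K. \<Sum>d\<le>K. \<Sum>a\<le>K. \<Sum>c\<le>K. f a b * g c d)"
    by (intro sum_mono sum_convolution_le[where f = "\<lambda>a c. f a b * g c d" for b d] mult_nonneg_nonneg nn)
  also have "\<dots> = (\<Sum>b\<le>K. \<Sum>a\<le>K. f a b) * (\<Sum>d\<le>K. \<Sum>c\<le>K. g c d)"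
    by (simp only: sum_product)
  also have "\<dots> = (\<Sum>a\<le>K. \<Sum>b\<le>K. f a b) * (\<Sum>c\<le>K. \<Sum>d\<le>K. g c d)"
    by (intro arg_cong2[where f = "(*)"] sum.swap)
  also have "\<dots> \<le> C * D"
    using majorizedD[OF F, of K] majorizedD[OF G, of K] majorized_nonneg[OF F] nn
    by (intro mult_mono) (auto simp: f_def g_def intro!: sum_nonneg)
  finally show "box_norm r K (F * G) \<le> C * D" .
qed

lemma majorized_monom2: "0 \<le> r \<Longrightarrow> majorized r (norm c * r ^ a * r ^ b) (monom2 c a b)"
  unfolding majorized_def
proof
  fix K assume "0 \<le> r"
  have "box_norm r K (monom2 c a b) =
     (\<Sum>i\<le>K. \<Sum>j\<le>K. if i = a then if j = b then norm c * r ^ a * r ^ b else 0 else 0)"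
    by (intro sum.cong refl) (auto simp: coef2_monom2)
  also have "\<dots> = (\<Sum>i\<le>K. if i = a then (\<Sum>j\<le>K. if j = b then norm c * r ^ a * r ^ b else 0) else 0)"
    by (intro sum.cong refl) simp
  also have "\<dots> \<le> norm c * r ^ a * r ^ b"
    using \<open>0 \<le> r\<close> by (simp add: sum.delta)
  finally show "box_norm r K (monom2 c a b) \<le> norm c * r ^ a * r ^ b" .
qed

lemma majorized_1: "0 \<le> r \<Longrightarrow> majorized r 1 1"
  using majorized_monom2[of r 1 0 0] by (simp add: monom2_def)

lemma majorized_power: "majorized r C F \<Longrightarrow> 0 \<le> r \<Longrightarrow> majorized r (C ^ n) (F ^ n)"
  by (induction n) (simp_all add: majorized_1 majorized_mult)

text \<open>Each of the at least k variables in a monomial gains a factor r / R when the radius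
  shrinks. This is the source of all smallness in the convergence proofs.\<close>

lemma majorized_order_ge:
  assumes "majorized R C F" "order_ge k F" "0 \<le> r" "r \<le> R" "0 < R"
  shows "majorized r (C * (r / R) ^ k) F"
  unfolding majorized_def
proof
  fix K
  have "norm (coef2 F i j) * r ^ i * r ^ j \<le> (norm (coef2 F i j) * R ^ i * R ^ j) * (r / R) ^ k" for i j
  proof (cases "i + j < k")
    case False
    have "r ^ i * r ^ j = R ^ i * R ^ j * (r / R) ^ (i + j)"
      using assms by (simp add: power_divide power_add)
    also have "\<dots> \<le> R ^ i * R ^ j * (r / R) ^ k"
      using assms False by (intro mult_left_mono power_decreasing) auto
    finally show ?thesis
      by (simp add: mult.assoc mult_left_mono)
  qed (use assms in \<open>simp add: order_ge_def\<close>)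
  then have "box_norm r K F \<le>
      (\<Sum>i\<le>K. \<Sum>j\<le>K. (norm (coef2 F i j) * R ^ i * R ^ j) * (r / R) ^ k)"
    by (intro sum_mono)
  also have "\<dots> \<le> C * (r / R) ^ k"
    using majorizedD[OF assms(1), of K] assms
    by (simp add: mult_right_mono flip: sum_distrib_right)
  finally show "box_norm r K F \<le> C * (r / R) ^ k" .
qed

lemma majorized_smaller_radius: "majorized R C F \<Longrightarrow> 0 \<le> r \<Longrightarrow> r \<le> R \<Longrightarrow> 0 < R \<Longrightarrow> majorized r C F"
  using majorized_order_ge[of R C F 0 r] by simp

text \<open>A monomial x^i y^j turns into a series of norm at most R^(i+j) at radius r, so the norm
  of F at R bounds that of the composite at r.\<close>

lemma majorized_subst2:
  assumes F: "majorized R C F" and \<sigma>: "majorized r R (fst \<sigma>)" "majorized r R (snd \<sigma>)" "no_const \<sigma>"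
    and "0 \<le> r"
  shows "majorized r C (subst2 F \<sigma>)"
  unfolding majorized_def
proof
  fix K
  define m where "m i j = fst \<sigma> ^ i * snd \<sigma> ^ j" for i j
  \<comment> \<open>Indices up to K give degrees up to 2 K, so one square of exponents serves all
    these coefficients.\<close>
  have "norm (coef2 (subst2 F \<sigma>) a b) * r ^ a * r ^ b \<le>
      (\<Sum>i\<le>2 * K. \<Sum>j\<le>2 * K. norm (coef2 F i j) * (norm (coef2 (m i j) a b) * r ^ a * r ^ b))"
    if "a \<le> K" "b \<le> K" for a b
  proof -
    have "norm (coef2 (subst2 F \<sigma>) a b) \<le> (\<Sum>i\<le>2 * K. \<Sum>j\<le>2 * K. norm (coef2 F i j) * norm (coef2 (m i j) a b))"
      using that
      by (subst coef2_subst2[OF \<sigma>(3), where K = "2 * K"])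
         (auto simp: norm_mult m_def intro!: order_trans[OF norm_sum] sum_mono)
    then have "norm (coef2 (subst2 F \<sigma>) a b) * (r ^ a * r ^ b) \<le>
       (\<Sum>i\<le>2 * K. \<Sum>j\<le>2 * K. norm (coef2 F i j) * norm (coef2 (m i j) a b)) * (r ^ a * r ^ b)"
      using \<open>0 \<le> r\<close> by (intro mult_right_mono) auto
    then show ?thesis
      by (simp add: sum_distrib_right mult.assoc)
  qed
  then have "(\<Sum>a\<le>K. \<Sum>b\<le>K. norm (coef2 (subst2 F \<sigma>) a b) * r ^ a * r ^ b) \<le>
     (\<Sum>a\<le>K. \<Sum>b\<le>K. \<Sum>i\<le>2 * K. \<Sum>j\<le>2 * K. norm (coef2 F i j) * (norm (coef2 (m i j) a b) * r ^ a * r ^ b))"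
    by (intro sum_mono) auto
  also have "\<dots> = (\<Sum>a\<le>K. \<Sum>i\<le>2 * K. \<Sum>b\<le>K. \<Sum>j\<le>2 * K. norm (coef2 F i j) * (norm (coef2 (m i j) a b) * r ^ a * r ^ b))"
    by (rule sum.cong[OF refl], rule sum.swap)
  also have "\<dots> = (\<Sum>i\<le>2 * K. \<Sum>a\<le>K. \<Sum>b\<le>K. \<Sum>j\<le>2 * K. norm (coef2 F i j) * (norm (coef2 (m i j) a b) * r ^ a * r ^ b))"
    by (rule sum.swap)
  also have "\<dots> = (\<Sum>i\<le>2 * K. \<Sum>a\<le>K. \<Sum>j\<le>2 * K. \<Sum>b\<le>K. norm (coef2 F i j) * (norm (coef2 (m i j) a b) * r ^ a * r ^ b))"
    by (rule sum.cong[OF refl], rule sum.cong[OF refl], rule sum.swap)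
  also have "\<dots> = (\<Sum>i\<le>2 * K. \<Sum>j\<le>2 * K. \<Sum>a\<le>K. \<Sum>b\<le>K. norm (coef2 F i j) * (norm (coef2 (m i j) a b) * r ^ a * r ^ b))"
    by (rule sum.cong[OF refl], rule sum.swap)
  also have "\<dots> = (\<Sum>i\<le>2 * K. \<Sum>j\<le>2 * K. norm (coef2 F i j) * (\<Sum>a\<le>K. \<Sum>b\<le>K. norm (coef2 (m i j) a b) * r ^ a * r ^ b))"
    by (simp only: sum_distrib_left)
  also have "\<dots> \<le> (\<Sum>i\<le>2 * K. \<Sum>j\<le>2 * K. norm (coef2 F i j) * (R ^ i * R ^ j))"
    unfolding m_def
    using majorizedD[OF majorized_mult[OF majorized_power[OF \<sigma>(1)] majorized_power[OF \<sigma>(2)]]] \<open>0 \<le> r\<close>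
    by (intro sum_mono mult_left_mono) auto
  also have "\<dots> \<le> C"
    using majorizedD[OF F] by (simp add: mult.assoc)
  finally show "(\<Sum>a\<le>K. \<Sum>b\<le>K. norm (coef2 (subst2 F \<sigma>) a b) * r ^ a * r ^ b) \<le> C" .
qed

lemma conv2_iff_majorized: "F \<in> conv2 \<longleftrightarrow> (\<exists>r>0. \<exists>C. majorized r C F)"
proof
  assume "F \<in> conv2"
  then obtain r where r: "r > 0" "(\<lambda>(i, j). norm (coef2 F i j) * r ^ i * r ^ j) summable_on UNIV"
    by (auto simp: conv2_def)
  have "majorized r (infsum (\<lambda>(i, j). norm (coef2 F i j) * r ^ i * r ^ j) UNIV) F"
    unfolding majorized_def
  proof
    fix K
    show "box_norm r K F \<le>
        infsum (\<lambda>(i, j). norm (coef2 F i j) * r ^ i * r ^ j) UNIV"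
      unfolding sum.cartesian_product
      using r by (intro finite_sum_le_infsum) auto
  qed
  then show "\<exists>r>0. \<exists>C. majorized r C F"
    using r by blast
next
  assume "\<exists>r>0. \<exists>C. majorized r C F"
  then obtain r C where r: "r > 0" "majorized r C F"
    by blast
  have "(\<lambda>(i, j). norm (coef2 F i j) * r ^ i * r ^ j) summable_on UNIV"
  proof (rule nonneg_bdd_above_summable_on)
    show "bdd_above (sum (\<lambda>(i, j). norm (coef2 F i j) * r ^ i * r ^ j) ` {F. F \<subseteq> UNIV \<and> finite F})"
    proof (rule bdd_aboveI2)
      fix S :: "(nat \<times> nat) set" assume "S \<in> {F. F \<subseteq> UNIV \<and> finite F}"
      then have "finite (fst ` S \<union> snd ` S)"
        by simp
      then obtain K where K: "fst ` S \<union> snd ` S \<subseteq> {..K}"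
        by (meson finite_nat_iff_bounded_le)
      have "S \<subseteq> {..K} \<times> {..K}"
        using K by (force)
      then have "sum (\<lambda>(i, j). norm (coef2 F i j) * r ^ i * r ^ j) S \<le>
          sum (\<lambda>(i, j). norm (coef2 F i j) * r ^ i * r ^ j) ({..K} \<times> {..K})"
        using r by (intro sum_mono2) auto
      also have "\<dots> \<le> C"
        using majorizedD[OF r(2), of K] by (simp add: sum.cartesian_product)
      finally show "sum (\<lambda>(i, j). norm (coef2 F i j) * r ^ i * r ^ j) S \<le> C" .
    qed
  qed (use r in auto)
  then show "F \<in> conv2"
    using r by (auto simp: conv2_def)
qed

text \<open>The bound \<open>r \<le> 1\<close> makes the powers of r decrease, which
  \<open>conv2_contract\<close> relies on.\<close>

lemma conv2_common_majorant:
  assumes "finite A" "A \<subseteq> conv2"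
  shows "\<exists>r>0. \<exists>C>0. r \<le> 1 \<and> (\<forall>F\<in>A. majorized r C F)"
  using assms
proof (induction rule: finite_induct)
  case empty
  then show ?case by (intro exI[of _ "1::real"]) (auto intro: exI[of _ "1::real"])
next
  case (insert F A)
  then obtain r C s D where rs: "r > 0" "C > 0" "r \<le> 1" "\<forall>F\<in>A. majorized r C F" "s > 0" "majorized s D F"
    by (auto simp: conv2_iff_majorized)
  have "majorized (min r s) (max C D) G" if "G \<in> insert F A" for G
    using rs that
    by (auto intro: majorized_mono[OF majorized_smaller_radius[of r C]] majorized_mono[OF majorized_smaller_radius[of s D]])
  then show ?case
    using rs by (intro exI[of _ "min r s"] conjI exI[of _ "max C D"]) auto
qed

lemma conv2_add: "F \<in> conv2 \<Longrightarrow> G \<in> conv2 \<Longrightarrow> F + G \<in> conv2"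
  and conv2_mult: "F \<in> conv2 \<Longrightarrow> G \<in> conv2 \<Longrightarrow> F * G \<in> conv2"
proof -
  assume "F \<in> conv2" "G \<in> conv2"
  then obtain r C where "r > 0" "majorized r C F" "majorized r C G"
    using conv2_common_majorant[of "{F, G}"] by auto
  then show "F + G \<in> conv2" "F * G \<in> conv2"
    using majorized_add[of r C F C G] majorized_mult[of r C F C G] by (auto simp: conv2_iff_majorized)
qed

lemma conv2_const_mult: "F \<in> conv2 \<Longrightarrow> const2 c * F \<in> conv2"
  by (auto simp: conv2_iff_majorized intro: majorized_const_mult)

lemma conv2_uminus: "F \<in> conv2 \<Longrightarrow> - F \<in> conv2"
  using conv2_const_mult[of F "-1"] by (simp add: const2_uminus_1)

lemma conv2_diff: "F \<in> conv2 \<Longrightarrow> G \<in> conv2 \<Longrightarrow> F - G \<in> conv2"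
  using conv2_add[of F "- G"] conv2_uminus[of G] by simp

lemma conv2_monom2: "monom2 c i j \<in> conv2"
  unfolding conv2_iff_majorized
  by (rule exI[of _ 1], rule conjI[OF zero_less_one], rule exI, rule majorized_monom2[OF zero_le_one])

lemma conv2_simps [simp]: "0 \<in> conv2" "1 \<in> conv2" "var_x \<in> conv2" "var_y \<in> conv2"
  using conv2_monom2[of 0 0 0] conv2_monom2[of 1 0 0] conv2_monom2[of 1 1 0] conv2_monom2[of 1 0 1]
  by (simp_all add: monom2_def)

lemma conv2_sum: "(\<And>a. a \<in> A \<Longrightarrow> f a \<in> conv2) \<Longrightarrow> sum f A \<in> conv2"
  and conv2_prod: "(\<And>a. a \<in> A \<Longrightarrow> f a \<in> conv2) \<Longrightarrow> prod f A \<in> conv2"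
  by (induction A rule: infinite_finite_induct) (auto intro: conv2_add conv2_mult)

lemma conv2_trunc2: "trunc2 k F \<in> conv2"
  unfolding trunc2_def by (intro conv2_sum conv2_monom2)

lemma majorized_small:
  assumes "F \<in> conv2" "G \<in> conv2" "order_ge 1 F" "order_ge 1 G" "R > 0"
  shows "\<exists>r>0. \<forall>r'. 0 \<le> r' \<and> r' \<le> r \<longrightarrow> majorized r' R F \<and> majorized r' R G"
proof -
  obtain s C where s: "s > 0" "C > 0" "majorized s C F" "majorized s C G"
    using assms conv2_common_majorant[of "{F, G}"] by auto
  \<comment> \<open>\<open>majorized_order_ge\<close> with order 1 bounds the norm at radius r' by C
    r' / s; the second entry of the minimum makes this at most R.\<close>
  define r where "r = min s (R * s / C)"
  show ?thesis
  proof (intro exI[of _ r] conjI allI impI)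
    show "r > 0"
      using s assms by (simp add: r_def)
    fix r' assume r': "0 \<le> r' \<and> r' \<le> r"
    then have "C * (r' / s) ^ 1 \<le> R" "r' \<le> s"
      using s by (simp_all add: r_def field_simps)
    then show "majorized r' R F" "majorized r' R G"
      using s assms r' majorized_order_ge[of s C _ 1 r'] by (auto intro: majorized_mono)
  qed
qed

lemma conv2_subst2:
  assumes "F \<in> conv2" "fst \<sigma> \<in> conv2" "snd \<sigma> \<in> conv2" "no_const \<sigma>"
  shows "subst2 F \<sigma> \<in> conv2"
proof -
  obtain R C where "R > 0" "majorized R C F"
    using assms by (auto simp: conv2_iff_majorized)
  moreover obtain r where "r > 0" "majorized r R (fst \<sigma>)" "majorized r R (snd \<sigma>)"
    using majorized_small[of "fst \<sigma>" "snd \<sigma>" R] assms \<open>R > 0\<close> by (force simp: no_const_def)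
  ultimately show ?thesis
    using majorized_subst2[of R C F r \<sigma>] assms by (auto simp: conv2_iff_majorized)
qed

lemma majorized_fps_const:
  "majorized r C (fps_const f) \<longleftrightarrow> (\<forall>K. (\<Sum>n\<le>K. norm (f $ n) * r ^ n) \<le> C)"
proof -
  have "box_norm r K (fps_const f) = (\<Sum>n\<le>K. norm (f $ n) * r ^ n)" for K
  proof (intro sum.cong refl)
    fix i
    have "(\<Sum>j\<le>K. norm (coef2 (fps_const f) i j) * r ^ i * r ^ j) = (\<Sum>j\<le>K. if j = 0 then norm (f $ i) * r ^ i else 0)"
      by (intro sum.cong refl) (auto simp: coef2_fps_const)
    then show "(\<Sum>j\<le>K. norm (coef2 (fps_const f) i j) * r ^ i * r ^ j) = norm (f $ i) * r ^ i"
      by (simp add: sum.delta)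
  qed
  then show ?thesis
    by (simp add: majorized_def)
qed

lemma majorized_fps_const_summable:
  assumes "majorized r C (fps_const f)" "0 \<le> r"
  shows "summable (\<lambda>n. norm (f $ n) * r ^ n)" "(\<Sum>n. norm (f $ n) * r ^ n) \<le> C"
proof -
  have b: "(\<Sum>n<K. norm (f $ n) * r ^ n) \<le> C" for K
  proof -
    have "(\<Sum>n<K. norm (f $ n) * r ^ n) \<le> (\<Sum>n\<le>K. norm (f $ n) * r ^ n)"
      using assms by (intro sum_mono2) auto
    then show ?thesis
      using assms unfolding majorized_fps_const by (meson order_trans)
  qed
  show s: "summable (\<lambda>n. norm (f $ n) * r ^ n)"
    using b assms by (intro bounded_imp_summable[of _ C])
      (auto simp: majorized_fps_const)
  show "(\<Sum>n. norm (f $ n) * r ^ n) \<le> C"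
    using s b by (intro suminf_le_const) auto
qed

lemma majorized_fps_const_conv_radius:
  assumes "majorized r C (fps_const f)" "0 \<le> r"
  shows "ereal r \<le> fps_conv_radius f"
proof -
  have "summable (\<lambda>n. norm (f $ n * of_real r ^ n))"
    using majorized_fps_const_summable(1)[OF assms] assms by (simp add: norm_mult norm_power)
  then have "summable (\<lambda>n. f $ n * of_real r ^ n)"
    by (rule summable_norm_cancel)
  then have "norm (of_real r :: complex) \<le> fps_conv_radius f"
    unfolding fps_conv_radius_def by (rule conv_radius_geI)
  then show ?thesis
    using assms by simp
qed

lemma conv2_fps_const_iff: "fps_const f \<in> conv2 \<longleftrightarrow> f \<in> conv1"
proof
  assume "fps_const f \<in> conv2"
  then obtain r C where "r > 0" "majorized r C (fps_const f)"
    by (auto simp: conv2_iff_majorized)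
  then have "ereal r \<le> fps_conv_radius f" "0 < ereal r"
    by (auto intro: majorized_fps_const_conv_radius)
  then have "0 < fps_conv_radius f"
    by (metis less_le_trans)
  then show "f \<in> conv1"
    by (simp add: conv1_def)
next
  assume "f \<in> conv1"
  then obtain r where r: "0 < ereal r" "ereal r < fps_conv_radius f"
    using ereal_dense2[of 0 "fps_conv_radius f"] by (auto simp: conv1_def)
  then have s: "summable (\<lambda>n. norm (f $ n * of_real r ^ n))"
    by (intro norm_summable_fps) simp
  have "(\<Sum>n\<le>K. norm (f $ n) * r ^ n) \<le> (\<Sum>n. norm (f $ n) * r ^ n)" for K
    using s r by (intro sum_le_suminf) (simp_all add: norm_mult norm_power)
  then show "fps_const f \<in> conv2"
    using r by (auto simp: conv2_iff_majorized majorized_fps_const)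
qed

lemma conv1_subst1:
  assumes "F \<in> conv2" "fst \<phi> \<in> conv1" "snd \<phi> \<in> conv1" "centered \<phi>"
  shows "subst1 F \<phi> \<in> conv1"
  using conv2_subst2[of F "germ2 \<phi>"] assms
  by (simp add: subst2_germ2 no_const_germ2 conv2_fps_const_iff) (simp add: germ2_def conv2_fps_const_iff)

lemma conv1_compose: "f \<in> conv1 \<Longrightarrow> \<rho> \<in> conv1 \<Longrightarrow> \<rho> $ 0 = 0 \<Longrightarrow> f oo \<rho> \<in> conv1"
  using conv1_subst1[of "fps_const f" "(\<rho>, 0)"]
  by (simp add: subst1_fps_const conv2_fps_const_iff) (simp add: conv1_def)


section \<open>Invertible coordinate changes\<close>

lemma order_ge_power_diff:
  assumes "order_ge 1 F" "order_ge 1 G" "order_ge k (F - G)"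
  shows "order_ge (k + n) (F ^ Suc n - G ^ Suc n)"
proof (induction n)
  case (Suc n)
  have "F ^ Suc (Suc n) - G ^ Suc (Suc n) = F * (F ^ Suc n - G ^ Suc n) + (F - G) * G ^ Suc n"
    by (simp add: algebra_simps)
  moreover have "order_ge (1 + (k + n)) (F * (F ^ Suc n - G ^ Suc n))"
    using Suc assms by (intro order_ge_mult) auto
  moreover have "order_ge (k + Suc n) ((F - G) * G ^ Suc n)"
    using assms by (intro order_ge_mult order_ge_power) auto
  ultimately show ?case
    by (auto intro!: order_ge_add)
qed (use assms in simp)

lemma order_ge_monomial_diff:
  assumes "no_const \<sigma>" "no_const \<tau>" "order_ge k (fst \<sigma> - fst \<tau>)" "order_ge k (snd \<sigma> - snd \<tau>)" "2 \<le> i + j"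
  shows "order_ge (Suc k) (fst \<sigma> ^ i * snd \<sigma> ^ j - fst \<tau> ^ i * snd \<tau> ^ j)"
proof -
  have eq: "fst \<sigma> ^ i * snd \<sigma> ^ j - fst \<tau> ^ i * snd \<tau> ^ j =
      (fst \<sigma> ^ i - fst \<tau> ^ i) * snd \<sigma> ^ j + fst \<tau> ^ i * (snd \<sigma> ^ j - snd \<tau> ^ j)"
    by (simp add: algebra_simps)
  have "order_ge (Suc k) ((fst \<sigma> ^ i - fst \<tau> ^ i) * snd \<sigma> ^ j)"
  proof (cases i)
    case (Suc n)
    have "order_ge (k + n + j) ((fst \<sigma> ^ Suc n - fst \<tau> ^ Suc n) * snd \<sigma> ^ j)"
      using assms by (intro order_ge_mult order_ge_power order_ge_power_diff) (auto simp: no_const_def)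
    then show ?thesis
      using Suc assms by (auto elim: order_ge_mono)
  qed simp
  moreover have "order_ge (Suc k) (fst \<tau> ^ i * (snd \<sigma> ^ j - snd \<tau> ^ j))"
  proof (cases j)
    case (Suc n)
    have "order_ge (i + (k + n)) (fst \<tau> ^ i * (snd \<sigma> ^ Suc n - snd \<tau> ^ Suc n))"
      using assms by (intro order_ge_mult order_ge_power order_ge_power_diff) (auto simp: no_const_def)
    then show ?thesis
      using Suc assms by (auto elim: order_ge_mono)
  qed simp
  ultimately show ?thesis
    unfolding eq by (rule order_ge_add)
qed

text \<open>Substitution into a series of order 2 is an adic contraction: in each monomial of degree
  at least 2 the difference of \<sigma> and \<tau> is accompanied by at least one further factor
  without constant term.\<close>

lemma order_ge_subst2_diff:
  assumes "no_const \<sigma>" "no_const \<tau>" "order_ge k (fst \<sigma> - fst \<tau>)" "order_ge k (snd \<sigma> - snd \<tau>)" "order_ge 2 G"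
  shows "order_ge (Suc k) (subst2 G \<sigma> - subst2 G \<tau>)"
  unfolding order_ge_def
proof (intro allI impI)
  fix a b assume ab: "a + b < Suc k"
  have "coef2 G i j * coef2 (fst \<sigma> ^ i * snd \<sigma> ^ j) a b = coef2 G i j * coef2 (fst \<tau> ^ i * snd \<tau> ^ j) a b" for i j
  proof (cases "2 \<le> i + j")
    case True
    then have "coef2 (fst \<sigma> ^ i * snd \<sigma> ^ j - fst \<tau> ^ i * snd \<tau> ^ j) a b = 0"
      using order_ge_monomial_diff[OF assms(1-4) True] ab by (auto simp: order_ge_def)
    then show ?thesis by simp
  next
    case False
    then show ?thesis using assms(5) by (simp add: order_ge_def)
  qed
  then have "coef2 (subst2 G \<sigma>) a b = coef2 (subst2 G \<tau>) a b"
    unfolding subst2_def coef2_series2 by (intro sum.cong refl)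
  then show "coef2 (subst2 G \<sigma> - subst2 G \<tau>) a b = 0"
    by simp
qed

text \<open>A formal and an analytic inverse function theorem in one statement. The iteration for
  \<tau> = l + g(\<tau>) converges adically because g has order 2; when the data converge, all
  iterates stay in one fixed ball of the weighted norm, and so does the limit.\<close>

lemma fixed_point_subst2:
  assumes l: "no_const l" and g: "order_ge 2 (fst g)" "order_ge 2 (snd g)"
  shows "\<exists>\<tau>. no_const \<tau> \<and> fst \<tau> = fst l + subst2 (fst g) \<tau> \<and> snd \<tau> = snd l + subst2 (snd g) \<tau> \<and>
     ({fst l, snd l, fst g, snd g} \<subseteq> conv2 \<longrightarrow> fst \<tau> \<in> conv2 \<and> snd \<tau> \<in> conv2)"
proof -
  define T where "T \<tau> = (fst l + subst2 (fst g) \<tau>, snd l + subst2 (snd g) \<tau>)" for \<tau>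
  define t where "t n = (T ^^ n) l" for n
  have t_Suc: "t (Suc n) = T (t n)" for n
    by (simp add: t_def)
  have nc_T: "no_const (T \<tau>)" if "no_const \<tau>" for \<tau>
    using order_ge_subst2[OF that g(1)] order_ge_subst2[OF that g(2)] l
    unfolding T_def no_const_def by (auto intro!: order_ge_add elim: order_ge_mono)
  have nc: "no_const (t n)" for n
    by (induction n) (simp_all add: t_Suc nc_T, simp add: t_def l)
  have step: "order_ge (Suc n) (fst (t (Suc n)) - fst (t n)) \<and> order_ge (Suc n) (snd (t (Suc n)) - snd (t n))" for n
  proof (induction n)
    case 0
    then show ?case
      using nc[of 1] nc[of 0] by (auto simp: no_const_def intro!: order_ge_diff)
  next
    case (Suc n)
    then show ?case
      unfolding t_Suc[of "Suc n"] t_Suc[of n]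
      using order_ge_subst2_diff[of "T (t n)" "t n" "Suc n"] nc[of n] nc[of "Suc n"] g
      by (auto simp: T_def t_Suc)
  qed
  have stable: "order_ge (Suc n) (fst (t (n + d)) - fst (t n)) \<and> order_ge (Suc n) (snd (t (n + d)) - snd (t n))" for n d
  proof (induction d)
    case (Suc d)
    have "order_ge (Suc n) (fst (t (Suc (n + d))) - fst (t (n + d)))" "order_ge (Suc n) (snd (t (Suc (n + d))) - snd (t (n + d)))"
      using step[of "n + d"] by (auto elim: order_ge_mono)
    then show ?case
      using Suc order_ge_add[of "Suc n" "fst (t (n + d)) - fst (t n)" "fst (t (Suc (n + d))) - fst (t (n + d))"]
        order_ge_add[of "Suc n" "snd (t (n + d)) - snd (t n)" "snd (t (Suc (n + d))) - snd (t (n + d))"]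
      by simp
  qed simp
  \<comment> \<open>Passing from the n-th iterate to the next changes only degrees above n, so the
    coefficients of degree n are final from the n-th iterate on.\<close>
  define \<tau> where "\<tau> = (series2 (\<lambda>i j. coef2 (fst (t (i + j))) i j), series2 (\<lambda>i j. coef2 (snd (t (i + j))) i j))"
  have coef: "coef2 (fst \<tau>) i j = coef2 (fst (t n)) i j" "coef2 (snd \<tau>) i j = coef2 (snd (t n)) i j"
    if "i + j \<le> n" for i j n
    using stable[of "i + j" "n - (i + j)"] that by (auto simp: \<tau>_def order_ge_def)
  have lim: "order_ge (Suc n) (fst \<tau> - fst (t n))" "order_ge (Suc n) (snd \<tau> - snd (t n))" for n
    by (auto simp: order_ge_def coef)
  have nc\<tau>: "no_const \<tau>"
    using lim[of 0] nc[of 0] order_ge_add[of 1 "fst \<tau> - fst (t 0)" "fst (t 0)"]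
      order_ge_add[of 1 "snd \<tau> - snd (t 0)" "snd (t 0)"]
    by (simp add: no_const_def)
  have "order_ge n (fst \<tau> - fst (T \<tau>)) \<and> order_ge n (snd \<tau> - snd (T \<tau>))" for n
  proof -
    have "order_ge (Suc (Suc n)) (subst2 (fst g) \<tau> - subst2 (fst g) (t n))"
      "order_ge (Suc (Suc n)) (subst2 (snd g) \<tau> - subst2 (snd g) (t n))"
      using lim[of n] nc[of n] nc\<tau> g by (auto intro!: order_ge_subst2_diff)
    then have "order_ge (Suc (Suc n)) (fst (T \<tau>) - fst (t (Suc n)))" "order_ge (Suc (Suc n)) (snd (T \<tau>) - snd (t (Suc n)))"
      by (simp_all add: t_Suc T_def)
    then have "order_ge (Suc (Suc n)) (fst \<tau> - fst (t (Suc n)) - (fst (T \<tau>) - fst (t (Suc n))))"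
       "order_ge (Suc (Suc n)) (snd \<tau> - snd (t (Suc n)) - (snd (T \<tau>) - snd (t (Suc n))))"
      using lim[of "Suc n"] order_ge_diff by blast+
    then show ?thesis
      by (auto elim: order_ge_mono)
  qed
  then have fixed: "fst \<tau> = fst (T \<tau>)" "snd \<tau> = snd (T \<tau>)"
    using order_ge_all_imp_0[of "fst \<tau> - fst (T \<tau>)"] order_ge_all_imp_0[of "snd \<tau> - snd (T \<tau>)"] by auto
  have "fst \<tau> \<in> conv2 \<and> snd \<tau> \<in> conv2" if conv: "{fst l, snd l, fst g, snd g} \<subseteq> conv2"
  proof -
    obtain R0 C0 where R0: "R0 > 0" "R0 \<le> 1" "C0 > 0" "\<forall>F\<in>{fst l, snd l, fst g, snd g}. majorized R0 C0 F"
      using conv2_common_majorant[of "{fst l, snd l, fst g, snd g}"] conv by blast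
    define C where "C = max C0 1"
    have C: "C \<ge> 1" "majorized R0 C F" if "F \<in> {fst l, snd l, fst g, snd g}" for F
      using R0 that by (auto simp: C_def intro: majorized_mono)
    then have C1: "C \<ge> 1" by blast
    \<comment> \<open>R is chosen so that a series of order 2 has norm at most C (R / R0)^2 = R / 2
      at radius R, and r so that a series of order 1 has norm at most C r / R0 = R / 2 at radius r.
      The iteration then preserves the ball of size R.\<close>
    define R where "R = R0\<^sup>2 / (2 * C)"
    define r where "r = R * R0 / (2 * C)"
    have "R0\<^sup>2 \<le> R0 * 1"
      unfolding power2_eq_square using R0 by (intro mult_left_mono) auto
    also have "\<dots> \<le> R0 * (2 * C)"
      using R0 C1 by (intro mult_left_mono) auto
    finally have R: "R > 0" "R \<le> R0"
      using R0 C1 by (simp_all add: R_def field_simps)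
    have "R * R0 \<le> R0 * (2 * C)"
      using R0 C1 R by (subst mult.commute, intro mult_left_mono) auto
    then have r: "r > 0" "r \<le> R0"
      using R R0 C1 by (simp_all add: r_def field_simps)
    have ml: "majorized r (R / 2) F" if "F \<in> {fst l, snd l}" for F
      using majorized_order_ge[OF C(2), of F 1 r] that l r R0 C1 by (auto simp: no_const_def r_def)
    have "C * (R / R0) ^ 2 = R * (C * R / R0\<^sup>2)"
      by (simp add: power2_eq_square)
    also have "\<dots> = R / 2"
      using R0 C1 by (simp add: R_def)
    finally have CR: "C * (R / R0) ^ 2 = R / 2" .
    have mg: "majorized R (R / 2) F" if "F \<in> {fst g, snd g}" for F
      using majorized_order_ge[OF C(2), of F 2 R] that g R R0 unfolding CR by auto
    have mt: "majorized r R (fst (t n)) \<and> majorized r R (snd (t n))" for n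
    proof (induction n)
      case 0
      have "majorized r R F" if "F \<in> {fst l, snd l}" for F
        using ml[OF that] R by (auto elim!: majorized_mono)
      then show ?case by (simp add: t_def)
    next
      case (Suc n)
      then have "majorized r (R / 2 + R / 2) (fst l + subst2 (fst g) (t n))"
         "majorized r (R / 2 + R / 2) (snd l + subst2 (snd g) (t n))"
        using ml mg nc r by (intro majorized_add majorized_subst2[of R]; simp)+
      then show ?case
        by (simp add: t_Suc T_def)
    qed
    have "majorized r R (fst \<tau>)" "majorized r R (snd \<tau>)"
      unfolding majorized_def
    proof (safe)
      fix K
      \<comment> \<open>The square contains degrees up to 2 K only, and there \<tau> agrees with the
        iterate of that index.\<close>
      have "box_norm r K (fst \<tau>) = box_norm r K (fst (t (2 * K)))"
        "box_norm r K (snd \<tau>) = box_norm r K (snd (t (2 * K)))"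
        by (intro sum.cong refl; simp add: coef[where n = "2 * K"])+
      then show "box_norm r K (fst \<tau>) \<le> R"
        "box_norm r K (snd \<tau>) \<le> R"
        using mt[of "2 * K"] by (simp_all add: majorizedD)
    qed
    then show ?thesis
      using r by (auto simp: conv2_iff_majorized)
  qed
  then show ?thesis
    using nc\<tau> fixed by (intro exI[of _ \<tau>]) (auto simp: T_def)
qed

text \<open>The condition on the 1-jet of \<sigma> in \<open>A_sub\<close>, without convergence. The
  linear parts (x + b y, y) form a copy of the additive group of complex numbers, so the parameters
  add under composition and change sign under inversion.\<close>

definition shear :: "complex \<Rightarrow> fps2 \<times> fps2 \<Rightarrow> bool" where
  "shear b \<sigma> \<longleftrightarrow> order_ge 2 (fst \<sigma> - (var_x + const2 b * var_y)) \<and> order_ge 2 (snd \<sigma> - var_y)"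

lemma order_ge_1_linear: "order_ge (Suc 0) (var_x + const2 b * var_y)"
  by (intro order_ge_add order_ge_const_mult) auto

lemma shear_no_const: "shear b \<sigma> \<Longrightarrow> no_const \<sigma>"
  unfolding shear_def no_const_def One_nat_def
  using order_ge_add[of 1 "fst \<sigma> - (var_x + const2 b * var_y)" "var_x + const2 b * var_y"]
    order_ge_add[of 1 "snd \<sigma> - var_y" var_y] order_ge_1_linear[of b]
    order_ge_mono[of 2 "fst \<sigma> - (var_x + const2 b * var_y)" 1] order_ge_mono[of 2 "snd \<sigma> - var_y" 1]
  by simp

lemma const2_add: "const2 (a + b) = const2 a + const2 b"
  and const2_minus: "const2 (- a) = - const2 a"
  by (simp_all add: const2_def)

lemma shear_comp2:
  assumes "shear b \<sigma>" "shear c \<tau>"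
  shows "shear (b + c) (comp2 \<sigma> \<tau>)"
proof -
  note nc = shear_no_const[OF assms(2)]
  have 1: "fst (comp2 \<sigma> \<tau>) - (var_x + const2 (b + c) * var_y) =
      subst2 (fst \<sigma> - (var_x + const2 b * var_y)) \<tau> +
      (fst \<tau> - (var_x + const2 c * var_y) + const2 b * (snd \<tau> - var_y))"
    unfolding comp2_def fst_conv subst2_diff subst2_add subst2_const_mult subst2_var[OF nc] const2_add
    by (simp add: algebra_simps)
  have 2: "snd (comp2 \<sigma> \<tau>) - var_y = subst2 (snd \<sigma> - var_y) \<tau> + (snd \<tau> - var_y)"
    by (simp add: comp2_def subst2_diff subst2_var[OF nc])
  show ?thesis
    using assms unfolding shear_def 1 2
    by (intro conjI order_ge_add order_ge_subst2[OF nc] order_ge_const_mult) auto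
qed

lemma shear_right_inverse:
  assumes "shear b \<sigma>"
  shows "\<exists>\<tau>. shear (- b) \<tau> \<and> comp2 \<sigma> \<tau> = (var_x, var_y) \<and>
     (fst \<sigma> \<in> conv2 \<and> snd \<sigma> \<in> conv2 \<longrightarrow> fst \<tau> \<in> conv2 \<and> snd \<tau> \<in> conv2)"
proof -
  define p q where "p = fst \<sigma> - (var_x + const2 b * var_y)" and "q = snd \<sigma> - var_y"
  have pq: "order_ge 2 p" "order_ge 2 q"
    using assms by (simp_all add: shear_def p_def q_def)
  \<comment> \<open>Let A be the linear part of \<sigma>, so that \<sigma> = A + (p, q). Then
    \<sigma>(\<tau>) = id reads \<tau> = A^(-1) - A^(-1) (p, q)(\<tau>), a fixed point equation with
    l = A^(-1) and g = - A^(-1) (p, q).\<close>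
  define l where "l = (var_x - const2 b * var_y, var_y)"
  define g where "g = (const2 b * q - p, - q)"
  have "no_const l"
    by (auto simp: l_def intro!: order_ge_diff order_ge_const_mult)
  moreover have "order_ge 2 (fst g)" "order_ge 2 (snd g)"
    using pq by (auto simp: g_def intro!: order_ge_diff order_ge_const_mult order_ge_uminus)
  ultimately obtain \<tau> where \<tau>: "no_const \<tau>" "fst \<tau> = fst l + subst2 (fst g) \<tau>" "snd \<tau> = snd l + subst2 (snd g) \<tau>"
     "{fst l, snd l, fst g, snd g} \<subseteq> conv2 \<longrightarrow> fst \<tau> \<in> conv2 \<and> snd \<tau> \<in> conv2"
    using fixed_point_subst2[of l g] by blast
  have "order_ge 2 (subst2 (fst g) \<tau>)" "order_ge 2 (subst2 (snd g) \<tau>)"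
    using \<open>order_ge 2 (fst g)\<close> \<open>order_ge 2 (snd g)\<close> \<tau>(1) by (auto intro: order_ge_subst2)
  moreover have "fst \<tau> - (var_x + const2 (- b) * var_y) = subst2 (fst g) \<tau>" "snd \<tau> - var_y = subst2 (snd g) \<tau>"
    using \<tau>(2,3) by (simp_all add: l_def const2_minus)
  ultimately have "shear (- b) \<tau>"
    by (simp add: shear_def)
  moreover have "comp2 \<sigma> \<tau> = (var_x, var_y)"
  proof -
    have \<sigma>: "fst \<sigma> = var_x + const2 b * var_y + p" "snd \<sigma> = var_y + q"
      by (simp_all add: p_def q_def)
    have q: "snd \<tau> = var_y - subst2 q \<tau>"
      using \<tau>(3) by (simp add: l_def g_def subst2_uminus)
    have "fst \<tau> = var_x - const2 b * var_y + (const2 b * subst2 q \<tau> - subst2 p \<tau>)"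
      using \<tau>(2) by (simp add: l_def g_def subst2_diff subst2_const_mult)
    then have "fst \<tau> + const2 b * snd \<tau> = var_x - subst2 p \<tau>"
      unfolding q by (simp add: algebra_simps)
    then show ?thesis
      unfolding comp2_def \<sigma> using q by (simp add: subst2_add subst2_const_mult subst2_var[OF \<tau>(1)])
  qed
  moreover have "{fst l, snd l, fst g, snd g} \<subseteq> conv2" if "fst \<sigma> \<in> conv2" "snd \<sigma> \<in> conv2"
    using that by (auto simp: l_def g_def p_def q_def intro!: conv2_diff conv2_const_mult conv2_add conv2_uminus)
  ultimately show ?thesis
    using \<tau>(4) by blast
qed

text \<open>The right inverse \<tau> is again a shear and has a right inverse of its own; by
  associativity that one is \<sigma>, so \<tau> is also a left inverse.\<close>

lemma shear_inverse:
  assumes "shear b \<sigma>"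
  shows "\<exists>\<tau>. shear (- b) \<tau> \<and> comp2 \<sigma> \<tau> = (var_x, var_y) \<and> comp2 \<tau> \<sigma> = (var_x, var_y) \<and>
     (fst \<sigma> \<in> conv2 \<and> snd \<sigma> \<in> conv2 \<longrightarrow> fst \<tau> \<in> conv2 \<and> snd \<tau> \<in> conv2)"
proof -
  obtain \<tau> where \<tau>: "shear (- b) \<tau>" "comp2 \<sigma> \<tau> = (var_x, var_y)"
     "fst \<sigma> \<in> conv2 \<and> snd \<sigma> \<in> conv2 \<longrightarrow> fst \<tau> \<in> conv2 \<and> snd \<tau> \<in> conv2"
    using shear_right_inverse[OF assms] by blast
  obtain \<sigma>' where \<sigma>': "shear b \<sigma>'" "comp2 \<tau> \<sigma>' = (var_x, var_y)"
    using shear_right_inverse[OF \<tau>(1)] by auto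
  have "\<sigma> = comp2 (comp2 \<sigma> \<tau>) \<sigma>'"
    using \<sigma>' \<tau>(1) by (simp add: comp2_assoc shear_no_const comp2_id_right)
  then have "\<sigma> = \<sigma>'"
    using \<sigma>'(1) by (simp add: \<tau>(2) comp2_id_left shear_no_const)
  then show ?thesis
    using \<tau> \<sigma>'(2) by blast
qed


section \<open>Reparametrizations\<close>

definition reparam :: "complex fps \<Rightarrow> bool" where
  "reparam \<rho> \<longleftrightarrow> \<rho> $ 0 = 0 \<and> \<rho> $ 1 = 1"

lemma reparam_fps_X: "reparam fps_X"
  by (simp add: reparam_def)

lemma reparam_eq: "reparam \<rho> \<Longrightarrow> \<rho> = fps_X * fps_shift 1 \<rho>"
  by (rule fps_ext) (auto simp: reparam_def)

lemma reparam_compose: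
  assumes "reparam \<rho>" "reparam \<theta>"
  shows "reparam (\<rho> oo \<theta>)"
  using assms by (auto simp: reparam_def fps_compose_nth)

lemma reparam_inv:
  assumes "reparam \<rho>"
  shows "fps_inv \<rho> oo \<rho> = fps_X" "\<rho> oo fps_inv \<rho> = fps_X" "reparam (fps_inv \<rho>)"
proof -
  define \<kappa> where "\<kappa> = fps_inv \<rho>"
  show left: "fps_inv \<rho> oo \<rho> = fps_X"
    using assms by (intro fps_inv) (auto simp: reparam_def)
  have "\<kappa> $ 0 = 0"
    using arg_cong[OF left, of "\<lambda>f. f $ 0"] by (simp add: \<kappa>_def)
  moreover have "\<kappa> $ 1 = 1"
    using arg_cong[OF left, of "\<lambda>f. f $ 1"] assms by (simp add: \<kappa>_def fps_compose_nth reparam_def)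
  ultimately show "reparam (fps_inv \<rho>)"
    by (simp add: reparam_def \<kappa>_def)
  show "\<rho> oo fps_inv \<rho> = fps_X"
    using assms by (intro fps_inv_right) (auto simp: reparam_def)
qed

lemma reparam_compose_inv_cancel:
  assumes "reparam \<rho>"
  shows "(f oo \<rho>) oo fps_inv \<rho> = f" "(f oo fps_inv \<rho>) oo \<rho> = f"
  using fps_compose_assoc[of "fps_inv \<rho>" \<rho> f] fps_compose_assoc[of \<rho> "fps_inv \<rho>" f] reparam_inv[OF assms] assms
  by (auto simp: reparam_def)

lemma fps_X_power_dvd_mult_unit:
  assumes "G $ 0 \<noteq> (0::complex)" "fps_X ^ k dvd f * G"
  shows "fps_X ^ k dvd f"
proof -
  have "fps_X ^ k dvd (f * G) * inverse G"
    using assms(2) by (rule dvd_mult2)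
  then show ?thesis
    using assms(1) by (simp add: mult.assoc inverse_mult_eq_1')
qed

lemma fps_X_dvd_iff: "fps_X dvd (f :: complex fps) \<longleftrightarrow> f $ 0 = 0"
  using fps_X_power_dvd_iff[of 1 f] by simp

lemma fps_taylor: 
  fixes f :: "complex fps"
  shows "f = (\<Sum>k\<le>L. fps_const (f $ k) * fps_X ^ k) + fps_X ^ Suc L * fps_shift (Suc L) f"
proof (rule fps_ext)
  fix n
  have "(\<Sum>k\<le>L. (fps_const (f $ k) * fps_X ^ k) $ n) = (\<Sum>k\<le>L. if k = n then f $ n else 0)"
    by (intro sum.cong refl) auto
  then show "f $ n = ((\<Sum>k\<le>L. fps_const (f $ k) * fps_X ^ k) + fps_X ^ Suc L * fps_shift (Suc L) f) $ n"
    by (simp add: fps_sum_nth sum.delta fps_X_power_mult_nth del: power_Suc)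
qed

lemma dvd_power_diff_compose:
  fixes \<theta> \<theta>' :: "complex fps"
  assumes "\<theta> $ 0 = 0" "\<theta>' $ 0 = 0" "fps_X ^ d dvd \<theta> - \<theta>'"
  shows "fps_X ^ (d + n) dvd \<theta> ^ Suc n - \<theta>' ^ Suc n"
proof -
  have "fps_X ^ n dvd (\<Sum>p<Suc n. \<theta> ^ p * \<theta>' ^ (n - p))"
  proof (rule dvd_sum)
    fix p assume "p \<in> {..<Suc n}"
    then have "fps_X ^ n = fps_X ^ p * (fps_X ^ (n - p) :: complex fps)"
      by (simp flip: power_add)
    moreover have "fps_X ^ p * fps_X ^ (n - p) dvd \<theta> ^ p * \<theta>' ^ (n - p)"
      using assms by (intro mult_dvd_mono dvd_power_same) (auto simp: fps_X_dvd_iff)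
    ultimately show "fps_X ^ n dvd \<theta> ^ p * \<theta>' ^ (n - p)"
      by (simp only:)
  qed
  then show ?thesis
    unfolding diff_power_eq_sum power_add using assms(3) by (intro mult_dvd_mono)
qed

lemma dvd_compose_diff_0:
  fixes \<theta> \<theta>' :: "complex fps"
  assumes "\<theta> $ 0 = 0" "\<theta>' $ 0 = 0" "fps_X ^ d dvd \<theta> - \<theta>'"
  shows "fps_X ^ d dvd (f oo \<theta>) - (f oo \<theta>')"
  unfolding fps_X_power_dvd_iff
proof (intro allI impI)
  fix n assume "n < d"
  have "(\<theta> ^ i) $ n = (\<theta>' ^ i) $ n" for i
  proof (cases i)
    case (Suc k)
    have "fps_X ^ (d + k) dvd \<theta> ^ Suc k - \<theta>' ^ Suc k"
      using assms by (rule dvd_power_diff_compose)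
    then have "(\<theta> ^ Suc k - \<theta>' ^ Suc k) $ n = 0"
      using \<open>n < d\<close> unfolding fps_X_power_dvd_iff by auto
    then show ?thesis
      by (simp add: Suc)
  qed simp
  then show "((f oo \<theta>) - (f oo \<theta>')) $ n = 0"
    by (simp add: fps_compose_nth)
qed

text \<open>A first order Taylor estimate: the derivative of f has order k, so moving the argument
  by order d moves f by order d + k.\<close>

lemma dvd_compose_diff:
  fixes \<theta> \<theta>' :: "complex fps"
  assumes "\<theta> $ 0 = 0" "\<theta>' $ 0 = 0" "fps_X ^ d dvd \<theta> - \<theta>'" "fps_X ^ Suc k dvd f"
  shows "fps_X ^ (d + k) dvd (f oo \<theta>) - (f oo \<theta>')"
proof -
  obtain g where g: "f = fps_X ^ Suc k * g"
    using assms(4) by (rule dvdE)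
  have "(f oo \<theta>) - (f oo \<theta>') =
      (\<theta> ^ Suc k - \<theta>' ^ Suc k) * (g oo \<theta>) + \<theta>' ^ Suc k * ((g oo \<theta>) - (g oo \<theta>'))"
    using assms(1,2) unfolding g
    by (simp add: fps_compose_mult_distrib fps_X_power_compose del: power_Suc) (simp add: algebra_simps)
  moreover have "fps_X ^ (d + k) dvd (\<theta> ^ Suc k - \<theta>' ^ Suc k) * (g oo \<theta>)"
    using assms by (intro dvd_mult2 dvd_power_diff_compose)
  moreover have "fps_X ^ (Suc k + d) dvd \<theta>' ^ Suc k * ((g oo \<theta>) - (g oo \<theta>'))"
    unfolding power_add using assms
    by (intro mult_dvd_mono dvd_compose_diff_0 dvd_power_same) (auto simp: fps_X_dvd_iff)
  then have "fps_X ^ (d + k) dvd \<theta>' ^ Suc k * ((g oo \<theta>) - (g oo \<theta>'))"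
    by (rule power_le_dvd) simp
  ultimately show ?thesis
    by simp
qed

text \<open>A reparametrization tangent to the identity moves t by order 2 and hence preserves
  leading terms.\<close>

lemma dvd_compose_reparam_diff:
  assumes "reparam \<kappa>" "fps_X ^ j dvd v"
  shows "fps_X ^ Suc j dvd (v oo \<kappa>) - v"
proof -
  have "fps_X ^ 2 dvd \<kappa> - fps_X"
    using assms(1) unfolding fps_X_power_dvd_iff reparam_def by (auto simp: less_2_cases_iff)
  then show ?thesis
  proof (cases j)
    case 0
    then show ?thesis
      using assms(1) by (simp add: fps_X_dvd_iff)
  next
    case (Suc k)
    then show ?thesis
      using dvd_compose_diff[of \<kappa> fps_X 2 k v] assms \<open>fps_X ^ 2 dvd \<kappa> - fps_X\<close> by (simp add: reparam_def)
  qed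
qed

lemma fps_root_exists:
  fixes f :: "complex fps"
  assumes "f $ 0 = c ^ m" "c \<noteq> 0" "m > 0"
  shows "\<exists>w. w ^ m = f \<and> w $ 0 = c"
proof -
  obtain k where m: "m = Suc k"
    using assms(3) by (cases m) auto
  have "fps_radical (\<lambda>_ _. c) (Suc k) f ^ Suc k = f"
    using power_radical[of f "\<lambda>_ _. c" k] assms by (simp add: m)
  then show ?thesis
    by (intro exI[of _ "fps_radical (\<lambda>_ _. c) m f"]) (simp add: m)
qed


section \<open>Flow of a vector field on the line\<close>

text \<open>The terms of exp(\<epsilon> d/dt) f, that is, the Taylor coefficients in the time
  variable of f transported along the vector field \<epsilon> d/dt.\<close>

definition flow_coeff :: "complex fps \<Rightarrow> nat \<Rightarrow> complex fps \<Rightarrow> complex fps" where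
  "flow_coeff \<epsilon> n f = fps_const (1 / fact n) * ((\<lambda>g. \<epsilon> * fps_deriv g) ^^ n) f"

definition flow_sum :: "complex fps \<Rightarrow> nat \<Rightarrow> complex fps \<Rightarrow> complex fps" where
  "flow_sum \<epsilon> L f = (\<Sum>n\<le>L. flow_coeff \<epsilon> n f)"

lemma flow_coeff_0 [simp]: "flow_coeff \<epsilon> 0 f = f"
  by (simp add: flow_coeff_def)

lemma flow_coeff_Suc:
  "of_nat (Suc n) * flow_coeff \<epsilon> (Suc n) f = \<epsilon> * fps_deriv (flow_coeff \<epsilon> n f)"
proof -
  have "of_nat (Suc n) * (1 / fact (Suc n)) = (1 / fact n :: complex)"
    by (simp add: field_simps del: of_nat_Suc)
  then have "of_nat (Suc n) * fps_const (1 / fact (Suc n)) = (fps_const (1 / fact n) :: complex fps)"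
    by (simp only: fps_of_nat[symmetric] fps_const_mult)
  then have "of_nat (Suc n) * flow_coeff \<epsilon> (Suc n) f =
      fps_const (1 / fact n) * ((\<lambda>g. \<epsilon> * fps_deriv g) ^^ Suc n) f"
    by (simp only: flow_coeff_def mult.assoc[symmetric])
  then show ?thesis
    by (simp add: flow_coeff_def mult.left_commute del: of_nat_Suc)
qed

text \<open>Since n + 1 can be cancelled, the differential equation of the flow in time determines
  all coefficients from the initial one. Identities for the flow are proved by checking this
  recursion.\<close>

lemma flow_coeff_unique:
  assumes "\<And>n. of_nat (Suc n) * c (Suc n) = \<epsilon> * fps_deriv (c n)"
  shows "c n = flow_coeff \<epsilon> n (c 0)"
proof (induction n)
  case (Suc n)
  have "of_nat (Suc n) * c (Suc n) = of_nat (Suc n) * flow_coeff \<epsilon> (Suc n) (c 0)"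
    by (simp only: flow_coeff_Suc assms flip: Suc)
  moreover have "of_nat (Suc n) \<noteq> (0 :: complex fps)"
    by (simp only: of_nat_eq_0_iff)
  ultimately show ?case
    by (simp del: of_nat_Suc)
qed simp

text \<open>The Leibniz rule exponentiated: the Cauchy product satisfies the recursion of the
  flow.\<close>

lemma flow_coeff_mult:
  "flow_coeff \<epsilon> n (f * g) = (\<Sum>k\<le>n. flow_coeff \<epsilon> k f * flow_coeff \<epsilon> (n - k) g)"
proof -
  define c where "c n = (\<Sum>k\<le>n. flow_coeff \<epsilon> k f * flow_coeff \<epsilon> (n - k) g)" for n
  have "of_nat (Suc n) * c (Suc n) = \<epsilon> * fps_deriv (c n)" for n
  proof -
    \<comment> \<open>The factor n + 1 is split as k + (n + 1 - k), one summand for each factor of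
      the product.\<close>
    have "of_nat (Suc n) * c (Suc n) = (\<Sum>k\<le>Suc n. (of_nat k + of_nat (Suc n - k)) * (flow_coeff \<epsilon> k f * flow_coeff \<epsilon> (Suc n - k) g))"
      unfolding c_def sum_distrib_left
      by (intro sum.cong refl arg_cong2[where f = "(*)"]) (simp flip: of_nat_add)
    also have "\<dots> = (\<Sum>k\<le>Suc n. (of_nat k * flow_coeff \<epsilon> k f) * flow_coeff \<epsilon> (Suc n - k) g) +
        (\<Sum>k\<le>Suc n. flow_coeff \<epsilon> k f * (of_nat (Suc n - k) * flow_coeff \<epsilon> (Suc n - k) g))"
      unfolding sum.distrib[symmetric] by (intro sum.cong refl) (simp add: algebra_simps)
    also have "(\<Sum>k\<le>Suc n. (of_nat k * flow_coeff \<epsilon> k f) * flow_coeff \<epsilon> (Suc n - k) g) =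
        (\<Sum>k\<le>n. (of_nat (Suc k) * flow_coeff \<epsilon> (Suc k) f) * flow_coeff \<epsilon> (n - k) g)"
      by (subst sum.atMost_Suc_shift) simp
    also have "(\<Sum>k\<le>Suc n. flow_coeff \<epsilon> k f * (of_nat (Suc n - k) * flow_coeff \<epsilon> (Suc n - k) g)) =
        (\<Sum>k\<le>n. flow_coeff \<epsilon> k f * (of_nat (Suc (n - k)) * flow_coeff \<epsilon> (Suc (n - k)) g))"
      by (subst sum.atMost_Suc) (simp add: Suc_diff_le del: of_nat_Suc)
    also have "(\<Sum>k\<le>n. (of_nat (Suc k) * flow_coeff \<epsilon> (Suc k) f) * flow_coeff \<epsilon> (n - k) g) +
        (\<Sum>k\<le>n. flow_coeff \<epsilon> k f * (of_nat (Suc (n - k)) * flow_coeff \<epsilon> (Suc (n - k)) g)) = \<epsilon> * fps_deriv (c n)"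
      unfolding flow_coeff_Suc c_def fps_deriv_sum sum_distrib_left sum.distrib[symmetric]
      by (intro sum.cong refl) (simp add: algebra_simps)
    finally show ?thesis .
  qed
  then have "c n = flow_coeff \<epsilon> n (c 0)"
    by (rule flow_coeff_unique)
  then show ?thesis
    by (simp add: c_def)
qed

lemma flow_coeff_add: "flow_coeff \<epsilon> n (f + g) = flow_coeff \<epsilon> n f + flow_coeff \<epsilon> n g"
proof -
  define c where "c n = flow_coeff \<epsilon> n f + flow_coeff \<epsilon> n g" for n
  have "of_nat (Suc n) * c (Suc n) = \<epsilon> * fps_deriv (c n)" for n
    unfolding c_def distrib_left flow_coeff_Suc by (simp add: distrib_left)
  then have "c n = flow_coeff \<epsilon> n (c 0)"
    by (rule flow_coeff_unique)
  then show ?thesis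
    by (simp add: c_def)
qed

lemma flow_coeff_const: "flow_coeff \<epsilon> n (fps_const c) = (if n = 0 then fps_const c else 0)"
  using flow_coeff_unique[of "\<lambda>n. if n = 0 then fps_const c else 0" \<epsilon> n] by simp

lemma flow_sum_const: "flow_sum \<epsilon> L (fps_const c) = fps_const c"
  by (simp add: flow_sum_def flow_coeff_const sum.delta)

lemma flow_sum_add: "flow_sum \<epsilon> L (f + g) = flow_sum \<epsilon> L f + flow_sum \<epsilon> L g"
  by (simp add: flow_sum_def flow_coeff_add sum.distrib)

lemma flow_sum_0: "flow_sum \<epsilon> L 0 = 0"
  using flow_sum_const[of \<epsilon> L 0] by simp

lemma flow_sum_sum: "flow_sum \<epsilon> L (sum f A) = (\<Sum>a\<in>A. flow_sum \<epsilon> L (f a))"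
  by (induction A rule: infinite_finite_induct) (simp_all add: flow_sum_add flow_sum_0)

text \<open>This is why \<epsilon> of order 2 is required throughout: each application raises the
  order by one, so the exponential series converges adically and its part up to L is exact modulo
  t^(L+1).\<close>

lemma dvd_vector_field:
  assumes "fps_X ^ 2 dvd \<epsilon>" "fps_X ^ k dvd (f :: complex fps)"
  shows "fps_X ^ Suc k dvd \<epsilon> * fps_deriv f"
proof (cases k)
  case 0
  have "fps_X ^ 1 dvd \<epsilon>"
    using assms(1) by (rule power_le_dvd) simp
  then show ?thesis
    using 0 by simp
next
  case (Suc l)
  have "fps_X ^ l dvd fps_deriv f"
    using assms(2) unfolding Suc fps_X_power_dvd_iff by simp
  then have "fps_X ^ (2 + l) dvd \<epsilon> * fps_deriv f"
    using assms(1) unfolding power_add by (intro mult_dvd_mono)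
  then show ?thesis
    by (simp add: Suc)
qed

lemma dvd_flow_coeff:
  assumes "fps_X ^ 2 dvd \<epsilon>" "fps_X ^ k dvd f"
  shows "fps_X ^ (k + n) dvd flow_coeff \<epsilon> n f"
proof -
  have "fps_X ^ (k + n) dvd ((\<lambda>g. \<epsilon> * fps_deriv g) ^^ n) f"
    by (induction n) (simp_all add: assms(2) dvd_vector_field[OF assms(1), unfolded power_Suc])
  then show ?thesis
    by (simp add: flow_coeff_def)
qed

text \<open>The full exponential is multiplicative. Cutting it at L loses only products of the a-th
  and the b-th term with a + b > L, and these have order above L.\<close>

lemma flow_sum_mult:
  assumes "fps_X ^ 2 dvd \<epsilon>"
  shows "fps_X ^ Suc L dvd flow_sum \<epsilon> L (f * g) - flow_sum \<epsilon> L f * flow_sum \<epsilon> L g"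
proof -
  let ?t = "\<lambda>a b. flow_coeff \<epsilon> a f * flow_coeff \<epsilon> b g"
  let ?A = "{(a, b). a + b \<le> L}" and ?B = "{..L} \<times> {..L}"
  have "flow_sum \<epsilon> L (f * g) = (\<Sum>(a, b)\<in>?A. ?t a b)"
    unfolding flow_sum_def flow_coeff_mult by (rule sum.triangle_reindex_eq[symmetric])
  moreover have "flow_sum \<epsilon> L f * flow_sum \<epsilon> L g = (\<Sum>(a, b)\<in>?B. ?t a b)"
    by (simp add: flow_sum_def sum_product sum.cartesian_product)
  moreover have "(\<Sum>(a, b)\<in>?B. ?t a b) = (\<Sum>(a, b)\<in>?B - ?A. ?t a b) + (\<Sum>(a, b)\<in>?A. ?t a b)"
    by (rule sum.subset_diff) auto
  ultimately have "flow_sum \<epsilon> L (f * g) - flow_sum \<epsilon> L f * flow_sum \<epsilon> L g = - (\<Sum>(a, b)\<in>?B - ?A. ?t a b)"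
    by simp
  moreover have "fps_X ^ Suc L dvd (\<Sum>(a, b)\<in>?B - ?A. ?t a b)"
  proof (rule dvd_sum)
    fix p assume p: "p \<in> ?B - ?A"
    obtain a b where ab: "p = (a, b)"
      by (cases p)
    have "fps_X ^ (a + b) dvd ?t a b"
      unfolding power_add using dvd_flow_coeff[OF assms, of 0] by (intro mult_dvd_mono) auto
    then have "fps_X ^ Suc L dvd ?t a b"
      by (rule power_le_dvd) (use p ab in auto)
    then show "fps_X ^ Suc L dvd (case p of (a, b) \<Rightarrow> ?t a b)"
      by (simp add: ab)
  qed
  ultimately show ?thesis
    by (simp only: dvd_minus_iff)
qed

lemma dvd_diff_trans: 
  fixes a :: "'a :: comm_ring_1"
  shows "p dvd a - b \<Longrightarrow> p dvd b - c \<Longrightarrow> p dvd a - c"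
  using dvd_add[of p "a - b" "b - c"] by simp

lemma flow_sum_fps_X_nth:
  assumes "fps_X ^ 2 dvd \<epsilon>"
  shows "reparam (flow_sum \<epsilon> L fps_X)"
proof -
  have "flow_sum \<epsilon> L fps_X $ i = fps_X $ i" if "i < 2" for i
  proof -
    have "flow_sum \<epsilon> L fps_X $ i = (\<Sum>n\<le>L. if n = 0 then fps_X $ i else 0)"
      unfolding flow_sum_def fps_sum_nth
    proof (intro sum.cong refl)
      fix n
      have "fps_X ^ (1 + n) dvd flow_coeff \<epsilon> n fps_X"
        using assms by (intro dvd_flow_coeff) auto
      then show "flow_coeff \<epsilon> n fps_X $ i = (if n = 0 then fps_X $ i else 0)"
        using that unfolding fps_X_power_dvd_iff by (cases n) auto
    qed
    then show ?thesis
      by (simp add: sum.delta)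
  qed
  from this[of 0] this[of 1] show ?thesis
    by (simp add: reparam_def)
qed

lemma flow_sum_power:
  assumes "fps_X ^ 2 dvd \<epsilon>"
  shows "fps_X ^ Suc L dvd flow_sum \<epsilon> L (f ^ k) - flow_sum \<epsilon> L f ^ k"
proof (induction k)
  case 0
  then show ?case
    using flow_sum_const[of \<epsilon> L 1] by simp
next
  case (Suc k)
  have "fps_X ^ Suc L dvd flow_sum \<epsilon> L f * (flow_sum \<epsilon> L (f ^ k) - flow_sum \<epsilon> L f ^ k)"
    by (rule dvd_mult[OF Suc.IH])
  then have "fps_X ^ Suc L dvd flow_sum \<epsilon> L f * flow_sum \<epsilon> L (f ^ k) - flow_sum \<epsilon> L f ^ Suc k"
    by (simp only: right_diff_distrib power_Suc)
  then show ?case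
    using dvd_diff_trans[OF flow_sum_mult[OF assms, of L f "f ^ k"]] by (simp only: power_Suc)
qed

text \<open>Modulo t^(L+1) the truncated exponential is a ring homomorphism, continuous for the
  t-adic topology, and therefore composition with its value at t.\<close>

lemma flow_sum_compose:
  assumes \<epsilon>: "fps_X ^ 2 dvd \<epsilon>"
  shows "fps_X ^ Suc L dvd flow_sum \<epsilon> L f - (f oo flow_sum \<epsilon> L fps_X)"
proof -
  define \<theta> where "\<theta> = flow_sum \<epsilon> L fps_X"
  have \<theta>0: "\<theta> $ 0 = 0"
    using flow_sum_fps_X_nth[OF \<epsilon>, of L] by (simp add: \<theta>_def reparam_def)
  define g where "g = fps_X ^ Suc L * fps_shift (Suc L) f"
  have f: "f = (\<Sum>k\<le>L. fps_const (f $ k) * fps_X ^ k) + g"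
    unfolding g_def by (rule fps_taylor)
  have g: "fps_X ^ Suc L dvd g"
    by (simp add: g_def)
  have "flow_sum \<epsilon> L f - (f oo \<theta>) =
     (\<Sum>k\<le>L. flow_sum \<epsilon> L (fps_const (f $ k) * fps_X ^ k) - fps_const (f $ k) * \<theta> ^ k) + (flow_sum \<epsilon> L g - (g oo \<theta>))"
    by (subst (1 2) f)
       (simp add: flow_sum_add flow_sum_sum fps_compose_add_distrib fps_compose_sum_distrib
         fps_compose_mult_distrib[OF \<theta>0] fps_X_power_compose[OF \<theta>0] sum_subtractf)
  moreover have "fps_X ^ Suc L dvd flow_sum \<epsilon> L (fps_const (f $ k) * fps_X ^ k) - fps_const (f $ k) * \<theta> ^ k" for k
  proof -
    have "fps_X ^ Suc L dvd fps_const (f $ k) * (flow_sum \<epsilon> L (fps_X ^ k) - \<theta> ^ k)"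
      unfolding \<theta>_def by (rule dvd_mult[OF flow_sum_power[OF \<epsilon>]])
    then have "fps_X ^ Suc L dvd fps_const (f $ k) * flow_sum \<epsilon> L (fps_X ^ k) - fps_const (f $ k) * \<theta> ^ k"
      by (simp only: right_diff_distrib)
    then show ?thesis
      using dvd_diff_trans[OF flow_sum_mult[OF \<epsilon>, of L "fps_const (f $ k)" "fps_X ^ k", unfolded flow_sum_const]]
      by blast
  qed
  moreover have "fps_X ^ Suc L dvd flow_sum \<epsilon> L g"
    unfolding flow_sum_def
  proof (rule dvd_sum)
    show "fps_X ^ Suc L dvd flow_coeff \<epsilon> n g" for n
      using dvd_flow_coeff[OF \<epsilon> g, of n] by (rule power_le_dvd) simp
  qed
  moreover have "fps_X ^ Suc L dvd (g oo \<theta>)"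
    using \<theta>0 g by (rule fps_X_power_dvd_compose)
  ultimately show ?thesis
    unfolding \<theta>_def[symmetric]
    by (simp only:) (rule dvd_add[OF dvd_sum dvd_diff])
qed

text \<open>The sequences \<open>U\<close> and \<open>W\<close> are the pullbacks of the iterates \<open>D\<^sup>n u\<close> and \<open>D\<^sup>n w\<close> of a
  derivation \<open>D\<close> of the plane that is related to the vector field \<open>\<epsilon>\<close> on the branch up to the
  error \<open>v\<close> in the \<open>w\<close> direction.\<close>

lemma branch_flow:
  fixes s \<epsilon> v :: "complex fps" and U W dU dW :: "nat \<Rightarrow> complex fps"
  assumes m: "0 < m" "m < j" "j \<le> L"
    and s: "fps_X ^ Suc m dvd s" and \<epsilon>: "fps_X ^ 2 dvd \<epsilon>" and v: "fps_X ^ j dvd v"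
    and U0: "U 0 = fps_X ^ m" and W0: "W 0 = s"
    and U: "\<And>n. \<epsilon> * fps_deriv (U n) = U (Suc n) + dU n * v"
    and W: "\<And>n. \<epsilon> * fps_deriv (W n) = W (Suc n) + dW n * v"
    and dW: "dW 0 = 1" "\<And>n. 0 < n \<Longrightarrow> dW n $ 0 = 0"
  defines "\<sigma>u \<equiv> (\<Sum>n\<le>L. fps_const (1 / fact n) * U n)"
    and "\<sigma>w \<equiv> (\<Sum>n\<le>L. fps_const (1 / fact n) * W n)"
  shows "\<exists>\<theta>. reparam \<theta> \<and> \<sigma>u = \<theta> ^ m \<and> fps_X ^ Suc j dvd (\<sigma>w oo fps_inv \<theta>) - (s - v)"
proof -
  define I where "I n f = ((\<lambda>g. \<epsilon> * fps_deriv g) ^^ n) f" for n f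
  have flow: "flow_sum \<epsilon> L f = (\<Sum>n\<le>L. fps_const (1 / fact n) * I n f)" for f
    by (simp add: flow_sum_def flow_coeff_def I_def)
  have I_Suc: "I (Suc n) f = \<epsilon> * fps_deriv (I n f)" for n f
    by (simp add: I_def)
  \<comment> \<open>In the first coordinate the plane map follows the flow only modulo t^j, because
    v enters through \<open>dU\<close>. The missing order is recovered further down from the order
    of s.\<close>
  have B: "fps_X ^ j dvd I n (fps_X ^ m) - U n" for n
  proof (induction n)
    case 0
    then show ?case by (simp add: I_def U0)
  next
    case (Suc n)
    have "I (Suc n) (fps_X ^ m) - U (Suc n) = \<epsilon> * fps_deriv (I n (fps_X ^ m) - U n) + dU n * v"
      using U[of n] by (simp add: I_Suc algebra_simps)
    moreover have "fps_X ^ j dvd \<epsilon> * fps_deriv (I n (fps_X ^ m) - U n)"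
      using dvd_vector_field[OF \<epsilon> Suc] by (rule power_le_dvd) simp
    ultimately show ?case
      using v by simp
  qed
  have A1: "I 1 s - W 1 = v"
    using W[of 0] by (simp add: I_def W0 dW)
  \<comment> \<open>In the linear term the error is exactly v. In the later terms it is either
    differentiated along \<epsilon> or multiplied by some \<open>dW n\<close> with n > 0, and both
    raise its order by one. This is the gain from exponentiating.\<close>
  have A: "fps_X ^ Suc j dvd I (Suc (Suc n)) s - W (Suc (Suc n))" for n
  proof -
    have step: "I (Suc n) s - W (Suc n) = \<epsilon> * fps_deriv (I n s - W n) + dW n * v" for n
      using W[of n] by (simp add: I_Suc algebra_simps)
    have dWv: "fps_X ^ Suc j dvd dW (Suc n) * v" for n
      unfolding power_Suc using dW(2)[of "Suc n"] v by (intro mult_dvd_mono) (auto simp: fps_X_dvd_iff)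
    have j: "fps_X ^ j dvd I (Suc n) s - W (Suc n)" for n
    proof (induction n)
      case 0
      then show ?case using A1 v by simp
    next
      case (Suc n)
      have "fps_X ^ j dvd \<epsilon> * fps_deriv (I (Suc n) s - W (Suc n))"
        using dvd_vector_field[OF \<epsilon> Suc] by (rule power_le_dvd) simp
      then show ?case
        unfolding step[of "Suc n"] using v by simp
    qed
    show ?thesis
      unfolding step[of "Suc n"] using dvd_vector_field[OF \<epsilon> j] dWv by (rule dvd_add)
  qed
  have \<sigma>u: "fps_X ^ j dvd flow_sum \<epsilon> L (fps_X ^ m) - \<sigma>u"
    unfolding flow \<sigma>u_def sum_subtractf[symmetric] right_diff_distrib[symmetric]
    by (intro dvd_sum dvd_mult B)
  have \<sigma>w: "fps_X ^ Suc j dvd flow_sum \<epsilon> L s - \<sigma>w - v"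
  proof -
    have "flow_sum \<epsilon> L s - \<sigma>w = (\<Sum>n\<le>L. fps_const (1 / fact n) * (I n s - W n))"
      by (simp add: flow \<sigma>w_def sum_subtractf right_diff_distrib)
    moreover have "v = (\<Sum>n\<le>L. if n = 1 then v else 0)"
      using m by (simp add: sum.delta)
    ultimately have eq: "flow_sum \<epsilon> L s - \<sigma>w - v =
        (\<Sum>n\<le>L. fps_const (1 / fact n) * (I n s - W n) - (if n = 1 then v else 0))"
      by (simp only: sum_subtractf)
    show ?thesis
      unfolding eq
    proof (rule dvd_sum)
      fix n
      consider "n = 0" | "n = 1" | k where "n = Suc (Suc k)"
        by (metis One_nat_def not0_implies_Suc)
      then show "fps_X ^ Suc j dvd fps_const (1 / fact n) * (I n s - W n) - (if n = 1 then v else 0)"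
      proof cases
        case 1
        then show ?thesis by (simp add: I_def W0)
      next
        case 2
        then show ?thesis using A1 by simp
      next
        case 3
        then show ?thesis
          using dvd_mult[OF A[of k], of "fps_const (1 / fact n)"] by (simp del: power_Suc fact_Suc)
      qed
    qed
  qed
  define \<theta>0 where "\<theta>0 = flow_sum \<epsilon> L fps_X"
  have \<theta>0: "reparam \<theta>0"
    unfolding \<theta>0_def using \<epsilon> by (rule flow_sum_fps_X_nth)
  define w0 where "w0 = fps_shift 1 \<theta>0"
  have w0: "\<theta>0 = fps_X * w0" "w0 $ 0 = 1"
    using reparam_eq[OF \<theta>0] \<theta>0 by (simp_all add: w0_def reparam_def)
  have "fps_X ^ j dvd flow_sum \<epsilon> L (fps_X ^ m) - \<theta>0 ^ m"
    using flow_sum_power[OF \<epsilon>, of L fps_X m] m unfolding \<theta>0_def by (elim power_le_dvd) simp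
  then have "fps_X ^ j dvd (flow_sum \<epsilon> L (fps_X ^ m) - \<theta>0 ^ m) - (flow_sum \<epsilon> L (fps_X ^ m) - \<sigma>u)"
    using \<sigma>u by (rule dvd_diff)
  then have u: "fps_X ^ j dvd \<sigma>u - \<theta>0 ^ m"
    by simp
  then obtain h where h: "\<sigma>u - \<theta>0 ^ m = fps_X ^ j * h"
    by (rule dvdE)
  have Xj: "fps_X ^ j = fps_X ^ m * (fps_X ^ (j - m) :: complex fps)"
    using m by (simp flip: power_add)
  have \<sigma>u_eq: "\<sigma>u = fps_X ^ m * (w0 ^ m + fps_X ^ (j - m) * h)"
    using h by (simp add: w0 power_mult_distrib Xj algebra_simps)
  \<comment> \<open>An exact m-th root is taken, so that the first coordinate is again a pure power
    after reparametrization.\<close>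
  obtain w where w: "w ^ m = w0 ^ m + fps_X ^ (j - m) * h" "w $ 0 = 1"
    using fps_root_exists[of "w0 ^ m + fps_X ^ (j - m) * h" 1 m] w0 m by (auto simp: fps_power_zeroth)
  define \<theta> where "\<theta> = fps_X * w"
  have \<theta>: "reparam \<theta>"
    using w by (simp add: reparam_def \<theta>_def)
  have \<sigma>u\<theta>: "\<sigma>u = \<theta> ^ m"
    by (simp add: \<theta>_def power_mult_distrib w \<sigma>u_eq)
  obtain k where k: "m = Suc k"
    using m by (cases m) auto
  \<comment> \<open>The cofactor of w - w0 in w^m - w0^m. Its constant term is m, so it is a
    unit.\<close>
  define G where "G = (\<Sum>p<Suc k. w ^ p * w0 ^ (k - p))"
  have "G $ 0 = of_nat m"
    by (simp add: G_def fps_sum_nth fps_power_zeroth w w0 k)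
  then have "G $ 0 \<noteq> 0"
    using m by simp
  moreover have "fps_X ^ (j - m) dvd (w - w0) * G"
    using w(1) unfolding G_def diff_power_eq_sum[symmetric] k by (simp del: power_Suc)
  ultimately have "fps_X ^ (j - m) dvd w - w0"
    by (rule fps_X_power_dvd_mult_unit)
  then have "fps_X * fps_X ^ (j - m) dvd fps_X * (w - w0)"
    by (intro mult_dvd_mono) auto
  then have d: "fps_X ^ Suc (j - m) dvd \<theta> - \<theta>0"
    by (simp add: \<theta>_def w0 right_diff_distrib)
  \<comment> \<open>The exact and the approximate reparametrization differ in order j - m + 1. As s
    has order at least m + 1, the composites differ in order j + 1, so nothing is lost in the
    end.\<close>
  have "fps_X ^ (Suc (j - m) + m) dvd (s oo \<theta>) - (s oo \<theta>0)"
    using \<theta> \<theta>0 d s by (intro dvd_compose_diff) (auto simp: reparam_def)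
  moreover have "Suc (j - m) + m = Suc j"
    using m by simp
  ultimately have c1: "fps_X ^ Suc j dvd (s oo \<theta>) - (s oo \<theta>0)"
    by simp
  have "fps_X ^ Suc j dvd flow_sum \<epsilon> L s - (s oo \<theta>0)"
    unfolding \<theta>0_def using flow_sum_compose[OF \<epsilon>, of L s] m by (elim power_le_dvd) simp
  then have "fps_X ^ Suc j dvd (flow_sum \<epsilon> L s - (s oo \<theta>0)) - (flow_sum \<epsilon> L s - \<sigma>w - v) - ((s oo \<theta>) - (s oo \<theta>0))"
    by (rule dvd_diff[OF dvd_diff[OF _ \<sigma>w] c1])
  then have "fps_X ^ Suc j dvd \<sigma>w - ((s oo \<theta>) - v)"
    by (simp add: algebra_simps)
  then have "fps_X ^ Suc j dvd ((\<sigma>w - ((s oo \<theta>) - v)) oo fps_inv \<theta>)"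
    using reparam_inv(3)[OF \<theta>] by (intro fps_X_power_dvd_compose) (auto simp: reparam_def)
  then have "fps_X ^ Suc j dvd (\<sigma>w oo fps_inv \<theta>) - (s - (v oo fps_inv \<theta>))"
    by (simp add: fps_compose_sub_distrib reparam_compose_inv_cancel[OF \<theta>] del: power_Suc)
  moreover have "fps_X ^ Suc j dvd (v oo fps_inv \<theta>) - v"
    using reparam_inv(3)[OF \<theta>] v by (rule dvd_compose_reparam_diff)
  ultimately have "fps_X ^ Suc j dvd (\<sigma>w oo fps_inv \<theta>) - (s - (v oo fps_inv \<theta>)) - ((v oo fps_inv \<theta>) - v)"
    by (rule dvd_diff)
  then have "fps_X ^ Suc j dvd (\<sigma>w oo fps_inv \<theta>) - (s - v)"
    by (simp add: algebra_simps)
  then show ?thesis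
    using \<theta> \<sigma>u\<theta> by blast
qed


section \<open>Formal equivalence of bigerms\<close>

text \<open>The relation defined by A[\<delta>] without convergence, with the reparametrizations
  moved to the side of \<psi> so that no inverse series occurs.\<close>

definition formal_equiv :: "nat \<Rightarrow> bigerm \<Rightarrow> bigerm \<Rightarrow> bool" where
  "formal_equiv \<delta> \<phi> \<psi> \<longleftrightarrow> (\<exists>b \<sigma> \<rho>1 \<rho>2. (\<delta> = 1 \<longrightarrow> b = 0) \<and> shear b \<sigma> \<and> reparam \<rho>1 \<and> reparam \<rho>2 \<and>
     germ_image \<sigma> (fst \<phi>) = germ_comp (fst \<psi>) \<rho>1 \<and> germ_image \<sigma> (snd \<phi>) = germ_comp (snd \<psi>) \<rho>2)"

lemma formal_equivI:
  assumes "\<delta> = 1 \<longrightarrow> b = 0" "shear b \<sigma>" "reparam \<rho>1" "reparam \<rho>2"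
    and "germ_image \<sigma> (fst \<phi>) = germ_comp (fst \<psi>) \<rho>1" "germ_image \<sigma> (snd \<phi>) = germ_comp (snd \<psi>) \<rho>2"
  shows "formal_equiv \<delta> \<phi> \<psi>"
  unfolding formal_equiv_def using assms by blast

lemma formal_equiv_refl:
  assumes "centered (fst \<phi>)" "centered (snd \<phi>)"
  shows "formal_equiv \<delta> \<phi> \<phi>"
proof -
  have "shear 0 (var_x, var_y)"
    by (simp add: shear_def)
  moreover have "germ_comp \<psi> fps_X = \<psi>" for \<psi>
    by (simp add: germ_comp_def)
  ultimately show ?thesis
    using assms reparam_fps_X germ_image_id by (intro formal_equivI[of \<delta> 0 "(var_x, var_y)" fps_X fps_X]) simp_all
qed

lemma germ_comp_germ_comp:
  "\<rho> $ 0 = 0 \<Longrightarrow> \<theta> $ 0 = 0 \<Longrightarrow> germ_comp (germ_comp \<psi> \<rho>) \<theta> = germ_comp \<psi> (\<rho> oo \<theta>)"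
  by (simp add: germ_comp_def fps_compose_assoc)

lemma formal_equiv_trans:
  assumes "formal_equiv \<delta> \<phi> \<psi>" "formal_equiv \<delta> \<psi> \<chi>"
    and c: "centered (fst \<phi>)" "centered (snd \<phi>)" "centered (fst \<psi>)" "centered (snd \<psi>)"
  shows "formal_equiv \<delta> \<phi> \<chi>"
proof -
  obtain b \<sigma> \<rho>1 \<rho>2 where 1: "\<delta> = 1 \<longrightarrow> b = 0" "shear b \<sigma>" "reparam \<rho>1" "reparam \<rho>2"
      "germ_image \<sigma> (fst \<phi>) = germ_comp (fst \<psi>) \<rho>1" "germ_image \<sigma> (snd \<phi>) = germ_comp (snd \<psi>) \<rho>2"
    using assms(1) unfolding formal_equiv_def by blast
  obtain b' \<sigma>' \<rho>1' \<rho>2' where 2: "\<delta> = 1 \<longrightarrow> b' = 0" "shear b' \<sigma>'" "reparam \<rho>1'" "reparam \<rho>2'"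
      "germ_image \<sigma>' (fst \<psi>) = germ_comp (fst \<chi>) \<rho>1'" "germ_image \<sigma>' (snd \<psi>) = germ_comp (snd \<chi>) \<rho>2'"
    using assms(2) unfolding formal_equiv_def by blast
  have 0: "\<rho>1 $ 0 = 0" "\<rho>2 $ 0 = 0" "\<rho>1' $ 0 = 0" "\<rho>2' $ 0 = 0"
    using 1 2 by (auto simp: reparam_def)
  have "germ_image (comp2 \<sigma>' \<sigma>) (fst \<phi>) = germ_comp (fst \<chi>) (\<rho>1' oo \<rho>1)"
    using 1 2 c 0 by (simp add: germ_image_comp2 shear_no_const germ_image_germ_comp germ_comp_germ_comp)
  moreover have "germ_image (comp2 \<sigma>' \<sigma>) (snd \<phi>) = germ_comp (snd \<chi>) (\<rho>2' oo \<rho>2)"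
    using 1 2 c 0 by (simp add: germ_image_comp2 shear_no_const germ_image_germ_comp germ_comp_germ_comp)
  moreover have "shear (b' + b) (comp2 \<sigma>' \<sigma>)"
    using 2 1 by (intro shear_comp2)
  ultimately show "formal_equiv \<delta> \<phi> \<chi>"
    using 1 2 reparam_compose[of \<rho>1' \<rho>1] reparam_compose[of \<rho>2' \<rho>2]
    by (intro formal_equivI[of \<delta> "b' + b" "comp2 \<sigma>' \<sigma>" "\<rho>1' oo \<rho>1" "\<rho>2' oo \<rho>2"]) simp_all
qed


section \<open>Differential forms\<close>

text \<open>\<open>Omega\<close> without convergence. The factor \<open>of_nat \<delta> - 1\<close>
  of the definition forces \<beta> = 0 for \<delta> = 1 and is otherwise absorbed into the free
  parameter.\<close>

definition formal_form :: "nat \<Rightarrow> fps2 \<times> fps2 \<Rightarrow> bool" where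
  "formal_form \<delta> \<omega> \<longleftrightarrow> order_ge 2 (fst \<omega>) \<and>
     (\<exists>\<beta>. (\<delta> = 1 \<longrightarrow> \<beta> = 0) \<and> order_ge 2 (snd \<omega> - const2 \<beta> * var_y))"

lemma max_ideal_pow_iff: "F \<in> max_ideal_pow k \<longleftrightarrow> F \<in> conv2 \<and> order_ge k F"
  by (simp add: max_ideal_pow_def order_ge_def)

lemma Omega_imp_formal_form:
  assumes "\<omega> \<in> Omega \<delta>"
  shows "formal_form \<delta> \<omega>"
proof -
  obtain \<eta>1 \<eta>2 \<beta> where "\<omega> = (\<eta>1, const2 (\<beta> * (of_nat \<delta> - 1)) * var_y + \<eta>2)" "order_ge 2 \<eta>1" "order_ge 2 \<eta>2"
    using assms by (auto simp: Omega_def max_ideal_pow_iff)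
  then show ?thesis
    unfolding formal_form_def by (intro conjI exI[of _ "\<beta> * (of_nat \<delta> - 1)"]) auto
qed

lemma formal_form_scale:
  assumes "formal_form \<delta> \<omega>"
  shows "formal_form \<delta> (const2 c * fst \<omega>, const2 c * snd \<omega>)"
proof -
  obtain \<beta> where \<beta>: "\<delta> = 1 \<longrightarrow> \<beta> = 0" "order_ge 2 (snd \<omega> - const2 \<beta> * var_y)"
    using assms by (auto simp: formal_form_def)
  have "order_ge 2 (const2 c * (snd \<omega> - const2 \<beta> * var_y))"
    using \<beta>(2) by (rule order_ge_const_mult)
  then have "order_ge 2 (const2 c * snd \<omega> - const2 (c * \<beta>) * var_y)"
    by (simp add: const2_mult right_diff_distrib mult.assoc)
  then show ?thesis
    using assms \<beta>(1) unfolding formal_form_def by (auto intro: order_ge_const_mult)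
qed

lemma pullback_form_scale:
  "centered \<phi> \<Longrightarrow> pullback_form (const2 c * fst \<omega>, const2 c * snd \<omega>) \<phi> = fps_const c * pullback_form \<omega> \<phi>"
  by (simp add: pullback_form_def subst1_mult subst1_const2 algebra_simps)

definition pull2 :: "fps2 \<times> fps2 \<Rightarrow> fps2 \<times> fps2 \<Rightarrow> fps2 \<times> fps2" where
  "pull2 \<tau> \<omega> = (subst2 (fst \<omega>) \<tau> * deriv_x (fst \<tau>) + subst2 (snd \<omega>) \<tau> * deriv_x (snd \<tau>),
               subst2 (fst \<omega>) \<tau> * deriv_y (fst \<tau>) + subst2 (snd \<omega>) \<tau> * deriv_y (snd \<tau>))"

lemma pullback_form_germ_image:
  assumes "no_const \<tau>" "centered \<psi>"
  shows "pullback_form \<omega> (germ_image \<tau> \<psi>) = pullback_form (pull2 \<tau> \<omega>) \<psi>"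
  using assms
  by (simp add: pullback_form_def pull2_def subst1_add subst1_mult subst1_subst2)
     (simp add: germ_image_def subst1_chain_rule algebra_simps)

lemma pullback_form_germ_comp:
  assumes "centered \<psi>" "\<rho> $ 0 = 0"
  shows "pullback_form \<omega> (germ_comp \<psi> \<rho>) = (pullback_form \<omega> \<psi> oo \<rho>) * fps_deriv \<rho>"
  using assms
  by (simp add: pullback_form_def subst1_germ_comp fps_compose_add_distrib fps_compose_mult_distrib)
     (simp add: germ_comp_def fps_compose_deriv algebra_simps)

text \<open>The space Omega[\<delta>] is stable under A[\<delta>]. The linear term y dy pulls back
  to v dv with v = y + q and q of order 2, which is y dy up to coefficients of order 2; coefficients
  of order 2 stay of order 2.\<close>

lemma formal_form_pull2:
  assumes \<omega>: "formal_form \<delta> \<omega>" and \<tau>: "shear b \<tau>"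
  shows "formal_form \<delta> (pull2 \<tau> \<omega>)"
proof -
  note nc = shear_no_const[OF \<tau>]
  obtain \<beta> where \<beta>: "\<delta> = 1 \<longrightarrow> \<beta> = 0" and \<omega>1: "order_ge 2 (fst \<omega>)"
    and \<omega>2: "order_ge 2 (snd \<omega> - const2 \<beta> * var_y)"
    using \<omega> by (auto simp: formal_form_def)
  define q where "q = snd \<tau> - var_y"
  have q: "order_ge 2 q" "snd \<tau> = var_y + q"
    using \<tau> by (simp_all add: q_def shear_def)
  define r where "r = subst2 (snd \<omega> - const2 \<beta> * var_y) \<tau> + const2 \<beta> * q"
  have r: "order_ge 2 r"
    unfolding r_def using \<omega>2 q by (intro order_ge_add order_ge_subst2 order_ge_const_mult nc)
  have s2: "subst2 (snd \<omega>) \<tau> = const2 \<beta> * var_y + r"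
    by (simp add: r_def subst2_diff subst2_const_mult subst2_var[OF nc] q(2) distrib_left)
  have s2': "order_ge 1 (subst2 (snd \<omega>) \<tau>)"
    unfolding s2 using order_ge_mono[OF r, of 1] by (intro order_ge_add order_ge_const_mult) auto
  have s1: "order_ge 2 (subst2 (fst \<omega>) \<tau>)"
    using \<omega>1 nc by (rule order_ge_subst2[rotated])
  have dq: "order_ge 1 (deriv_x q)" "order_ge 1 (deriv_y q)"
    using q order_ge_deriv_x[of 1 q] order_ge_deriv_y[of 1 q] by (simp_all add: numeral_2_eq_2)
  \<comment> \<open>The x-derivative of y + q is that of q and supplies the second order that the
    dy-coefficient may lack.\<close>
  have "order_ge 2 (subst2 (snd \<omega>) \<tau> * deriv_x (snd \<tau>))"
    using order_ge_mult[of 1 _ 1, OF s2' dq(1)] by (simp add: q(2) deriv_x_add numeral_2_eq_2)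
  then have "order_ge 2 (fst (pull2 \<tau> \<omega>))"
    unfolding pull2_def fst_conv using order_ge_mult1[OF s1] by (intro order_ge_add)
  moreover have "order_ge 2 (snd (pull2 \<tau> \<omega>) - const2 \<beta> * var_y)"
  proof -
    have "snd (pull2 \<tau> \<omega>) - const2 \<beta> * var_y =
        subst2 (fst \<omega>) \<tau> * deriv_y (fst \<tau>) + (r + subst2 (snd \<omega>) \<tau> * deriv_y q)"
      by (simp add: pull2_def q(2) deriv_y_add s2 algebra_simps)
    moreover have "order_ge 2 (subst2 (snd \<omega>) \<tau> * deriv_y q)"
      using order_ge_mult[of 1 _ 1, OF s2' dq(2)] by (simp add: numeral_2_eq_2)
    ultimately show ?thesis
      using s1 r by (auto intro!: order_ge_add order_ge_mult1)
  qed
  ultimately show ?thesis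
    using \<beta> by (auto simp: formal_form_def)
qed

lemma dvd_compose_reparam_iff:
  assumes "reparam \<rho>"
  shows "fps_X ^ k dvd (f oo \<rho>) * fps_deriv \<rho> \<longleftrightarrow> fps_X ^ k dvd f"
proof
  assume *: "fps_X ^ k dvd (f oo \<rho>) * fps_deriv \<rho>"
  have "fps_X ^ k dvd (f oo \<rho>)"
    by (rule fps_X_power_dvd_mult_unit[OF _ *]) (use assms in \<open>simp add: reparam_def\<close>)
  then have "fps_X ^ k dvd ((f oo \<rho>) oo fps_inv \<rho>)"
    using reparam_inv(3)[OF assms] by (simp add: fps_X_power_dvd_compose reparam_def)
  then show "fps_X ^ k dvd f"
    by (simp add: reparam_compose_inv_cancel[OF assms])
next
  assume "fps_X ^ k dvd f"
  then show "fps_X ^ k dvd (f oo \<rho>) * fps_deriv \<rho>"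
    using assms by (intro dvd_mult2 fps_X_power_dvd_compose) (auto simp: reparam_def)
qed

text \<open>Invariance of \<Lambda> under the group, in the shape in which it is used: the form
  pulled back along the inverse of \<sigma> has on each branch of \<psi> the order that \<omega> has
  on that of \<phi>. With divisibility in place of orders a vanishing pullback is no special
  case.\<close>

lemma formal_equiv_transfer_form:
  assumes eq: "formal_equiv \<delta> \<phi> \<psi>" and \<omega>: "formal_form \<delta> \<omega>"
    and c: "centered (fst \<phi>)" "centered (snd \<phi>)" "centered (fst \<psi>)" "centered (snd \<psi>)"
  shows "\<exists>\<omega>'. formal_form \<delta> \<omega>' \<and>
     (\<forall>k. fps_X ^ k dvd pullback_form \<omega>' (fst \<psi>) \<longleftrightarrow> fps_X ^ k dvd pullback_form \<omega> (fst \<phi>)) \<and>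
     (\<forall>k. fps_X ^ k dvd pullback_form \<omega>' (snd \<psi>) \<longleftrightarrow> fps_X ^ k dvd pullback_form \<omega> (snd \<phi>))"
proof -
  obtain b \<sigma> \<rho>1 \<rho>2 where 1: "\<delta> = 1 \<longrightarrow> b = 0" "shear b \<sigma>" and \<rho>: "reparam \<rho>1" "reparam \<rho>2"
    and im: "germ_image \<sigma> (fst \<phi>) = germ_comp (fst \<psi>) \<rho>1" "germ_image \<sigma> (snd \<phi>) = germ_comp (snd \<psi>) \<rho>2"
    using eq unfolding formal_equiv_def by blast
  obtain \<tau> where \<tau>: "shear (- b) \<tau>" "comp2 \<tau> \<sigma> = (var_x, var_y)"
    using shear_inverse[OF 1(2)] by blast
  note nc = shear_no_const[OF 1(2)] shear_no_const[OF \<tau>(1)]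
  have iff: "fps_X ^ k dvd pullback_form (pull2 \<tau> \<omega>) \<psi>' \<longleftrightarrow> fps_X ^ k dvd pullback_form \<omega> \<phi>'"
    if "centered \<phi>'" "centered \<psi>'" "reparam \<rho>" "germ_image \<sigma> \<phi>' = germ_comp \<psi>' \<rho>" for k \<phi>' \<psi>' \<rho>
  proof -
    have "\<phi>' = germ_image \<tau> (germ_image \<sigma> \<phi>')"
      using that(1) nc by (simp only: germ_image_comp2[symmetric] \<tau>(2) germ_image_id)
    also have "\<dots> = germ_comp (germ_image \<tau> \<psi>') \<rho>"
      using that by (simp add: germ_image_germ_comp reparam_def)
    finally have "pullback_form \<omega> \<phi>' = (pullback_form (pull2 \<tau> \<omega>) \<psi>' oo \<rho>) * fps_deriv \<rho>"
      using that nc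
      by (simp add: pullback_form_germ_comp centered_germ_image reparam_def flip: pullback_form_germ_image)
    then show ?thesis
      using dvd_compose_reparam_iff[OF that(3)] by simp
  qed
  show ?thesis
    using formal_form_pull2[OF \<omega> \<tau>(1)] iff[OF c(1,3) \<rho>(1) im(1)] iff[OF c(2,4) \<rho>(2) im(2)] by blast
qed


section \<open>Elimination of a term\<close>

definition derivation :: "fps2 \<times> fps2 \<Rightarrow> fps2 \<Rightarrow> fps2" where
  "derivation \<xi> F = fst \<xi> * deriv_x F + snd \<xi> * deriv_y F"

definition flow2 :: "nat \<Rightarrow> fps2 \<times> fps2 \<Rightarrow> fps2 \<Rightarrow> fps2" where
  "flow2 L \<xi> F = (\<Sum>n\<le>L. const2 (1 / fact n) * (derivation \<xi> ^^ n) F)"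

text \<open>The fields dual to \<open>formal_form\<close>. Their linear part b y d/dx has square
  zero, so the linear part of the exponential is the shear with parameter b.\<close>

definition nilpotent_field :: "complex \<Rightarrow> fps2 \<times> fps2 \<Rightarrow> bool" where
  "nilpotent_field b \<xi> \<longleftrightarrow> order_ge 2 (fst \<xi> - const2 b * var_y) \<and> order_ge 2 (snd \<xi>)"

lemma nilpotent_field_no_const:
  assumes "nilpotent_field b \<xi>"
  shows "no_const \<xi>"
proof -
  have "order_ge 1 (fst \<xi> - const2 b * var_y + const2 b * var_y)"
    using assms unfolding nilpotent_field_def
    by (intro order_ge_add order_ge_const_mult) (auto elim: order_ge_mono)
  then show ?thesis
    using assms by (auto simp: no_const_def nilpotent_field_def elim: order_ge_mono)
qed

lemma order_ge_derivation:
  assumes "no_const \<xi>" "order_ge (Suc k) F"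
  shows "order_ge (Suc k) (derivation \<xi> F)"
  unfolding derivation_def
  using order_ge_mult[of 1 "fst \<xi>" k "deriv_x F"] order_ge_mult[of 1 "snd \<xi>" k "deriv_y F"] assms
  by (auto simp: no_const_def intro!: order_ge_add order_ge_deriv_x order_ge_deriv_y)

lemma derivation_var [simp]: "derivation \<xi> var_x = fst \<xi>" "derivation \<xi> var_y = snd \<xi>"
  by (simp_all add: derivation_def)

text \<open>D y has order 2 by assumption, D^2 x has order 2 because D(b y) = b D y, and D never
  lowers the order.\<close>

lemma order_ge_derivation_iterate:
  assumes "nilpotent_field b \<xi>"
  shows "order_ge 2 ((derivation \<xi> ^^ Suc n) var_y)" "order_ge 2 ((derivation \<xi> ^^ Suc (Suc n)) var_x)"
proof -
  note nc = nilpotent_field_no_const[OF assms]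
  have D: "order_ge 2 (derivation \<xi> F)" if "order_ge 2 F" for F
    using order_ge_derivation[OF nc, of 1 F] that by (simp add: numeral_2_eq_2)
  have \<xi>: "order_ge 2 (fst \<xi> - const2 b * var_y)" "order_ge 2 (snd \<xi>)"
    using assms by (auto simp: nilpotent_field_def)
  show "order_ge 2 ((derivation \<xi> ^^ Suc n) var_y)"
    by (induction n) (use \<xi> D in auto)
  have eq: "derivation \<xi> (fst \<xi>) = derivation \<xi> (fst \<xi> - const2 b * var_y) + const2 b * snd \<xi>"
  proof -
    have "deriv_x (const2 b * var_y) = 0" "deriv_y (const2 b * var_y) = const2 b"
      using deriv_x_monom2[of b 0 1] deriv_y_monom2[of b 0 1] by (simp_all add: monom2_def)
    moreover have "fst \<xi> = (fst \<xi> - const2 b * var_y) + const2 b * var_y"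
      by simp
    ultimately show ?thesis
      unfolding derivation_def
      by (metis (no_types, lifting) add.assoc add.right_neutral deriv_x_add deriv_y_add distrib_left mult.commute)
  qed
  show "order_ge 2 ((derivation \<xi> ^^ Suc (Suc n)) var_x)"
  proof (induction n)
    case 0
    have "order_ge 2 (derivation \<xi> (fst \<xi>))"
      unfolding eq using D[OF \<xi>(1)] \<xi>(2) by (intro order_ge_add order_ge_const_mult)
    then show ?case by simp
  qed (use D in auto)
qed

text \<open>Only the terms n = 0 and n = 1 of the exponential have a linear part.\<close>

lemma shear_flow2:
  assumes "nilpotent_field b \<xi>" "1 \<le> L"
  shows "shear b (flow2 L \<xi> var_x, flow2 L \<xi> var_y)"
proof -
  obtain l where L: "L = Suc l"
    using assms(2) by (cases L) auto
  have rest: "order_ge 2 (\<Sum>n<l. const2 (1 / fact (Suc (Suc n))) * (derivation \<xi> ^^ Suc (Suc n)) F)"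
    if "F \<in> {var_x, var_y}" for F
    using that order_ge_derivation_iterate(1)[OF assms(1), of "Suc n" for n] order_ge_derivation_iterate(2)[OF assms(1)]
    by (intro order_ge_sum order_ge_const_mult) auto
  have split: "flow2 L \<xi> F = F + derivation \<xi> F + (\<Sum>n<l. const2 (1 / fact (Suc (Suc n))) * (derivation \<xi> ^^ Suc (Suc n)) F)" for F
    unfolding flow2_def L
    by (subst sum.atMost_Suc_shift, subst lessThan_Suc_atMost[symmetric], subst sum.lessThan_Suc_shift)
       (simp add: add.assoc del: funpow.simps fact_Suc, simp)
  show ?thesis
    using assms(1) rest[of var_x] rest[of var_y] unfolding shear_def nilpotent_field_def fst_conv snd_conv split
    using order_ge_add[of 2 "fst \<xi> - const2 b * var_y" "\<Sum>n<l. const2 (1 / fact (Suc (Suc n))) * (derivation \<xi> ^^ Suc (Suc n)) var_x"]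
      order_ge_add[of 2 "snd \<xi>" "\<Sum>n<l. const2 (1 / fact (Suc (Suc n))) * (derivation \<xi> ^^ Suc (Suc n)) var_y"]
    by (auto simp: algebra_simps simp del: funpow.simps fact_Suc)
qed

lemma subst1_flow2:
  "centered \<phi> \<Longrightarrow> subst1 (flow2 L \<xi> F) \<phi> = (\<Sum>n\<le>L. fps_const (1 / fact n) * subst1 ((derivation \<xi> ^^ n) F) \<phi>)"
  by (simp add: flow2_def subst1_sum subst1_mult subst1_const2)

text \<open>If D and \<epsilon> d/dt are related along the germ up to an error (v1, v2), they are
  related on every F up to the derivative of F in the direction of that error.\<close>

lemma vector_field_chain_rule:
  assumes "centered \<phi>" "\<epsilon> * fps_deriv (fst \<phi>) = subst1 (fst \<xi>) \<phi> + v1" "\<epsilon> * fps_deriv (snd \<phi>) = subst1 (snd \<xi>) \<phi> + v2"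
  shows "\<epsilon> * fps_deriv (subst1 F \<phi>) = subst1 (derivation \<xi> F) \<phi> + (subst1 (deriv_x F) \<phi> * v1 + subst1 (deriv_y F) \<phi> * v2)"
proof -
  have "\<epsilon> * fps_deriv (subst1 F \<phi>) =
     subst1 (deriv_x F) \<phi> * (\<epsilon> * fps_deriv (fst \<phi>)) + subst1 (deriv_y F) \<phi> * (\<epsilon> * fps_deriv (snd \<phi>))"
    by (simp add: subst1_chain_rule[OF assms(1)] algebra_simps)
  then show ?thesis
    unfolding assms(2,3) by (simp add: derivation_def subst1_add subst1_mult[OF assms(1)] algebra_simps)
qed

lemma dvd_subst1_multiplicity:
  assumes "fps_X ^ m dvd fst \<phi>" "fps_X ^ m dvd snd \<phi>" "order_ge k F"
  shows "fps_X ^ (m * k) dvd subst1 F \<phi>"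
  unfolding fps_X_power_dvd_iff
proof (intro allI impI)
  fix n assume n: "n < m * k"
  have "coef2 F i j * (fst \<phi> ^ i * snd \<phi> ^ j) $ n = 0" for i j
  proof (cases "i + j < k")
    case False
    have "(fps_X ^ m) ^ i * (fps_X ^ m) ^ j dvd fst \<phi> ^ i * snd \<phi> ^ j"
      using assms by (intro mult_dvd_mono dvd_power_same)
    then have "fps_X ^ (m * (i + j)) dvd fst \<phi> ^ i * snd \<phi> ^ j"
      by (simp add: power_add power_mult distrib_left)
    moreover have "n < m * (i + j)"
      using n False mult_le_mono2[of k "i + j" m] by linarith
    ultimately show ?thesis
      by (simp add: fps_X_power_dvd_iff)
  qed (use assms(3) in \<open>simp add: order_ge_def\<close>)
  then show "subst1 F \<phi> $ n = 0"
    unfolding subst1_def fps_nth_Abs_fps by (intro sum.neutral ballI)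
qed

lemma fps_deriv_X_power:
  "0 < m \<Longrightarrow> fps_deriv (fps_X ^ m :: complex fps) = fps_const (of_nat m) * fps_X ^ (m - 1)"
  by (simp add: fps_deriv_power fps_of_nat mult.commute)

lemma dvd_fps_deriv: "fps_X ^ Suc m dvd (f :: complex fps) \<Longrightarrow> fps_X ^ m dvd fps_deriv f"
  unfolding fps_X_power_dvd_iff by simp

text \<open>Dividing a series of order m + 1 by m t^(m-1) leaves order 2, the threshold from which
  the flow raises orders.\<close>

lemma vector_field_exists:
  assumes "0 < m" "fps_X ^ Suc m dvd (f :: complex fps)"
  shows "\<exists>\<epsilon>. fps_X ^ 2 dvd \<epsilon> \<and> \<epsilon> * fps_deriv (fps_X ^ m) = f"
proof -
  obtain g where g: "f = fps_X ^ Suc m * g"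
    using assms(2) by (rule dvdE)
  have X: "fps_X ^ Suc m = fps_X ^ 2 * (fps_X ^ (m - 1) :: complex fps)"
    using assms(1) by (subst power_add[symmetric]) simp
  have "fps_const (1 / of_nat m) * fps_const (of_nat m) = (1 :: complex fps)"
    using assms(1) by simp
  then have "(fps_const (1 / of_nat m) * fps_X ^ 2 * g) * fps_deriv (fps_X ^ m) = f"
    unfolding fps_deriv_X_power[OF assms(1)] g X by (metis (no_types, lifting) mult.assoc mult.commute mult_1)
  then show ?thesis
    by (intro exI[of _ "fps_const (1 / of_nat m) * fps_X ^ 2 * g"]) (auto simp: mult.assoc)
qed

lemma fps_shift_eqI:
  assumes "0 < m" "fps_const (of_nat m) * fps_X ^ (m - 1) * v = (f :: complex fps)"
  shows "v = fps_const (1 / of_nat m) * fps_shift (m - 1) f"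
proof -
  have "fps_shift (m - 1) f = fps_const (of_nat m) * v"
    unfolding assms(2)[symmetric]
    by (metis (no_types, lifting) fps_shift_times_fps_X_power' mult.assoc mult.commute)
  then show ?thesis
    using assms(1) by (simp add: mult.assoc[symmetric])
qed

lemma dvd_fps_shift: "fps_X ^ (k + d) dvd (f :: complex fps) \<Longrightarrow> fps_X ^ k dvd fps_shift d f"
  by (simp add: fps_X_power_dvd_iff)

text \<open>The coordinate t^m determines \<epsilon>: there D and \<epsilon> d/dt are related
  exactly, and the whole defect v falls on the second coordinate. Up to sign, v is the pullback of
  the dual form divided by m t^(m-1).\<close>

lemma branch_step:
  assumes m: "0 < m" "m < j" "j \<le> L" and s: "fps_X ^ Suc m dvd s"
    and \<xi>: "nilpotent_field b \<xi>"
    and pull: "fps_X ^ (j + (m - 1)) dvd pullback_form (snd \<xi>, - fst \<xi>) (fps_X ^ m, s)"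
  shows "\<exists>\<theta> s'. reparam \<theta> \<and>
    germ_image (flow2 L \<xi> var_x, flow2 L \<xi> var_y) (fps_X ^ m, s) = germ_comp (fps_X ^ m, s') \<theta> \<and>
    fps_X ^ Suc j dvd s' - (s + fps_const (1 / of_nat m) * fps_shift (m - 1) (pullback_form (snd \<xi>, - fst \<xi>) (fps_X ^ m, s)))"
proof -
  define \<phi> :: germ where "\<phi> = (fps_X ^ m, s)"
  have \<phi>: "fst \<phi> = fps_X ^ m" "snd \<phi> = s" "centered \<phi>"
    using m s fps_X_power_dvd_iff[of "Suc m" s] by (auto simp: \<phi>_def)
  have Xm: "fps_X ^ m dvd fst \<phi>" "fps_X ^ m dvd snd \<phi>"
    using s \<phi> by (auto elim: power_le_dvd)
  define p where "p = fst \<xi> - const2 b * var_y"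
  have p: "order_ge 2 p" "fst \<xi> = p + const2 b * var_y"
    using \<xi> by (simp_all add: p_def nilpotent_field_def)
  have "fps_X ^ Suc m dvd subst1 p \<phi>"
    using dvd_subst1_multiplicity[OF Xm p(1)] by (rule power_le_dvd) (use m in simp)
  \<comment> \<open>The linear term b y of the field contributes b s, of order above m; here it
    matters that t^m is the first coordinate.\<close>
  then have "fps_X ^ Suc m dvd subst1 (fst \<xi>) \<phi>"
    unfolding p(2) subst1_add subst1_mult[OF \<phi>(3)] subst1_var[OF \<phi>(3)] \<phi>(2) using s by (intro dvd_add dvd_mult)
  then obtain \<epsilon> where \<epsilon>: "fps_X ^ 2 dvd \<epsilon>" "\<epsilon> * fps_deriv (fst \<phi>) = subst1 (fst \<xi>) \<phi> + 0"
    using vector_field_exists[OF m(1)] by (auto simp: \<phi>(1))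
  define v where "v = \<epsilon> * fps_deriv s - subst1 (snd \<xi>) \<phi>"
  have \<epsilon>v: "\<epsilon> * fps_deriv (snd \<phi>) = subst1 (snd \<xi>) \<phi> + v"
    by (simp add: v_def \<phi>)
  note chain = vector_field_chain_rule[OF \<phi>(3) \<epsilon>(2) \<epsilon>v]
  \<comment> \<open>With \<xi> = (P, Q) on the branch, \<epsilon> x' = P, so x' v = P y' - Q x',
    which is minus the pullback of Q dx - P dy.\<close>
  have "fps_const (of_nat m) * fps_X ^ (m - 1) * v = - pullback_form (snd \<xi>, - fst \<xi>) \<phi>"
  proof -
    have "fps_deriv (fst \<phi>) * v = (\<epsilon> * fps_deriv (fst \<phi>)) * fps_deriv s - fps_deriv (fst \<phi>) * subst1 (snd \<xi>) \<phi>"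
      by (simp add: v_def algebra_simps)
    also have "\<dots> = - pullback_form (snd \<xi>, - fst \<xi>) \<phi>"
      unfolding \<epsilon>(2) by (simp add: pullback_form_def subst1_uminus \<phi> algebra_simps)
    finally show ?thesis
      by (simp add: \<phi> fps_deriv_X_power[OF m(1)])
  qed
  then have v: "v = fps_const (1 / of_nat m) * fps_shift (m - 1) (- pullback_form (snd \<xi>, - fst \<xi>) \<phi>)"
    by (rule fps_shift_eqI[OF m(1)])
  have "fps_X ^ j dvd v"
    unfolding v using pull by (intro dvd_mult dvd_fps_shift) (simp add: \<phi>_def)
  then obtain \<theta> where \<theta>: "reparam \<theta>"
     "(\<Sum>n\<le>L. fps_const (1 / fact n) * subst1 ((derivation \<xi> ^^ n) var_x) \<phi>) = \<theta> ^ m"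
     "fps_X ^ Suc j dvd ((\<Sum>n\<le>L. fps_const (1 / fact n) * subst1 ((derivation \<xi> ^^ n) var_y) \<phi>) oo fps_inv \<theta>) - (s - v)"
  proof (atomize_elim, rule branch_flow[OF m s \<epsilon>(1)])
    show "subst1 ((derivation \<xi> ^^ 0) var_x) \<phi> = fps_X ^ m" "subst1 ((derivation \<xi> ^^ 0) var_y) \<phi> = s"
      by (simp_all add: subst1_var \<phi>)
    show "\<epsilon> * fps_deriv (subst1 ((derivation \<xi> ^^ n) var_x) \<phi>) =
        subst1 ((derivation \<xi> ^^ Suc n) var_x) \<phi> + subst1 (deriv_y ((derivation \<xi> ^^ n) var_x)) \<phi> * v" for n
      using chain by simp
    show "\<epsilon> * fps_deriv (subst1 ((derivation \<xi> ^^ n) var_y) \<phi>) =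
        subst1 ((derivation \<xi> ^^ Suc n) var_y) \<phi> + subst1 (deriv_y ((derivation \<xi> ^^ n) var_y)) \<phi> * v" for n
      using chain by simp
    show "subst1 (deriv_y ((derivation \<xi> ^^ 0) var_y)) \<phi> = 1"
      by (simp add: subst1_1 \<phi>)
    show "subst1 (deriv_y ((derivation \<xi> ^^ n) var_y)) \<phi> $ 0 = 0" if n: "0 < n" for n
    proof -
      have "order_ge (Suc 1) ((derivation \<xi> ^^ n) var_y)"
        using order_ge_derivation_iterate(1)[OF \<xi>, of "n - 1"] n by (simp add: numeral_2_eq_2 del: funpow.simps)
      then have "order_ge 1 (deriv_y ((derivation \<xi> ^^ n) var_y))"
        by (rule order_ge_deriv_y)
      then show ?thesis
        using fps_X_power_dvd_subst1[OF \<phi>(3), of 1] by (simp add: fps_X_dvd_iff)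
    qed
  qed
  define s' where "s' = subst1 (flow2 L \<xi> var_y) \<phi> oo fps_inv \<theta>"
  have "germ_image (flow2 L \<xi> var_x, flow2 L \<xi> var_y) \<phi> = germ_comp (fps_X ^ m, s') \<theta>"
    unfolding germ_image_def germ_comp_def fst_conv snd_conv s'_def reparam_compose_inv_cancel[OF \<theta>(1)]
    using \<theta>(1,2) by (simp add: subst1_flow2[OF \<phi>(3)] fps_X_power_compose reparam_def)
  moreover have sv: "s - v = s + fps_const (1 / of_nat m) * fps_shift (m - 1) (pullback_form (snd \<xi>, - fst \<xi>) \<phi>)"
    by (simp add: v fps_shift_uminus)
  moreover have "fps_X ^ Suc j dvd s' - (s + fps_const (1 / of_nat m) * fps_shift (m - 1) (pullback_form (snd \<xi>, - fst \<xi>) \<phi>))"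
    using \<theta>(3) unfolding sv s'_def subst1_flow2[OF \<phi>(3)] by blast
  ultimately show ?thesis
    using \<theta>(1) unfolding \<phi>_def by blast
qed

text \<open>Exchanging the coordinates reverses the sign of Q dx - P dy relative to the field (P,
  Q), hence the factor - 1 / m in place of 1 / m.\<close>

lemma branch_step_swapped:
  assumes m: "0 < m" "m < j" "j \<le> L" and s: "fps_X ^ Suc m dvd s"
    and \<xi>: "nilpotent_field 0 \<xi>"
    and pull: "fps_X ^ (j + (m - 1)) dvd pullback_form (snd \<xi>, - fst \<xi>) (s, fps_X ^ m)"
  shows "\<exists>\<theta> s'. reparam \<theta> \<and>
    germ_image (flow2 L \<xi> var_x, flow2 L \<xi> var_y) (s, fps_X ^ m) = germ_comp (s', fps_X ^ m) \<theta> \<and>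
    fps_X ^ Suc j dvd s' - (s + fps_const (- 1 / of_nat m) * fps_shift (m - 1) (pullback_form (snd \<xi>, - fst \<xi>) (s, fps_X ^ m)))"
proof -
  define \<phi> :: germ where "\<phi> = (s, fps_X ^ m)"
  have \<phi>: "fst \<phi> = s" "snd \<phi> = fps_X ^ m" "centered \<phi>"
    using m s fps_X_power_dvd_iff[of "Suc m" s] by (auto simp: \<phi>_def)
  have Xm: "fps_X ^ m dvd fst \<phi>" "fps_X ^ m dvd snd \<phi>"
    using s \<phi> by (auto elim: power_le_dvd)
  have \<xi>2: "order_ge 2 (fst \<xi>)" "order_ge 2 (snd \<xi>)"
    using \<xi> by (simp_all add: nilpotent_field_def)
  have "fps_X ^ Suc m dvd subst1 (snd \<xi>) \<phi>"
    using dvd_subst1_multiplicity[OF Xm \<xi>2(2)] by (rule power_le_dvd) (use m in simp)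
  then obtain \<epsilon> where \<epsilon>: "fps_X ^ 2 dvd \<epsilon>" "\<epsilon> * fps_deriv (snd \<phi>) = subst1 (snd \<xi>) \<phi> + 0"
    using vector_field_exists[OF m(1)] by (auto simp: \<phi>(2))
  define v where "v = \<epsilon> * fps_deriv s - subst1 (fst \<xi>) \<phi>"
  have \<epsilon>v: "\<epsilon> * fps_deriv (fst \<phi>) = subst1 (fst \<xi>) \<phi> + v"
    by (simp add: v_def \<phi>)
  note chain = vector_field_chain_rule[OF \<phi>(3) \<epsilon>v \<epsilon>(2)]
  have "fps_const (of_nat m) * fps_X ^ (m - 1) * v = pullback_form (snd \<xi>, - fst \<xi>) \<phi>"
  proof -
    have "fps_deriv (snd \<phi>) * v = (\<epsilon> * fps_deriv (snd \<phi>)) * fps_deriv s - fps_deriv (snd \<phi>) * subst1 (fst \<xi>) \<phi>"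
      by (simp add: v_def algebra_simps)
    also have "\<dots> = pullback_form (snd \<xi>, - fst \<xi>) \<phi>"
      unfolding \<epsilon>(2) by (simp add: pullback_form_def subst1_uminus \<phi> algebra_simps)
    finally show ?thesis
      by (simp add: \<phi> fps_deriv_X_power[OF m(1)])
  qed
  then have v: "v = fps_const (1 / of_nat m) * fps_shift (m - 1) (pullback_form (snd \<xi>, - fst \<xi>) \<phi>)"
    by (rule fps_shift_eqI[OF m(1)])
  have "fps_X ^ j dvd v"
    unfolding v using pull by (intro dvd_mult dvd_fps_shift) (simp add: \<phi>_def)
  then obtain \<theta> where \<theta>: "reparam \<theta>"
     "(\<Sum>n\<le>L. fps_const (1 / fact n) * subst1 ((derivation \<xi> ^^ n) var_y) \<phi>) = \<theta> ^ m"
     "fps_X ^ Suc j dvd ((\<Sum>n\<le>L. fps_const (1 / fact n) * subst1 ((derivation \<xi> ^^ n) var_x) \<phi>) oo fps_inv \<theta>) - (s - v)"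
  proof (atomize_elim, rule branch_flow[OF m s \<epsilon>(1)])
    show "subst1 ((derivation \<xi> ^^ 0) var_y) \<phi> = fps_X ^ m" "subst1 ((derivation \<xi> ^^ 0) var_x) \<phi> = s"
      by (simp_all add: subst1_var \<phi>)
    show "\<epsilon> * fps_deriv (subst1 ((derivation \<xi> ^^ n) var_x) \<phi>) =
        subst1 ((derivation \<xi> ^^ Suc n) var_x) \<phi> + subst1 (deriv_x ((derivation \<xi> ^^ n) var_x)) \<phi> * v" for n
      using chain by simp
    show "\<epsilon> * fps_deriv (subst1 ((derivation \<xi> ^^ n) var_y) \<phi>) =
        subst1 ((derivation \<xi> ^^ Suc n) var_y) \<phi> + subst1 (deriv_x ((derivation \<xi> ^^ n) var_y)) \<phi> * v" for n
      using chain by simp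
    show "subst1 (deriv_x ((derivation \<xi> ^^ 0) var_x)) \<phi> = 1"
      by (simp add: subst1_1 \<phi>)
    show "subst1 (deriv_x ((derivation \<xi> ^^ n) var_x)) \<phi> $ 0 = 0" if n: "0 < n" for n
    proof -
      have "order_ge (Suc 1) ((derivation \<xi> ^^ n) var_x)"
      proof (cases "n = 1")
        case False
        then obtain k where "n = Suc (Suc k)"
          using n by (metis One_nat_def Suc_pred not_gr0)
        then show ?thesis
          using order_ge_derivation_iterate(2)[OF \<xi>, of k] by (simp add: numeral_2_eq_2 del: funpow.simps)
      qed (use \<xi>2 in \<open>simp add: numeral_2_eq_2\<close>)
      then have "order_ge 1 (deriv_x ((derivation \<xi> ^^ n) var_x))"
        by (rule order_ge_deriv_x)
      then show ?thesis
        using fps_X_power_dvd_subst1[OF \<phi>(3), of 1] by (simp add: fps_X_dvd_iff)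
    qed
  qed
  define s' where "s' = subst1 (flow2 L \<xi> var_x) \<phi> oo fps_inv \<theta>"
  have "germ_image (flow2 L \<xi> var_x, flow2 L \<xi> var_y) \<phi> = germ_comp (s', fps_X ^ m) \<theta>"
    unfolding germ_image_def germ_comp_def fst_conv snd_conv s'_def reparam_compose_inv_cancel[OF \<theta>(1)]
    using \<theta>(1,2) by (simp add: subst1_flow2[OF \<phi>(3)] fps_X_power_compose reparam_def)
  moreover have sv: "s - v = s + fps_const (- 1 / of_nat m) * fps_shift (m - 1) (pullback_form (snd \<xi>, - fst \<xi>) \<phi>)"
    unfolding v by (simp flip: fps_const_neg)
  moreover have "fps_X ^ Suc j dvd s' - (s + fps_const (- 1 / of_nat m) * fps_shift (m - 1) (pullback_form (snd \<xi>, - fst \<xi>) \<phi>))"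
    using \<theta>(3) unfolding sv s'_def subst1_flow2[OF \<phi>(3)] by blast
  ultimately show ?thesis
    using \<theta>(1) unfolding \<phi>_def by blast
qed


section \<open>Both branches at once, and induction on the degree\<close>

definition puiseux_pair :: "nat \<Rightarrow> nat \<Rightarrow> nat \<Rightarrow> complex fps \<Rightarrow> complex fps \<Rightarrow> bigerm" where
  "puiseux_pair \<delta> m1 m2 s1 s2 = ((fps_X ^ m1, s1), if \<delta> = 1 then (s2, fps_X ^ m2) else (fps_X ^ m2, s2))"

lemma centered_puiseux_pair:
  assumes "0 < m1" "0 < m2" "fps_X ^ Suc m1 dvd s1" "fps_X ^ Suc m2 dvd s2"
  shows "centered (fst (puiseux_pair \<delta> m1 m2 s1 s2))" "centered (snd (puiseux_pair \<delta> m1 m2 s1 s2))"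
  using assms by (auto simp: puiseux_pair_def fps_X_power_dvd_iff simp del: power_Suc)

lemma formal_form_field:
  assumes "formal_form \<delta> \<omega>"
  shows "\<exists>b. (\<delta> = 1 \<longrightarrow> b = 0) \<and> nilpotent_field b (- snd \<omega>, fst \<omega>)"
proof -
  obtain \<beta> where \<beta>: "\<delta> = 1 \<longrightarrow> \<beta> = 0" "order_ge 2 (fst \<omega>)" "order_ge 2 (snd \<omega> - const2 \<beta> * var_y)"
    using assms by (auto simp: formal_form_def)
  have "order_ge 2 (- (snd \<omega> - const2 \<beta> * var_y))"
    using \<beta>(3) by (rule order_ge_uminus)
  then show ?thesis
    using \<beta>(1,2) by (intro exI[of _ "- \<beta>"]) (simp add: nilpotent_field_def const2_minus)
qed

text \<open>Coefficients of order 2 have order at least 2 m on a branch of multiplicity m, and on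
  (t^m, s) the term y dy becomes s s' of even higher order. On (s, t^m) that term would have order 2
  m - 1 only, which is where \<beta> = 0 enters.\<close>

lemma dvd_pullback_form:
  assumes m: "0 < m" and s: "fps_X ^ Suc m dvd s" and \<omega>: "formal_form \<delta> \<omega>"
  shows "fps_X ^ (2 * m) dvd pullback_form \<omega> (fps_X ^ m, s)"
    and "\<delta> = 1 \<Longrightarrow> fps_X ^ (2 * m) dvd pullback_form \<omega> (s, fps_X ^ m)"
proof -
  obtain \<beta> where \<beta>: "\<delta> = 1 \<longrightarrow> \<beta> = 0" and \<omega>1: "order_ge 2 (fst \<omega>)"
    and \<omega>2: "order_ge 2 (snd \<omega> - const2 \<beta> * var_y)"
    using \<omega> by (auto simp: formal_form_def)
  have sm: "fps_X ^ m dvd s"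
    using s by (rule power_le_dvd) simp
  have c: "centered (fps_X ^ m, s)"
    using m s fps_X_power_dvd_iff[of "Suc m" s] by auto
  have 1: "fps_X ^ (2 * m) dvd subst1 F (fps_X ^ m, s)" "fps_X ^ (2 * m) dvd subst1 F (s, fps_X ^ m)" if "order_ge 2 F" for F
    using dvd_subst1_multiplicity[OF _ _ that, of m "(fps_X ^ m, s)"]
      dvd_subst1_multiplicity[OF _ _ that, of m "(s, fps_X ^ m)"] sm by (simp_all add: mult.commute)
  have "fps_X ^ m * fps_X ^ m dvd subst1 (const2 \<beta> * var_y) (fps_X ^ m, s) * fps_deriv s"
    using sm s by (intro mult_dvd_mono dvd_fps_deriv) (simp_all add: subst1_mult[OF c] subst1_var[OF c])
  then have 2: "fps_X ^ (2 * m) dvd subst1 (const2 \<beta> * var_y) (fps_X ^ m, s) * fps_deriv s"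
    by (simp only: mult_2 power_add)
  have 3: "subst1 (snd \<omega>) (fps_X ^ m, s) = subst1 (snd \<omega> - const2 \<beta> * var_y) (fps_X ^ m, s) + subst1 (const2 \<beta> * var_y) (fps_X ^ m, s)"
    by (simp add: subst1_diff)
  show "fps_X ^ (2 * m) dvd pullback_form \<omega> (fps_X ^ m, s)"
    unfolding pullback_form_def fst_conv snd_conv 3 distrib_right
    by (rule dvd_add[OF dvd_mult2[OF 1(1)[OF \<omega>1]] dvd_add[OF dvd_mult2[OF 1(1)[OF \<omega>2]] 2]])
  show "fps_X ^ (2 * m) dvd pullback_form \<omega> (s, fps_X ^ m)" if "\<delta> = 1"
    unfolding pullback_form_def fst_conv snd_conv
    using 1(2)[OF \<omega>1] 1(2)[OF \<omega>2] that \<beta> by (intro dvd_add dvd_mult2) simp_all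
qed

definition second_sign :: "nat \<Rightarrow> nat \<Rightarrow> complex" where
  "second_sign \<delta> m = (if \<delta> = 1 then - 1 / of_nat m else 1 / of_nat m)"

lemma elimination_step:
  assumes m: "0 < m1" "0 < m2" and s: "fps_X ^ Suc m1 dvd s1" "fps_X ^ Suc m2 dvd s2"
    and \<omega>: "formal_form \<delta> \<omega>"
  defines "\<phi> \<equiv> puiseux_pair \<delta> m1 m2 s1 s2"
  defines "p1 \<equiv> pullback_form \<omega> (fst \<phi>)" and "p2 \<equiv> pullback_form \<omega> (snd \<phi>)"
  assumes p: "fps_X ^ (j + (m1 - 1)) dvd p1" "fps_X ^ (j + (m2 - 1)) dvd p2"
  shows "\<exists>s1' s2'. formal_equiv \<delta> \<phi> (puiseux_pair \<delta> m1 m2 s1' s2') \<and>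
    fps_X ^ Suc m1 dvd s1' \<and> fps_X ^ Suc m2 dvd s2' \<and>
    fps_X ^ Suc j dvd s1' - (s1 + fps_const (1 / of_nat m1) * fps_shift (m1 - 1) p1) \<and>
    fps_X ^ Suc j dvd s2' - (s2 + fps_const (second_sign \<delta> m2) * fps_shift (m2 - 1) p2)"
proof -
  define \<xi> where "\<xi> = (- snd \<omega>, fst \<omega>)"
  have \<omega>_eq: "(snd \<xi>, - fst \<xi>) = \<omega>"
    by (simp add: \<xi>_def)
  obtain b where b: "\<delta> = 1 \<longrightarrow> b = 0" "nilpotent_field b \<xi>"
    using formal_form_field[OF \<omega>] by (auto simp: \<xi>_def)
  \<comment> \<open>The degree j need not exceed m1 and m2, as \<open>branch_step\<close> wants.
    Since every pullback has order at least 2 m = (m + 1) + (m - 1), the degree may be raised to m +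
    1 on the branch in question.\<close>
  define j1 j2 where "j1 = max j (Suc m1)" and "j2 = max j (Suc m2)"
  \<comment> \<open>The same map has to act on both branches, so the exponential is cut at a common
    place.\<close>
  define L where "L = max j1 j2"
  have L: "m1 < j1" "m2 < j2" "j1 \<le> L" "j2 \<le> L" "1 \<le> L" "j \<le> j1" "j \<le> j2" "Suc m1 \<le> j1" "Suc m2 \<le> j2"
    using m by (auto simp: j1_def j2_def L_def)
  have dp1: "fps_X ^ (2 * m1) dvd p1"
    using dvd_pullback_form(1)[OF m(1) s(1) \<omega>] by (simp add: p1_def \<phi>_def puiseux_pair_def)
  have dp2: "fps_X ^ (2 * m2) dvd p2"
    using dvd_pullback_form[OF m(2) s(2) \<omega>] by (simp add: p2_def \<phi>_def puiseux_pair_def)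
  have q1: "fps_X ^ (j1 + (m1 - 1)) dvd p1"
    using dp1 p(1) m by (cases "j \<le> Suc m1") (simp_all add: j1_def max_def mult_2)
  have q2: "fps_X ^ (j2 + (m2 - 1)) dvd p2"
    using dp2 p(2) m by (cases "j \<le> Suc m2") (simp_all add: j2_def max_def mult_2)
  define \<sigma> where "\<sigma> = (flow2 L \<xi> var_x, flow2 L \<xi> var_y)"
  obtain \<theta>1 s1' where 1: "reparam \<theta>1" "germ_image \<sigma> (fst \<phi>) = germ_comp (fps_X ^ m1, s1') \<theta>1"
     "fps_X ^ Suc j1 dvd s1' - (s1 + fps_const (1 / of_nat m1) * fps_shift (m1 - 1) p1)"
    using branch_step[OF m(1) L(1,3) s(1) b(2)] q1
    unfolding \<omega>_eq \<sigma>_def \<phi>_def puiseux_pair_def p1_def fst_conv by blast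
  obtain \<theta>2 s2' where 2: "reparam \<theta>2"
     "germ_image \<sigma> (snd \<phi>) = germ_comp (snd (puiseux_pair \<delta> m1 m2 s1' s2')) \<theta>2"
     "fps_X ^ Suc j2 dvd s2' - (s2 + fps_const (second_sign \<delta> m2) * fps_shift (m2 - 1) p2)"
  proof (cases "\<delta> = 1")
    case True
    then show ?thesis
      using branch_step_swapped[OF m(2) L(2,4) s(2), of \<xi>] q2 b that
      unfolding \<omega>_eq \<sigma>_def \<phi>_def puiseux_pair_def p2_def second_sign_def by auto
  next
    case False
    then show ?thesis
      using branch_step[OF m(2) L(2,4) s(2) b(2)] q2 that
      unfolding \<omega>_eq \<sigma>_def \<phi>_def puiseux_pair_def p2_def second_sign_def by auto
  qed
  have new: "fps_X ^ Suc m dvd s' \<and> fps_X ^ Suc j dvd s' - (s + fps_const \<kappa> * fps_shift (m - 1) p)"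
    if "fps_X ^ Suc i dvd s' - (s + fps_const \<kappa> * fps_shift (m - 1) p)" "fps_X ^ Suc m dvd s" "fps_X ^ (2 * m) dvd p"
      "0 < m" "j \<le> i" "Suc m \<le> i" for i m :: nat and s s' p :: "complex fps" and \<kappa>
  proof -
    have "fps_X ^ Suc m dvd fps_shift (m - 1) p"
      by (rule dvd_fps_shift) (use that in \<open>simp add: mult_2\<close>)
    then have "fps_X ^ Suc m dvd s + fps_const \<kappa> * fps_shift (m - 1) p"
      using that(2) by (intro dvd_add dvd_mult)
    moreover have "fps_X ^ Suc m dvd s' - (s + fps_const \<kappa> * fps_shift (m - 1) p)"
      using that(1) by (rule power_le_dvd) (use that in simp)
    ultimately have "fps_X ^ Suc m dvd s'"
      using dvd_add[of "fps_X ^ Suc m" "s' - (s + fps_const \<kappa> * fps_shift (m - 1) p)"] by fastforce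
    moreover have "fps_X ^ Suc j dvd s' - (s + fps_const \<kappa> * fps_shift (m - 1) p)"
      using that(1) by (rule power_le_dvd) (use that in simp)
    ultimately show ?thesis ..
  qed
  have "shear b \<sigma>"
    unfolding \<sigma>_def using b(2) L(5) by (rule shear_flow2)
  then have "formal_equiv \<delta> \<phi> (puiseux_pair \<delta> m1 m2 s1' s2')"
    using b(1) 1(1,2) 2(1,2) by (intro formal_equivI[of \<delta> b \<sigma> \<theta>1 \<theta>2]) (simp_all add: puiseux_pair_def)
  then show ?thesis
    using new[OF 1(3) s(1) dp1 m(1) L(6,8)] new[OF 2(3) s(2) dp2 m(2) L(7,9)] by blast
qed

text \<open>Multiples of one form move the two coefficients of degree j along the line spanned by
  (p1, p2) and fix all lower ones. The form is given on the original bigerm and transported to the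
  current one; p1 or p2 vanishes exactly when the value on that branch exceeds j.\<close>

lemma elimination_family:
  assumes eq: "formal_equiv \<delta> \<phi> (puiseux_pair \<delta> m1 m2 s1 s2)"
    and c: "centered (fst \<phi>)" "centered (snd \<phi>)"
    and m: "0 < m1" "0 < m2" and s: "fps_X ^ Suc m1 dvd s1" "fps_X ^ Suc m2 dvd s2"
    and \<omega>: "formal_form \<delta> \<omega>"
    and p: "fps_X ^ (j + (m1 - 1)) dvd pullback_form \<omega> (fst \<phi>)" "fps_X ^ (j + (m2 - 1)) dvd pullback_form \<omega> (snd \<phi>)"
  obtains p1 p2 :: complex
  where "p1 = 0 \<longleftrightarrow> fps_X ^ (Suc j + (m1 - 1)) dvd pullback_form \<omega> (fst \<phi>)"
    and "p2 = 0 \<longleftrightarrow> fps_X ^ (Suc j + (m2 - 1)) dvd pullback_form \<omega> (snd \<phi>)"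
    and "\<And>a. \<exists>s1' s2'. formal_equiv \<delta> \<phi> (puiseux_pair \<delta> m1 m2 s1' s2') \<and>
      fps_X ^ Suc m1 dvd s1' \<and> fps_X ^ Suc m2 dvd s2' \<and> (\<forall>k<j. s1' $ k = s1 $ k \<and> s2' $ k = s2 $ k) \<and>
      s1' $ j = s1 $ j + a * p1 \<and> s2' $ j = s2 $ j + a * p2"
proof -
  define \<psi> where "\<psi> = puiseux_pair \<delta> m1 m2 s1 s2"
  note c\<psi> = centered_puiseux_pair[OF m s, of \<delta>, folded \<psi>_def]
  obtain \<omega>' where \<omega>': "formal_form \<delta> \<omega>'"
    "\<And>k. fps_X ^ k dvd pullback_form \<omega>' (fst \<psi>) \<longleftrightarrow> fps_X ^ k dvd pullback_form \<omega> (fst \<phi>)"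
    "\<And>k. fps_X ^ k dvd pullback_form \<omega>' (snd \<psi>) \<longleftrightarrow> fps_X ^ k dvd pullback_form \<omega> (snd \<phi>)"
    using formal_equiv_transfer_form[OF eq[folded \<psi>_def] \<omega> c c\<psi>] by blast
  define f1 f2 where "f1 = pullback_form \<omega>' (fst \<psi>)" and "f2 = pullback_form \<omega>' (snd \<psi>)"
  have f: "fps_X ^ (j + (m1 - 1)) dvd f1" "fps_X ^ (j + (m2 - 1)) dvd f2"
    using p \<omega>' by (simp_all add: f1_def f2_def)
  have zero: "f $ k = 0 \<longleftrightarrow> fps_X ^ Suc k dvd f" if "fps_X ^ k dvd f" for f :: "complex fps" and k
    using that unfolding fps_X_power_dvd_iff by (auto simp: less_Suc_eq)
  define p1 p2 where "p1 = f1 $ (j + (m1 - 1)) / of_nat m1" and "p2 = second_sign \<delta> m2 * f2 $ (j + (m2 - 1))"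
  show ?thesis
  proof (rule that)
    show "p1 = 0 \<longleftrightarrow> fps_X ^ (Suc j + (m1 - 1)) dvd pullback_form \<omega> (fst \<phi>)"
      using zero[OF f(1)] m \<omega>'(2)[of "Suc j + (m1 - 1)"] by (simp add: p1_def f1_def)
    have "second_sign \<delta> m2 \<noteq> 0"
      using m by (simp add: second_sign_def)
    then show "p2 = 0 \<longleftrightarrow> fps_X ^ (Suc j + (m2 - 1)) dvd pullback_form \<omega> (snd \<phi>)"
      using zero[OF f(2)] \<omega>'(3)[of "Suc j + (m2 - 1)"] by (simp add: p2_def f2_def)
    fix a
    define \<omega>a where "\<omega>a = (const2 a * fst \<omega>', const2 a * snd \<omega>')"
    have pa: "pullback_form \<omega>a (fst \<psi>) = fps_const a * f1" "pullback_form \<omega>a (snd \<psi>) = fps_const a * f2"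
      using c\<psi> by (simp_all add: \<omega>a_def pullback_form_scale f1_def f2_def)
    have "formal_form \<delta> \<omega>a"
      unfolding \<omega>a_def using \<omega>'(1) by (rule formal_form_scale)
    then obtain s1' s2' where s': "formal_equiv \<delta> \<psi> (puiseux_pair \<delta> m1 m2 s1' s2')"
        "fps_X ^ Suc m1 dvd s1'" "fps_X ^ Suc m2 dvd s2'"
        "fps_X ^ Suc j dvd s1' - (s1 + fps_const (1 / of_nat m1) * fps_shift (m1 - 1) (fps_const a * f1))"
        "fps_X ^ Suc j dvd s2' - (s2 + fps_const (second_sign \<delta> m2) * fps_shift (m2 - 1) (fps_const a * f2))"
      using elimination_step[OF m s, of \<delta> \<omega>a j] f unfolding \<psi>_def[symmetric] pa
      by (metis (no_types, lifting) dvd_mult)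
    have coef: "s1' $ k = s1 $ k + 1 / of_nat m1 * (a * f1 $ (k + (m1 - 1)))"
         "s2' $ k = s2 $ k + second_sign \<delta> m2 * (a * f2 $ (k + (m2 - 1)))" if "k < Suc j" for k
      using s'(4,5) that unfolding fps_X_power_dvd_iff by auto
    have "s1' $ k = s1 $ k \<and> s2' $ k = s2 $ k" if "k < j" for k
      using coef[of k] that f unfolding fps_X_power_dvd_iff by simp
    moreover have "s1' $ j = s1 $ j + a * p1" "s2' $ j = s2 $ j + a * p2"
      using coef[of j] by (simp_all add: p1_def p2_def)
    moreover have "formal_equiv \<delta> \<phi> (puiseux_pair \<delta> m1 m2 s1' s2')"
      using formal_equiv_trans[OF eq[folded \<psi>_def] s'(1) c c\<psi>] .
    ultimately show "\<exists>s1' s2'. formal_equiv \<delta> \<phi> (puiseux_pair \<delta> m1 m2 s1' s2') \<and>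
      fps_X ^ Suc m1 dvd s1' \<and> fps_X ^ Suc m2 dvd s2' \<and> (\<forall>k<j. s1' $ k = s1 $ k \<and> s2' $ k = s2 $ k) \<and>
      s1' $ j = s1 $ j + a * p1 \<and> s2' $ j = s2 $ j + a * p2"
      using s'(2,3) by blast
  qed
qed

text \<open>E1 and E2 are the degrees to be cleared on the two branches. All forms are given for the
  initial \<phi>, and no step disturbs degrees already treated, which makes the induction on the
  degree work.\<close>

lemma formal_normal_form:
  assumes \<phi>: "\<phi> = puiseux_pair \<delta> m1 m2 s1 s2"
    and m: "0 < m1" "0 < m2" and s: "fps_X ^ Suc m1 dvd s1" "fps_X ^ Suc m2 dvd s2"
    and E1: "\<And>j. j \<in> E1 \<Longrightarrow> \<exists>\<omega>. formal_form \<delta> \<omega> \<and>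
      fps_X ^ (j + (m1 - 1)) dvd pullback_form \<omega> (fst \<phi>) \<and> \<not> fps_X ^ (Suc j + (m1 - 1)) dvd pullback_form \<omega> (fst \<phi>) \<and>
      fps_X ^ (j + (m2 - 1)) dvd pullback_form \<omega> (snd \<phi>) \<and>
      (j \<in> E2 \<longrightarrow> fps_X ^ (Suc j + (m2 - 1)) dvd pullback_form \<omega> (snd \<phi>))"
    and E2: "\<And>j. j \<in> E2 \<Longrightarrow> \<exists>\<omega>. formal_form \<delta> \<omega> \<and>
      fps_X ^ (Suc j + (m1 - 1)) dvd pullback_form \<omega> (fst \<phi>) \<and>
      fps_X ^ (j + (m2 - 1)) dvd pullback_form \<omega> (snd \<phi>) \<and> \<not> fps_X ^ (Suc j + (m2 - 1)) dvd pullback_form \<omega> (snd \<phi>)"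
  shows "\<exists>s1' s2'. formal_equiv \<delta> \<phi> (puiseux_pair \<delta> m1 m2 s1' s2') \<and> fps_X ^ Suc m1 dvd s1' \<and> fps_X ^ Suc m2 dvd s2' \<and>
    (\<forall>k<N. (k \<in> E1 \<longrightarrow> s1' $ k = 0) \<and> (k \<in> E2 \<longrightarrow> s2' $ k = 0))"
proof (induction N)
  case 0
  have "formal_equiv \<delta> \<phi> \<phi>"
    using centered_puiseux_pair[OF m s] unfolding \<phi> by (intro formal_equiv_refl)
  then show ?case
    using s \<phi> by auto
next
  case (Suc N)
  note c = centered_puiseux_pair[OF m s, of \<delta>, folded \<phi>]
  obtain s1' s2' where s': "formal_equiv \<delta> \<phi> (puiseux_pair \<delta> m1 m2 s1' s2')"
      "fps_X ^ Suc m1 dvd s1'" "fps_X ^ Suc m2 dvd s2'"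
      "\<forall>k<N. (k \<in> E1 \<longrightarrow> s1' $ k = 0) \<and> (k \<in> E2 \<longrightarrow> s2' $ k = 0)"
    using Suc by blast
  \<comment> \<open>The second branch is treated first: the form that clears degree N on the first
    one then leaves the second coefficient alone whenever N belongs to E2.\<close>
  obtain t1 t2 where t: "formal_equiv \<delta> \<phi> (puiseux_pair \<delta> m1 m2 t1 t2)"
      "fps_X ^ Suc m1 dvd t1" "fps_X ^ Suc m2 dvd t2"
      "\<forall>k<N. (k \<in> E1 \<longrightarrow> t1 $ k = 0) \<and> (k \<in> E2 \<longrightarrow> t2 $ k = 0)" "N \<in> E2 \<longrightarrow> t2 $ N = 0"
  proof (cases "N \<in> E2")
    case True
    then obtain \<omega> where \<omega>: "formal_form \<delta> \<omega>" "fps_X ^ (Suc N + (m1 - 1)) dvd pullback_form \<omega> (fst \<phi>)"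
        "fps_X ^ (N + (m2 - 1)) dvd pullback_form \<omega> (snd \<phi>)" "\<not> fps_X ^ (Suc N + (m2 - 1)) dvd pullback_form \<omega> (snd \<phi>)"
      using E2 by blast
    have "fps_X ^ (N + (m1 - 1)) dvd pullback_form \<omega> (fst \<phi>)"
      using \<omega>(2) by (rule power_le_dvd) simp
    obtain p1 p2 where
      "p1 = 0 \<longleftrightarrow> fps_X ^ (Suc N + (m1 - 1)) dvd pullback_form \<omega> (fst \<phi>)"
      "p2 = 0 \<longleftrightarrow> fps_X ^ (Suc N + (m2 - 1)) dvd pullback_form \<omega> (snd \<phi>)" and fam: "\<And>a. \<exists>u1 u2. formal_equiv \<delta> \<phi> (puiseux_pair \<delta> m1 m2 u1 u2) \<and>
        fps_X ^ Suc m1 dvd u1 \<and> fps_X ^ Suc m2 dvd u2 \<and> (\<forall>k<N. u1 $ k = s1' $ k \<and> u2 $ k = s2' $ k) \<and>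
        u1 $ N = s1' $ N + a * p1 \<and> u2 $ N = s2' $ N + a * p2"
      by (rule elimination_family[OF s'(1) c m s'(2,3) \<omega>(1) \<open>fps_X ^ (N + (m1 - 1)) dvd _\<close> \<omega>(3)]) (rule that)
    then have p: "p2 \<noteq> 0"
      using \<omega>(4) by blast
    show ?thesis
      using fam[of "- s2' $ N / p2"] p s'(4) by (auto intro: that simp del: power_Suc)
  qed (use s' that in blast)
  show ?case
  proof (cases "N \<in> E1")
    case True
    then obtain \<omega> where \<omega>: "formal_form \<delta> \<omega>" "fps_X ^ (N + (m1 - 1)) dvd pullback_form \<omega> (fst \<phi>)"
        "\<not> fps_X ^ (Suc N + (m1 - 1)) dvd pullback_form \<omega> (fst \<phi>)"
        "fps_X ^ (N + (m2 - 1)) dvd pullback_form \<omega> (snd \<phi>)"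
        "N \<in> E2 \<longrightarrow> fps_X ^ (Suc N + (m2 - 1)) dvd pullback_form \<omega> (snd \<phi>)"
      using E1 by blast
    obtain p1 p2 where
      "p1 = 0 \<longleftrightarrow> fps_X ^ (Suc N + (m1 - 1)) dvd pullback_form \<omega> (fst \<phi>)"
      "p2 = 0 \<longleftrightarrow> fps_X ^ (Suc N + (m2 - 1)) dvd pullback_form \<omega> (snd \<phi>)" and fam: "\<And>a. \<exists>u1 u2. formal_equiv \<delta> \<phi> (puiseux_pair \<delta> m1 m2 u1 u2) \<and>
        fps_X ^ Suc m1 dvd u1 \<and> fps_X ^ Suc m2 dvd u2 \<and> (\<forall>k<N. u1 $ k = t1 $ k \<and> u2 $ k = t2 $ k) \<and>
        u1 $ N = t1 $ N + a * p1 \<and> u2 $ N = t2 $ N + a * p2"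
      by (rule elimination_family[OF t(1) c m t(2,3) \<omega>(1,2,4)]) (rule that)
    then have p: "p1 \<noteq> 0" "N \<in> E2 \<longrightarrow> p2 = 0"
      using \<omega>(3,5) by blast+
    obtain u1 u2 where u: "formal_equiv \<delta> \<phi> (puiseux_pair \<delta> m1 m2 u1 u2)"
        "fps_X ^ Suc m1 dvd u1" "fps_X ^ Suc m2 dvd u2" "\<forall>k<N. u1 $ k = t1 $ k \<and> u2 $ k = t2 $ k"
        "u1 $ N = t1 $ N + (- t1 $ N / p1) * p1" "u2 $ N = t2 $ N + (- t1 $ N / p1) * p2"
      using fam[of "- t1 $ N / p1"] by blast
    have "(k \<in> E1 \<longrightarrow> u1 $ k = 0) \<and> (k \<in> E2 \<longrightarrow> u2 $ k = 0)" if "k < Suc N" for k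
      using that u(4,5,6) t(4,5) p by (cases "k = N") auto
    then show ?thesis
      using u(1,2,3) by blast
  next
    case False
    then have "(k \<in> E1 \<longrightarrow> t1 $ k = 0) \<and> (k \<in> E2 \<longrightarrow> t2 $ k = 0)" if "k < Suc N" for k
      using that t(4,5) by (cases "k = N") auto
    then show ?thesis
      using t(1,2,3) by blast
  qed
qed


section \<open>Values of differential forms\<close>

text \<open>Since \<open>nu_form\<close> is the order plus one, a value above j means order at least
  j + m. It is written \<open>Suc j + (m - 1)\<close> to match the shift by m - 1 in the
  elimination.\<close>

lemma nu_form_gt_iff:
  assumes "0 < m"
  shows "enat j < nu_form \<phi> \<omega> - enat m \<longleftrightarrow> fps_X ^ (Suc j + (m - 1)) dvd pullback_form \<omega> \<phi>"
proof (cases "pullback_form \<omega> \<phi> = 0")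
  case True
  then show ?thesis
    by (simp add: nu_form_def ord_t_def plus_1_eSuc)
next
  case False
  then have "nu_form \<phi> \<omega> - enat m = enat (Suc (subdegree (pullback_form \<omega> \<phi>)) - m)"
    by (simp add: nu_form_def ord_t_def plus_1_eSuc eSuc_enat)
  moreover have "fps_X ^ (Suc j + (m - 1)) dvd pullback_form \<omega> \<phi> \<longleftrightarrow> Suc j + (m - 1) \<le> subdegree (pullback_form \<omega> \<phi>)"
    using False by (subst fps_dvd_iff) (auto simp: fps_X_power_subdegree simp del: power_Suc)
  ultimately show ?thesis
    using assms by auto
qed

text \<open>Truncated subtraction sends every order below m to 0, so the value determines the order
  only when it is positive.\<close>

lemma nu_form_eq_iff:
  assumes "0 < m" "0 < j"
  shows "nu_form \<phi> \<omega> - enat m = enat j \<longleftrightarrow>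
    fps_X ^ (j + (m - 1)) dvd pullback_form \<omega> \<phi> \<and> \<not> fps_X ^ (Suc j + (m - 1)) dvd pullback_form \<omega> \<phi>"
proof -
  obtain i where i: "j = Suc i"
    using assms(2) by (cases j) auto
  have "n = enat j \<longleftrightarrow> enat i < n \<and> \<not> enat j < n" for n
    unfolding i by (cases n) auto
  then show ?thesis
    using nu_form_gt_iff[OF assms(1), of i] nu_form_gt_iff[OF assms(1), of j] by (simp add: i)
qed


section \<open>Finite determinacy\<close>

lemma no_const_stretch: "0 < k \<Longrightarrow> no_const (monom2 c k 0, var_y)"
  by simp (simp add: order_ge_def coef2_monom2)

text \<open>Covers two substitutions at once: x to x^m, which turns fractional exponents into
  integral ones, and, for k = 1, the rotation x to c x.\<close>

lemma coef2_subst2_stretch: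
  assumes "0 < k"
  shows "coef2 (subst2 F (monom2 c k 0, var_y)) a b = (if k dvd a then c ^ (a div k) * coef2 F (a div k) b else 0)"
proof -
  note nc = no_const_stretch[OF assms]
  have mon: "coef2 (monom2 c k 0 ^ i * var_y ^ j) a b = (if a = k * i \<and> b = j then c ^ i else 0)" for i j
  proof -
    have "monom2 c k 0 ^ i * var_y ^ j = monom2 (c ^ i) (k * i) j"
      by (simp add: monom2_def const2_def fps_const_power power_mult_distrib power_mult)
    then show ?thesis
      by (simp add: coef2_monom2)
  qed
  have "coef2 (subst2 F (monom2 c k 0, var_y)) a b =
      (\<Sum>i\<le>a + b. \<Sum>j\<le>a + b. if j = b then (if a = k * i then c ^ i * coef2 F i b else 0) else 0)"
    unfolding coef2_subst2[OF nc order.refl] fst_conv snd_conv mon by (intro sum.cong refl) auto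
  also have "\<dots> = (\<Sum>i\<le>a + b. if a = k * i then c ^ i * coef2 F i b else 0)"
    by (simp add: sum.delta)
  also have "\<dots> = (if k dvd a then c ^ (a div k) * coef2 F (a div k) b else 0)"
  proof (cases "k dvd a")
    case True
    then have "(\<Sum>i\<le>a + b. if a = k * i then c ^ i * coef2 F i b else 0) =
        (\<Sum>i\<le>a + b. if i = a div k then c ^ i * coef2 F i b else 0)"
      using assms by (intro sum.cong refl) auto
    also have "\<dots> = c ^ (a div k) * coef2 F (a div k) b"
      by (simp add: sum.delta div_le_dividend le_trans[OF div_le_dividend])
    finally show ?thesis
      using True by simp
  qed (auto intro!: sum.neutral)
  finally show ?thesis .
qed

text \<open>Inverse of the substitution x to x^m on the series in which every exponent of x is a
  multiple of m.\<close>

definition contract :: "nat \<Rightarrow> fps2 \<Rightarrow> fps2" where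
  "contract m F = series2 (\<lambda>i j. coef2 F (m * i) j)"

lemma subst2_contract:
  assumes "0 < m" "\<And>i j. \<not> m dvd i \<Longrightarrow> coef2 F i j = 0"
  shows "subst2 (contract m F) (monom2 1 m 0, var_y) = F"
  by (rule fps2_eqI) (use assms in \<open>auto simp: coef2_subst2_stretch contract_def\<close>)

lemma conv2_contract:
  assumes "0 < m" "F \<in> conv2"
  shows "contract m F \<in> conv2"
proof -
  obtain r C where r: "0 < r" "r \<le> 1" "majorized r C F"
    using conv2_common_majorant[of "{F}"] assms by auto
  \<comment> \<open>The exponent m i of x becomes i, so the radius for x becomes r^m. The same
    radius is used for y, where it is at most r because r is at most 1.\<close>
  have "majorized (r ^ m) C (contract m F)"
    unfolding majorized_def
  proof
    fix K
    have rm: "r ^ m \<le> r"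
      using power_decreasing[of 1 m r] assms r by simp
    define g where "g i = (\<Sum>j\<le>m * K. norm (coef2 F i j) * r ^ i * r ^ j)" for i
    have g0: "0 \<le> g i" for i
      using r by (auto simp: g_def intro!: sum_nonneg)
    have "(\<Sum>i\<le>K. \<Sum>j\<le>K. norm (coef2 (contract m F) i j) * (r ^ m) ^ i * (r ^ m) ^ j) \<le> (\<Sum>i\<le>K. g (m * i))"
    proof (rule sum_mono)
      fix i
      have "(\<Sum>j\<le>K. norm (coef2 (contract m F) i j) * (r ^ m) ^ i * (r ^ m) ^ j) \<le>
          (\<Sum>j\<le>K. norm (coef2 F (m * i) j) * r ^ (m * i) * r ^ j)"
        using rm r by (intro sum_mono) (simp add: contract_def power_mult mult_left_mono power_mono)
      also have "\<dots> \<le> g (m * i)"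
        unfolding g_def using r assms by (intro sum_mono2) auto
      finally show "(\<Sum>j\<le>K. norm (coef2 (contract m F) i j) * (r ^ m) ^ i * (r ^ m) ^ j) \<le> g (m * i)" .
    qed
    also have "(\<Sum>i\<le>K. g (m * i)) = sum g ((*) m ` {..K})"
      using assms by (subst sum.reindex) (auto simp: inj_on_def)
    also have "\<dots> \<le> (\<Sum>i\<le>m * K. g i)"
      using g0 by (intro sum_mono2) auto
    also have "\<dots> \<le> C"
      unfolding g_def using r(3) by (rule majorizedD)
    finally show "(\<Sum>i\<le>K. \<Sum>j\<le>K. norm (coef2 (contract m F) i j) * (r ^ m) ^ i * (r ^ m) ^ j) \<le> C" .
  qed
  then show ?thesis
    unfolding conv2_iff_majorized using r by (intro exI[of _ "r ^ m"] conjI exI[of _ C]) auto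
qed

text \<open>A series that descends from the cover can be evaluated upstairs as soon as an m-th root
  g of the first coordinate is chosen.\<close>

lemma subst1_contract:
  assumes "0 < m" "\<And>i j. \<not> m dvd i \<Longrightarrow> coef2 F i j = 0" "g $ 0 = 0" "b $ 0 = 0"
  shows "subst1 (contract m F) (g ^ m, b) = subst1 F (g, b)"
proof -
  note nc = no_const_stretch[OF assms(1)]
  have c: "centered (g, b)"
    using assms by simp
  have "subst1 F (g, b) = subst1 (subst2 (contract m F) (monom2 1 m 0, var_y)) (g, b)"
    by (simp add: subst2_contract[OF assms(1,2)])
  also have "\<dots> = subst1 (contract m F) (germ_image (monom2 1 m 0, var_y) (g, b))"
    using nc c by (rule subst1_subst2)
  also have "germ_image (monom2 1 m 0, var_y) (g, b) = (g ^ m, b)"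
    by (simp add: germ_image_def subst1_monom2[OF c] subst1_var[OF c])
  finally show ?thesis ..
qed

lemma primitive_root_of_unity:
  assumes "0 < m"
  shows "\<exists>\<zeta>::complex. \<zeta> ^ m = 1 \<and> (\<forall>i. \<zeta> ^ i = 1 \<longrightarrow> m dvd i)"
proof -
  define \<zeta> where "\<zeta> = exp (2 * of_real pi * \<i> * of_nat 1 / of_nat m)"
  have pow: "\<zeta> ^ i = exp (2 * of_real pi * \<i> * of_nat i / of_nat m)" for i
    unfolding \<zeta>_def exp_of_nat_mult[symmetric] by (rule arg_cong[where f = exp]) simp
  have "\<zeta> ^ i = 1 \<longleftrightarrow> m dvd i" for i
    unfolding pow using assms by (intro complex_root_unity_eq_1) simp
  then show ?thesis
    by (intro exI[of _ \<zeta>]) simp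
qed

abbreviation twist :: "complex \<Rightarrow> complex fps \<Rightarrow> complex fps" where
  "twist \<zeta> f \<equiv> f oo (fps_const \<zeta> * fps_X)"

lemma twist_1 [simp]: "twist 1 f = f"
  by simp

lemma twist_twist: "twist \<zeta> (twist \<xi> f) = twist (\<zeta> * \<xi>) f"
  by (rule fps_ext) (simp add: power_mult_distrib)

text \<open>For a root of unity \<zeta> this is the Galois action on fractional power series, the
  first variable playing the part of x^(1/m).\<close>

definition rotate :: "complex \<Rightarrow> fps2 \<Rightarrow> fps2" where
  "rotate \<zeta> F = subst2 F (monom2 \<zeta> 1 0, var_y)"

lemma no_const_rotate: "no_const (monom2 \<zeta> 1 0, var_y)"
  by (rule no_const_stretch) simp

lemma coef2_rotate: "coef2 (rotate \<zeta> F) i j = \<zeta> ^ i * coef2 F i j"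
  by (simp add: rotate_def coef2_subst2_stretch)

lemma rotate_fps_const: "rotate \<zeta> (fps_const f) = fps_const (twist \<zeta> f)"
  by (rule fps2_eqI) (simp add: coef2_rotate coef2_fps_const)

lemma rotate_var_y: "rotate \<zeta> var_y = var_y"
  unfolding rotate_def subst2_var[OF no_const_rotate] by simp

text \<open>The factors \<open>y - s(\<zeta>t)\<close> of the minimal polynomial of the branch over \<open>\<complex>{x}\<close>, where \<open>x = t\<^sup>m\<close>.\<close>

definition conj_factor :: "complex fps \<Rightarrow> complex \<Rightarrow> fps2" where
  "conj_factor s \<zeta> = var_y - fps_const (twist \<zeta> s)"

lemma rotate_conj_factor: "rotate \<zeta> (conj_factor s \<xi>) = conj_factor s (\<zeta> * \<xi>)"
proof -
  have "rotate \<zeta> (conj_factor s \<xi>) = rotate \<zeta> var_y - rotate \<zeta> (fps_const (twist \<xi> s))"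
    by (simp add: conj_factor_def rotate_def subst2_diff)
  then show ?thesis
    by (simp add: rotate_var_y rotate_fps_const twist_twist conj_factor_def)
qed

lemma conv1_mult: "f \<in> conv1 \<Longrightarrow> g \<in> conv1 \<Longrightarrow> f * g \<in> conv1"
  using fps_conv_radius_mult[of f g] by (auto simp: conv1_def min_def split: if_splits intro: less_le_trans)

lemma conv1_X_power: "fps_X ^ n \<in> conv1"
  by (simp add: conv1_def)

lemma conv1_twist: "f \<in> conv1 \<Longrightarrow> twist \<zeta> f \<in> conv1"
proof (rule conv1_compose)
  have "fps_const \<zeta> \<in> conv1" "fps_X \<in> conv1"
    by (simp_all add: conv1_def)
  then show "fps_const \<zeta> * fps_X \<in> conv1"
    by (rule conv1_mult)
qed simp_all

lemma conv2_conj_factor: "s \<in> conv1 \<Longrightarrow> conj_factor s \<zeta> \<in> conv2"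
  unfolding conj_factor_def by (intro conv2_diff) (auto simp: conv2_fps_const_iff conv1_twist)

lemma subst1_conj_factor:
  assumes "g $ 0 = 0" "b $ 0 = 0"
  shows "subst1 (conj_factor s \<zeta>) (g, b) = b - (twist \<zeta> s oo g)"
proof -
  have "centered (g, b)"
    using assms by simp
  then show ?thesis
    by (simp add: conj_factor_def subst1_diff subst1_var subst1_fps_const)
qed

text \<open>A rotation multiplies the coefficient of x^i by \<zeta>^i; for primitive \<zeta> an
  invariant coefficient vanishes unless m divides i.\<close>

lemma rotation_invariant_coef2:
  assumes "0 < m" "\<And>\<zeta>. \<zeta> ^ m = 1 \<Longrightarrow> rotate \<zeta> F = F" "\<not> m dvd i"
  shows "coef2 F i j = 0"
proof -
  obtain \<zeta> :: complex where \<zeta>: "\<zeta> ^ m = 1" "\<zeta> ^ i \<noteq> 1"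
    using primitive_root_of_unity[OF assms(1)] assms(3) by blast
  then show ?thesis
    using coef2_rotate[of \<zeta> F i j] assms(2) by simp
qed

lemma bij_betw_roots_mult:
  assumes "0 < m" "\<zeta> ^ m = (1::complex)"
  shows "bij_betw (\<lambda>\<xi>. \<zeta> * \<xi>) {\<xi>. \<xi> ^ m = 1} {\<xi>. \<xi> ^ m = 1}"
proof (rule bij_betwI[where g = "\<lambda>\<xi>. inverse \<zeta> * \<xi>"])
  have "\<zeta> \<noteq> 0"
    using assms by (auto simp: power_0_left)
  then show "inverse \<zeta> * (\<zeta> * x) = x" "\<zeta> * (inverse \<zeta> * x) = x" for x
    by simp_all
qed (use assms in \<open>auto simp: power_mult_distrib power_inverse\<close>)

text \<open>Up to a convergent unit g is t^d, so division by g costs d orders and preserves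
  convergence.\<close>

lemma fps_divide_conv1:
  assumes "g \<in> conv1" "g \<noteq> 0"
  shows "\<exists>d. \<forall>r\<in>conv1. \<forall>n. fps_X ^ (n + d) dvd r \<longrightarrow> (\<exists>q\<in>conv1. fps_X ^ n dvd q \<and> r = q * g)"
proof -
  define d where "d = subdegree g"
  define u where "u = fps_shift d g"
  have u: "g = fps_X ^ d * u" "u $ 0 \<noteq> 0" "u \<in> conv1"
    using assms by (simp_all add: u_def d_def conv1_def subdegree_decompose' mult.commute)
  have iu: "inverse u \<in> conv1"
    using u by (simp add: conv1_def fps_conv_radius_inverse_pos)
  show ?thesis
  proof (intro exI[of _ d] ballI allI impI)
    fix r n assume r: "r \<in> conv1" "fps_X ^ (n + d) dvd r"
    define q where "q = fps_shift d r * inverse u"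
    have "fps_X ^ d dvd r"
      using r(2) by (rule power_le_dvd) simp
    then obtain r' where r': "r = fps_X ^ d * r'"
      by (rule dvdE)
    have "fps_shift d r = r'"
      unfolding r' by (simp add: mult.commute)
    then have "q * g = r' * fps_X ^ d * (inverse u * u)"
      by (simp add: q_def u(1) mult_ac)
    then have "q * g = r' * fps_X ^ d"
      by (simp only: inverse_mult_eq_1[OF u(2)] mult_1_right)
    then have "q * g = r"
      by (simp add: r' mult.commute)
    moreover have "fps_X ^ n dvd q"
      unfolding q_def using r(2) by (intro dvd_mult2 dvd_fps_shift)
    moreover have "q \<in> conv1"
      unfolding q_def using iu r(1) by (intro conv1_mult) (simp_all add: conv1_def)
    ultimately show "\<exists>q\<in>conv1. fps_X ^ n dvd q \<and> r = q * g"
      by auto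
  qed
qed

text \<open>The local ring of the branch has a conductor: inside the convergent series in t it
  contains everything of sufficiently high order.\<close>

definition determined_branch :: "germ \<Rightarrow> bool" where
  "determined_branch \<phi> \<longleftrightarrow> (\<exists>d. \<forall>r\<in>conv1. fps_X ^ d dvd r \<longrightarrow> (\<exists>\<eta>\<in>conv2. subst1 \<eta> \<phi> = r))"

text \<open>Lagrange interpolation over the conjugates \<open>s(\<zeta>t)\<close> of \<open>s\<close>.\<close>

lemma determined_branch_puiseux:
  assumes m: "0 < m" and s: "s \<in> conv1" "s $ 0 = 0"
    and prim: "\<And>\<zeta>. \<zeta> ^ m = 1 \<Longrightarrow> \<zeta> \<noteq> 1 \<Longrightarrow> twist \<zeta> s \<noteq> s"
  shows "determined_branch (fps_X ^ m, s)"
proof -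
  define Z where "Z = {\<zeta> :: complex. \<zeta> ^ m = 1}"
  have fin: "finite Z"
    unfolding Z_def using m by (rule finite_nth_roots)
  have Z1: "1 \<in> Z"
    by (simp add: Z_def)
  \<comment> \<open>The y-derivative at y = s of the polynomial with roots s(\<xi> t). Primitivity
    of the branch makes it nonzero.\<close>
  define G where "G = (\<Prod>\<xi>\<in>Z - {1}. s - twist \<xi> s)"
  have G0: "G \<noteq> 0"
    unfolding G_def using fin prim[symmetric] by (subst prod_zero_iff) (auto simp: Z_def)
  have G: "G \<in> conv1"
  proof -
    have "(\<Prod>\<xi>\<in>Z - {1}. fps_const (s - twist \<xi> s)) \<in> conv2"
    proof (rule conv2_prod)
      fix \<xi>
      have "fps_const s - fps_const (twist \<xi> s) \<in> conv2"
        using s by (intro conv2_diff) (simp_all add: conv2_fps_const_iff conv1_twist)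
      then show "fps_const (s - twist \<xi> s) \<in> conv2"
        by simp
    qed
    moreover have "(\<Prod>\<xi>\<in>A. fps_const (s - twist \<xi> s)) = fps_const (\<Prod>\<xi>\<in>A. s - twist \<xi> s)" for A
      by (induction A rule: infinite_finite_induct) simp_all
    ultimately show ?thesis
      by (simp add: G_def conv2_fps_const_iff)
  qed
  from fps_divide_conv1[OF G G0] obtain d where
    d: "\<forall>r\<in>conv1. \<forall>n. fps_X ^ (n + d) dvd r \<longrightarrow> (\<exists>q\<in>conv1. fps_X ^ n dvd q \<and> r = q * G)" ..
  have "\<exists>\<eta>\<in>conv2. subst1 \<eta> (fps_X ^ m, s) = r" if r: "r \<in> conv1" "fps_X ^ d dvd r" for r
  proof -
    obtain h where h: "h \<in> conv1" "r = h * G"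
      using d[rule_format, of r 0] r by auto
    \<comment> \<open>The interpolation polynomial with value h(\<zeta> t) G(\<zeta> t) = r(\<zeta>
      t) at y = s(\<zeta> t). A rotation by a root of unity permutes its summands, so it descends to
      a series in t^m.\<close>
    define \<eta> where "\<eta> = (\<Sum>\<zeta>\<in>Z. fps_const (twist \<zeta> h) * (\<Prod>\<xi>\<in>Z - {\<zeta>}. conj_factor s \<xi>))"
    have "rotate \<kappa> \<eta> = \<eta>" if \<kappa>: "\<kappa> ^ m = 1" for \<kappa>
    proof -
      have bij: "bij_betw (\<lambda>\<xi>. \<kappa> * \<xi>) Z Z"
        unfolding Z_def using m \<kappa> by (rule bij_betw_roots_mult)
      have "rotate \<kappa> \<eta> = (\<Sum>\<zeta>\<in>Z. fps_const (twist (\<kappa> * \<zeta>) h) * (\<Prod>\<xi>\<in>Z - {\<zeta>}. conj_factor s (\<kappa> * \<xi>)))"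
        unfolding \<eta>_def rotate_def subst2_sum subst2_mult[OF no_const_rotate] subst2_prod[OF no_const_rotate]
        by (simp only: rotate_fps_const[unfolded rotate_def] rotate_conj_factor[unfolded rotate_def] twist_twist)
      also have "\<dots> = (\<Sum>\<zeta>\<in>Z. fps_const (twist (\<kappa> * \<zeta>) h) * (\<Prod>\<xi>\<in>Z - {\<kappa> * \<zeta>}. conj_factor s \<xi>))"
      proof (intro sum.cong refl arg_cong2[where f = "(*)"])
        fix \<zeta> assume "\<zeta> \<in> Z"
        then have "bij_betw (\<lambda>\<xi>. \<kappa> * \<xi>) (Z - {\<zeta>}) (Z - {\<kappa> * \<zeta>})"
          using bij_betw_subset[OF bij, of "Z - {\<zeta>}" "Z - {\<kappa> * \<zeta>}"] bij
          by (auto simp: bij_betw_def inj_on_image_set_diff[of _ Z])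
        then show "(\<Prod>\<xi>\<in>Z - {\<zeta>}. conj_factor s (\<kappa> * \<xi>)) = (\<Prod>\<xi>\<in>Z - {\<kappa> * \<zeta>}. conj_factor s \<xi>)"
          by (rule prod.reindex_bij_betw)
      qed
      also have "\<dots> = \<eta>"
        unfolding \<eta>_def using bij by (rule sum.reindex_bij_betw)
      finally show ?thesis .
    qed
    then have inv: "coef2 \<eta> i j = 0" if "\<not> m dvd i" for i j
      using rotation_invariant_coef2[OF m] that by blast
    have "\<eta> \<in> conv2"
      unfolding \<eta>_def using h(1) s(1)
      by (intro conv2_sum conv2_mult conv2_prod conv2_conj_factor) (simp_all add: conv2_fps_const_iff conv1_twist)
    then have "contract m \<eta> \<in> conv2"
      using m by (intro conv2_contract)
    moreover have "subst1 (contract m \<eta>) (fps_X ^ m, s) = r"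
    proof -
      have c: "centered (fps_X, s)"
        using s by simp
      have "subst1 (contract m \<eta>) (fps_X ^ m, s) = subst1 \<eta> (fps_X, s)"
        using m inv s by (intro subst1_contract) auto
      also have "\<dots> = (\<Sum>\<zeta>\<in>Z. twist \<zeta> h * (\<Prod>\<xi>\<in>Z - {\<zeta>}. s - twist \<xi> s))"
        unfolding \<eta>_def subst1_sum subst1_mult[OF c] subst1_prod[OF c] subst1_fps_const[OF c]
        using s by (simp add: subst1_conj_factor)
      \<comment> \<open>At y = s every summand with \<zeta> different from 1 contains the factor s -
        s.\<close>
      also have "\<dots> = (\<Sum>\<zeta>\<in>Z. if \<zeta> = 1 then h * G else 0)"
      proof (intro sum.cong refl)
        fix \<zeta> assume "\<zeta> \<in> Z"
        show "twist \<zeta> h * (\<Prod>\<xi>\<in>Z - {\<zeta>}. s - twist \<xi> s) = (if \<zeta> = 1 then h * G else 0)"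
        proof (cases "\<zeta> = 1")
          case False
          then have "(\<Prod>\<xi>\<in>Z - {\<zeta>}. s - twist \<xi> s) = 0"
            using fin Z1 by (intro prod_zero) (auto intro!: bexI[of _ 1])
          then show ?thesis
            using False by simp
        qed (simp add: G_def)
      qed
      also have "\<dots> = r"
        using fin Z1 h by (simp add: sum.delta)
      finally show ?thesis .
    qed
    ultimately show ?thesis
      by blast
  qed
  then show ?thesis
    unfolding determined_branch_def by blast
qed

text \<open>Here f is the product of y - s(\<zeta> x^(1/m)) over the m-th roots of unity, the
  equation of the branch. Along a germ (a, b) the root of a need not be a power series in t, so
  nonvanishing is tested after replacing t by t^k, where a root g is supplied.\<close>

lemma branch_equation:
  assumes m: "0 < m" and s: "s \<in> conv1" "s $ 0 = 0"
  shows "\<exists>f\<in>conv2. subst1 f (fps_X ^ m, s) = 0 \<and>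
    (\<forall>a b k g. a $ 0 = 0 \<longrightarrow> b $ 0 = 0 \<longrightarrow> 0 < k \<longrightarrow> g $ 0 = 0 \<longrightarrow> g ^ m = a oo fps_X ^ k \<longrightarrow>
      (\<forall>\<zeta>. \<zeta> ^ m = 1 \<longrightarrow> b oo fps_X ^ k \<noteq> twist \<zeta> s oo g) \<longrightarrow> subst1 f (a, b) \<noteq> 0)"
proof -
  define Z where "Z = {\<zeta> :: complex. \<zeta> ^ m = 1}"
  have fin: "finite Z"
    unfolding Z_def using m by (rule finite_nth_roots)
  define F where "F = (\<Prod>\<xi>\<in>Z. conj_factor s \<xi>)"
  have "rotate \<kappa> F = F" if \<kappa>: "\<kappa> ^ m = 1" for \<kappa>
  proof -
    have "rotate \<kappa> F = (\<Prod>\<xi>\<in>Z. conj_factor s (\<kappa> * \<xi>))"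
      unfolding F_def rotate_def subst2_prod[OF no_const_rotate]
      by (simp only: rotate_conj_factor[unfolded rotate_def])
    also have "\<dots> = F"
      unfolding F_def Z_def using bij_betw_roots_mult[OF m \<kappa>] by (rule prod.reindex_bij_betw)
    finally show ?thesis .
  qed
  then have inv: "coef2 F i j = 0" if "\<not> m dvd i" for i j
    using rotation_invariant_coef2[OF m] that by blast
  have eval: "subst1 (contract m F) (g ^ m, b) = (\<Prod>\<xi>\<in>Z. b - (twist \<xi> s oo g))" if "g $ 0 = 0" "b $ 0 = 0" for g b
  proof -
    have c: "centered (g, b)"
      using that by simp
    have "subst1 (contract m F) (g ^ m, b) = subst1 F (g, b)"
      using m inv that by (intro subst1_contract) auto
    then show ?thesis
      using that by (simp add: F_def subst1_prod[OF c] subst1_conj_factor)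
  qed
  show ?thesis
  proof (intro bexI[of _ "contract m F"] conjI allI impI)
    show "contract m F \<in> conv2"
      unfolding F_def using m s by (intro conv2_contract conv2_prod conv2_conj_factor)
    show "subst1 (contract m F) (fps_X ^ m, s) = 0"
    proof -
      have "(\<Prod>\<xi>\<in>Z. s - twist \<xi> s) = 0"
        using fin by (rule prod_zero) (rule bexI[of _ 1], simp_all add: Z_def)
      then show ?thesis
        using eval[of fps_X s] s by simp
    qed
    fix a b g :: "complex fps" and k
    assume a: "a $ 0 = 0" "b $ 0 = 0" "0 < k" and g: "g $ 0 = 0" "g ^ m = a oo fps_X ^ k"
      and neq: "\<forall>\<zeta>. \<zeta> ^ m = 1 \<longrightarrow> b oo fps_X ^ k \<noteq> twist \<zeta> s oo g"
    have "subst1 (contract m F) (a, b) oo fps_X ^ k = subst1 (contract m F) (germ_comp (a, b) (fps_X ^ k))"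
      using a by (simp add: subst1_germ_comp)
    also have "germ_comp (a, b) (fps_X ^ k) = (g ^ m, b oo fps_X ^ k)"
      by (simp add: germ_comp_def g)
    also have "subst1 (contract m F) \<dots> = (\<Prod>\<xi>\<in>Z. (b oo fps_X ^ k) - (twist \<xi> s oo g))"
      using g a by (intro eval) simp_all
    also have "\<dots> \<noteq> 0"
      using fin neq by (subst prod_zero_iff) (auto simp: Z_def)
    finally show "subst1 (contract m F) (a, b) \<noteq> 0"
      by auto
  qed
qed

definition swap_vars :: "fps2 \<Rightarrow> fps2" where
  "swap_vars F = subst2 F (var_y, var_x)"

lemma subst1_swap_vars:
  assumes "centered (a, b)"
  shows "subst1 (swap_vars F) (a, b) = subst1 F (b, a)"
  using assms by (simp add: swap_vars_def subst1_subst2 germ_image_def subst1_var)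

lemma conv2_swap_vars: "F \<in> conv2 \<Longrightarrow> swap_vars F \<in> conv2"
  unfolding swap_vars_def by (rule conv2_subst2) simp_all

lemma determined_branch_swap:
  assumes "determined_branch (a, b)" "centered (a, b)"
  shows "determined_branch (b, a)"
proof -
  obtain d where d: "\<And>r. r \<in> conv1 \<Longrightarrow> fps_X ^ d dvd r \<Longrightarrow> \<exists>\<eta>\<in>conv2. subst1 \<eta> (a, b) = r"
    using assms(1) unfolding determined_branch_def by blast
  have "\<exists>\<eta>\<in>conv2. subst1 \<eta> (b, a) = r" if r: "r \<in> conv1" "fps_X ^ d dvd r" for r
  proof -
    obtain \<eta> where \<eta>: "\<eta> \<in> conv2" "subst1 \<eta> (a, b) = r"
      using d[OF r] by blast
    show ?thesis
      using \<eta> assms(2) by (intro bexI[of _ "swap_vars \<eta>"]) (simp_all add: subst1_swap_vars conv2_swap_vars)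
  qed
  then show ?thesis
    unfolding determined_branch_def by blast
qed

lemma max_ideal_pow_mult:
  "F \<in> max_ideal_pow k \<Longrightarrow> G \<in> conv2 \<Longrightarrow> F * G \<in> max_ideal_pow k"
  by (simp add: max_ideal_pow_iff conv2_mult order_ge_mult1)

text \<open>Multiplication by the equation of the other branch separates the two branches.\<close>

lemma finite_determinacy:
  assumes \<phi>: "centered (fst \<phi>)" "centered (snd \<phi>)" and conv: "fst (fst \<phi>) \<in> conv1" "snd (fst \<phi>) \<in> conv1"
      "fst (snd \<phi>) \<in> conv1" "snd (snd \<phi>) \<in> conv1"
    and nz: "fst (fst \<phi>) \<noteq> 0 \<or> snd (fst \<phi>) \<noteq> 0" "fst (snd \<phi>) \<noteq> 0 \<or> snd (snd \<phi>) \<noteq> 0"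
    and det: "determined_branch (fst \<phi>)" "determined_branch (snd \<phi>)"
    and f1: "f1 \<in> conv2" "subst1 f1 (fst \<phi>) = 0" "subst1 f1 (snd \<phi>) \<noteq> 0"
    and f2: "f2 \<in> conv2" "subst1 f2 (snd \<phi>) = 0" "subst1 f2 (fst \<phi>) \<noteq> 0"
  shows "\<exists>N. \<forall>r1\<in>conv1. \<forall>r2\<in>conv1. fps_X ^ N dvd r1 \<longrightarrow> fps_X ^ N dvd r2 \<longrightarrow>
    (\<exists>\<eta>\<in>max_ideal_pow 2. subst1 \<eta> (fst \<phi>) = r1 \<and> subst1 \<eta> (snd \<phi>) = r2)"
proof -
  have branch: "\<exists>N. \<forall>r\<in>conv1. fps_X ^ N dvd r \<longrightarrow> (\<exists>\<eta>\<in>max_ideal_pow 2. subst1 \<eta> \<chi> = r \<and> subst1 \<eta> \<chi>' = 0)"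
    if c: "centered \<chi>" "centered \<chi>'" and cv: "fst \<chi> \<in> conv1" "snd \<chi> \<in> conv1" and nz: "fst \<chi> \<noteq> 0 \<or> snd \<chi> \<noteq> 0"
      and det: "determined_branch \<chi>" and f: "f \<in> conv2" "subst1 f \<chi>' = 0" "subst1 f \<chi> \<noteq> 0" for \<chi> \<chi>' f
  proof -
    obtain d where d: "\<And>r. r \<in> conv1 \<Longrightarrow> fps_X ^ d dvd r \<Longrightarrow> \<exists>\<eta>\<in>conv2. subst1 \<eta> \<chi> = r"
      using det unfolding determined_branch_def by blast
    obtain u where u: "u \<in> conv2" "order_ge 1 u" "subst1 u \<chi> \<noteq> 0"
      using nz subst1_var[OF c(1)] by (metis conv2_simps(3,4) One_nat_def order_ge_var)
    \<comment> \<open>The factor f kills the other branch; the square of a coordinate u that does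
      not vanish on this branch puts the product into the square of the maximal ideal.\<close>
    define \<mu> where "\<mu> = u ^ 2 * f"
    have "u ^ 2 \<in> max_ideal_pow 2"
      using u order_ge_power[of u 2] by (simp add: max_ideal_pow_iff power2_eq_square conv2_mult)
    then have \<mu>: "\<mu> \<in> max_ideal_pow 2"
      unfolding \<mu>_def using f(1) by (rule max_ideal_pow_mult)
    have \<mu>0: "subst1 \<mu> \<chi> \<noteq> 0" "subst1 \<mu> \<chi>' = 0"
      using u f by (simp_all add: \<mu>_def subst1_mult subst1_power c)
    have \<mu>1: "subst1 \<mu> \<chi> \<in> conv1"
      using \<mu> cv c(1) by (intro conv1_subst1) (simp_all add: max_ideal_pow_iff)
    from fps_divide_conv1[OF \<mu>1 \<mu>0(1)] obtain e where
      e: "\<forall>r\<in>conv1. \<forall>n. fps_X ^ (n + e) dvd r \<longrightarrow> (\<exists>q\<in>conv1. fps_X ^ n dvd q \<and> r = q * subst1 \<mu> \<chi>)" ..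
    have "\<exists>\<eta>\<in>max_ideal_pow 2. subst1 \<eta> \<chi> = r \<and> subst1 \<eta> \<chi>' = 0" if r: "r \<in> conv1" "fps_X ^ (d + e) dvd r" for r
    proof -
      obtain q where q: "q \<in> conv1" "fps_X ^ d dvd q" "r = q * subst1 \<mu> \<chi>"
        using e[rule_format, OF r] by blast
      obtain \<eta> where \<eta>: "\<eta> \<in> conv2" "subst1 \<eta> \<chi> = q"
        using d[OF q(1,2)] by blast
      show ?thesis
        using \<eta> q(3) \<open>subst1 \<mu> \<chi>' = 0\<close> max_ideal_pow_mult[OF \<mu> \<eta>(1)]
        by (intro bexI[of _ "\<mu> * \<eta>"]) (simp_all add: subst1_mult c mult.commute)
    qed
    then show ?thesis
      by blast
  qed
  obtain N1 where N1: "\<And>r. r \<in> conv1 \<Longrightarrow> fps_X ^ N1 dvd r \<Longrightarrow>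
      \<exists>\<eta>\<in>max_ideal_pow 2. subst1 \<eta> (fst \<phi>) = r \<and> subst1 \<eta> (snd \<phi>) = 0"
    using branch[OF \<phi> conv(1,2) nz(1) det(1) f2] by blast
  obtain N2 where N2: "\<And>r. r \<in> conv1 \<Longrightarrow> fps_X ^ N2 dvd r \<Longrightarrow>
      \<exists>\<eta>\<in>max_ideal_pow 2. subst1 \<eta> (snd \<phi>) = r \<and> subst1 \<eta> (fst \<phi>) = 0"
    using branch[OF \<phi>(2,1) conv(3,4) nz(2) det(2) f1] by blast
  show ?thesis
  proof (intro exI[of _ "max N1 N2"] ballI impI)
    fix r1 r2 assume r: "r1 \<in> conv1" "r2 \<in> conv1" "fps_X ^ max N1 N2 dvd r1" "fps_X ^ max N1 N2 dvd r2"
    obtain \<eta>1 where \<eta>1: "\<eta>1 \<in> max_ideal_pow 2" "subst1 \<eta>1 (fst \<phi>) = r1" "subst1 \<eta>1 (snd \<phi>) = 0"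
      using N1[OF r(1) power_le_dvd[OF r(3)]] by auto
    obtain \<eta>2 where \<eta>2: "\<eta>2 \<in> max_ideal_pow 2" "subst1 \<eta>2 (snd \<phi>) = r2" "subst1 \<eta>2 (fst \<phi>) = 0"
      using N2[OF r(2) power_le_dvd[OF r(4)]] by auto
    show "\<exists>\<eta>\<in>max_ideal_pow 2. subst1 \<eta> (fst \<phi>) = r1 \<and> subst1 \<eta> (snd \<phi>) = r2"
      using \<eta>1 \<eta>2
      by (intro bexI[of _ "\<eta>1 + \<eta>2"]) (simp_all add: subst1_add max_ideal_pow_iff conv2_add order_ge_add)
  qed
qed

section \<open>The equation of one branch does not vanish on the other\<close>

lemma complex_root_exists:
  assumes "0 < n"
  shows "\<exists>u::complex. u ^ n = c"
proof (cases "c = 0")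
  case False
  then have "card {z. z ^ n = c} \<noteq> 0"
    using assms by (subst card_nth_roots) auto
  then show ?thesis
    by (metis (mono_tags, lifting) card.empty empty_Collect_eq)
qed (use assms in \<open>auto intro!: exI[of _ 0]\<close>)

text \<open>Replacing t by t^m makes the order of a divisible by m, and the remaining unit has an
  m-th root.\<close>

lemma root_of_stretched:
  assumes "0 < m" "fps_X ^ n dvd a"
  shows "\<exists>g :: complex fps. g ^ m = a oo fps_X ^ m \<and> fps_X ^ n dvd g"
proof (cases "a = 0")
  case True
  then show ?thesis
    using assms by (intro exI[of _ 0]) (simp add: power_0_left)
next
  case False
  define d where "d = subdegree a"
  define u where "u = fps_shift d a"
  have u: "a = fps_X ^ d * u" "u $ 0 \<noteq> 0"
    using False by (simp_all add: u_def d_def subdegree_decompose' mult.commute)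
  have "n \<le> d"
    using assms(2) False fps_dvd_iff[of "fps_X ^ n" a] by (simp add: d_def fps_X_power_subdegree)
  obtain c where c: "c ^ m = u $ 0"
    using complex_root_exists[OF assms(1)] by blast
  then have "c \<noteq> 0"
    using assms(1) u(2) by (auto simp: power_0_left)
  then obtain w where w: "w ^ m = u oo fps_X ^ m"
    using fps_root_exists[of "u oo fps_X ^ m" c m] c assms(1) by auto
  have Xm0: "(fps_X ^ m :: complex fps) $ 0 = 0"
    using assms(1) by simp
  have "(fps_X ^ d * w) ^ m = a oo fps_X ^ m"
    by (simp add: u(1) power_mult_distrib w fps_compose_mult_distrib[OF Xm0] fps_X_power_compose[OF Xm0]
        power_mult[symmetric] mult.commute)
  moreover have "fps_X ^ n dvd fps_X ^ d * w"
    using le_imp_power_dvd[OF \<open>n \<le> d\<close>] by (rule dvd_mult2)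
  ultimately show ?thesis
    by blast
qed

text \<open>Separates transversal branches by orders alone: n m on the left, at least (n + 1) (m +
  1) on the right.\<close>

lemma compose_neq_of_orders:
  assumes "0 < m" "fps_X ^ Suc m dvd s" "fps_X ^ Suc n dvd (g :: complex fps)"
  shows "fps_X ^ n oo fps_X ^ m \<noteq> s oo g"
proof
  assume eq: "fps_X ^ n oo fps_X ^ m = s oo g"
  obtain t where t: "s = fps_X ^ Suc m * t"
    using assms(2) by (rule dvdE)
  have g0: "g $ 0 = 0"
    using assms(3) unfolding fps_X_power_dvd_iff by blast
  have "(fps_X ^ Suc n) ^ Suc m dvd g ^ Suc m"
    using assms(3) by (rule dvd_power_same)
  then have "(fps_X ^ Suc n) ^ Suc m dvd s oo g"
    unfolding t by (simp only: fps_compose_mult_distrib[OF g0] fps_X_power_compose[OF g0] dvd_mult2)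
  then have dvd: "fps_X ^ (Suc n * Suc m) dvd s oo g"
    by (simp only: power_mult)
  have "(fps_X ^ m :: complex fps) $ 0 = 0"
    using assms(1) by simp
  then have "fps_X ^ n oo fps_X ^ m = (fps_X ^ (n * m) :: complex fps)"
    by (simp only: fps_X_power_compose power_mult[symmetric] mult.commute[of m n])
  then have "fps_X ^ (Suc n * Suc m) dvd (fps_X ^ (n * m) :: complex fps)"
    using dvd eq by simp
  moreover have "n * m < Suc n * Suc m"
    by simp
  ultimately have "(fps_X ^ (n * m) :: complex fps) $ (n * m) = 0"
    unfolding fps_X_power_dvd_iff by blast
  then show False
    by simp
qed

text \<open>Each branch equation is nonzero on the other branch: for distinct tangents by comparison
  of orders, for equal tangents by \<open>dist\<close>, which says that no two conjugate Puiseux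
  series coincide on the common cover.\<close>

lemma finite_determinacy_puiseux:
  assumes m: "0 < m1" "0 < m2" and s: "fps_X ^ Suc m1 dvd s1" "fps_X ^ Suc m2 dvd s2" "s1 \<in> conv1" "s2 \<in> conv1"
    and prim: "\<And>\<zeta>. \<zeta> ^ m1 = 1 \<Longrightarrow> \<zeta> \<noteq> 1 \<Longrightarrow> twist \<zeta> s1 \<noteq> s1"
      "\<And>\<zeta>. \<zeta> ^ m2 = 1 \<Longrightarrow> \<zeta> \<noteq> 1 \<Longrightarrow> twist \<zeta> s2 \<noteq> s2"
    and dist: "\<And>\<zeta>. \<delta> \<noteq> 1 \<Longrightarrow> \<zeta> ^ m1 = 1 \<Longrightarrow> s2 oo fps_X ^ m1 \<noteq> twist \<zeta> s1 oo fps_X ^ m2"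
      "\<And>\<zeta>. \<delta> \<noteq> 1 \<Longrightarrow> \<zeta> ^ m2 = 1 \<Longrightarrow> s1 oo fps_X ^ m2 \<noteq> twist \<zeta> s2 oo fps_X ^ m1"
  defines "\<phi> \<equiv> puiseux_pair \<delta> m1 m2 s1 s2"
  shows "\<exists>N. \<forall>r1\<in>conv1. \<forall>r2\<in>conv1. fps_X ^ N dvd r1 \<longrightarrow> fps_X ^ N dvd r2 \<longrightarrow>
    (\<exists>\<eta>\<in>max_ideal_pow 2. subst1 \<eta> (fst \<phi>) = r1 \<and> subst1 \<eta> (snd \<phi>) = r2)"
proof -
  have s0: "s1 $ 0 = 0" "s2 $ 0 = 0"
    using s(1,2) unfolding fps_X_power_dvd_iff by blast+
  have Xm0: "(fps_X ^ m1 :: complex fps) $ 0 = 0" "(fps_X ^ m2 :: complex fps) $ 0 = 0"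
    using m by simp_all
  note c = centered_puiseux_pair[OF m s(1,2), of \<delta>, folded \<phi>_def]
  have det: "determined_branch (fps_X ^ m1, s1)" "determined_branch (fps_X ^ m2, s2)"
    using m s(3,4) s0 prim by (auto intro: determined_branch_puiseux)
  have dets: "determined_branch (fst \<phi>)" "determined_branch (snd \<phi>)"
    using det determined_branch_swap[OF det(2)] s0 Xm0 by (auto simp: \<phi>_def puiseux_pair_def)
  obtain f1 where f1: "f1 \<in> conv2" "subst1 f1 (fps_X ^ m1, s1) = 0"
    "\<And>a b k g. a $ 0 = 0 \<Longrightarrow> b $ 0 = 0 \<Longrightarrow> 0 < k \<Longrightarrow> g $ 0 = 0 \<Longrightarrow> g ^ m1 = a oo fps_X ^ k \<Longrightarrow>
      (\<And>\<zeta>. \<zeta> ^ m1 = 1 \<Longrightarrow> b oo fps_X ^ k \<noteq> twist \<zeta> s1 oo g) \<Longrightarrow> subst1 f1 (a, b) \<noteq> 0"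
    using branch_equation[OF m(1) s(3) s0(1)] by blast
  obtain f2 where f2: "f2 \<in> conv2" "subst1 f2 (fps_X ^ m2, s2) = 0"
    "\<And>a b k g. a $ 0 = 0 \<Longrightarrow> b $ 0 = 0 \<Longrightarrow> 0 < k \<Longrightarrow> g $ 0 = 0 \<Longrightarrow> g ^ m2 = a oo fps_X ^ k \<Longrightarrow>
      (\<And>\<zeta>. \<zeta> ^ m2 = 1 \<Longrightarrow> b oo fps_X ^ k \<noteq> twist \<zeta> s2 oo g) \<Longrightarrow> subst1 f2 (a, b) \<noteq> 0"
    using branch_equation[OF m(2) s(4) s0(2)] by blast
  define g2 where "g2 = (if \<delta> = 1 then swap_vars f2 else f2)"
  have X0: "fps_X ^ m1 \<noteq> (0 :: complex fps)" "fps_X ^ m2 \<noteq> (0 :: complex fps)"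
    by simp_all
  have twist_dvd: "fps_X ^ k dvd twist \<zeta> s" if "fps_X ^ k dvd s" for k \<zeta> and s :: "complex fps"
    using that by (intro fps_X_power_dvd_compose) simp_all
  have root: "\<exists>g. g ^ m = a oo fps_X ^ m \<and> g $ 0 = 0 \<and> (\<forall>\<zeta>. fps_X ^ n oo fps_X ^ m \<noteq> twist \<zeta> s oo g)"
    if prems: "0 < m" "fps_X ^ Suc n dvd a" "fps_X ^ Suc m dvd s" for m n :: nat and a s :: "complex fps"
  proof -
    obtain g where g: "g ^ m = a oo fps_X ^ m" "fps_X ^ Suc n dvd g"
      using root_of_stretched[OF prems(1,2)] by blast
    then have "g $ 0 = 0"
      unfolding fps_X_power_dvd_iff by blast
    then show ?thesis
      using g compose_neq_of_orders[OF prems(1) twist_dvd[OF prems(3)] g(2)] by blast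
  qed
  have F1: "subst1 f1 (fst \<phi>) = 0" "subst1 f1 (snd \<phi>) \<noteq> 0"
  proof -
    show "subst1 f1 (fst \<phi>) = 0"
      using f1 by (simp add: \<phi>_def puiseux_pair_def)
    show "subst1 f1 (snd \<phi>) \<noteq> 0"
    proof (cases "\<delta> = 1")
      case True
      obtain g where g: "g ^ m1 = s2 oo fps_X ^ m1" "g $ 0 = 0" "\<And>\<zeta>. fps_X ^ m2 oo fps_X ^ m1 \<noteq> twist \<zeta> s1 oo g"
        using root[OF m(1) s(2) s(1)] by blast
      show ?thesis
        using f1(3)[OF s0(2) Xm0(2) m(1) g(2,1,3)] True by (simp add: \<phi>_def puiseux_pair_def)
    next
      case False
      \<comment> \<open>For equal tangents the required m1-th root of the first coordinate t^(m1 m2)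
        is t^m2 itself.\<close>
      have "(fps_X ^ m2) ^ m1 = fps_X ^ m2 oo (fps_X ^ m1 :: complex fps)"
        by (simp add: fps_X_power_compose[OF Xm0(1)] power_mult[symmetric] mult.commute)
      then show ?thesis
        using f1(3)[OF Xm0(2) s0(2) m(1) Xm0(2) _ dist(1)] False by (simp add: \<phi>_def puiseux_pair_def)
    qed
  qed
  have F2: "g2 \<in> conv2" "subst1 g2 (snd \<phi>) = 0" "subst1 g2 (fst \<phi>) \<noteq> 0"
  proof -
    show "g2 \<in> conv2"
      using f2 by (simp add: g2_def conv2_swap_vars)
    show "subst1 g2 (snd \<phi>) = 0"
      using f2 s0 Xm0 by (auto simp: \<phi>_def puiseux_pair_def g2_def subst1_swap_vars)
    show "subst1 g2 (fst \<phi>) \<noteq> 0"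
    proof (cases "\<delta> = 1")
      case True
      obtain g where g: "g ^ m2 = s1 oo fps_X ^ m2" "g $ 0 = 0" "\<And>\<zeta>. fps_X ^ m1 oo fps_X ^ m2 \<noteq> twist \<zeta> s2 oo g"
        using root[OF m(2) s(1) s(2)] by blast
      show ?thesis
        using f2(3)[OF s0(1) Xm0(1) m(2) g(2,1,3)] True s0 Xm0
        by (simp add: \<phi>_def puiseux_pair_def g2_def subst1_swap_vars)
    next
      case False
      have "(fps_X ^ m1) ^ m2 = fps_X ^ m1 oo (fps_X ^ m2 :: complex fps)"
        by (simp add: fps_X_power_compose[OF Xm0(2)] power_mult[symmetric] mult.commute)
      then show ?thesis
        using f2(3)[OF Xm0(1) s0(1) m(2) Xm0(1) _ dist(2)] False by (simp add: \<phi>_def puiseux_pair_def g2_def)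
    qed
  qed
  show ?thesis
    using finite_determinacy[OF c _ _ _ _ _ _ dets f1(1) F1 F2] s(3,4) X0 conv1_X_power
    by (simp add: \<phi>_def puiseux_pair_def split: if_splits)
qed


section \<open>Evaluation of germs\<close>

lemma fps_nth_compose_stretch:
  fixes f :: "complex fps"
  assumes "0 < m"
  shows "(f oo fps_X ^ m) $ k = (if m dvd k then f $ (k div m) else 0)"
proof -
  have "(f oo fps_X ^ m) $ k = (\<Sum>i\<in>{0..k}. if k = m * i then f $ i else 0)"
    unfolding fps_compose_nth power_mult[symmetric] by (intro sum.cong refl) simp
  also have "\<dots> = (if m dvd k then f $ (k div m) else 0)"
  proof (cases "m dvd k")
    case True
    then have "(\<Sum>i\<in>{0..k}. if k = m * i then f $ i else 0) = (\<Sum>i\<in>{0..k}. if i = k div m then f $ i else 0)"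
      using assms by (intro sum.cong refl) auto
    then show ?thesis
      using True by (simp add: sum.delta div_le_dividend)
  qed (auto intro!: sum.neutral)
  finally show ?thesis .
qed

lemma eval_fps_stretch:
  assumes "0 < m"
  shows "eval_fps (f oo fps_X ^ m) t = eval_fps f (t ^ m :: complex)"
proof -
  have "(\<Sum>n. (f oo fps_X ^ m) $ (m * n) * t ^ (m * n)) = (\<Sum>n. (f oo fps_X ^ m) $ n * t ^ n)"
    using assms by (intro suminf_mono_reindex) (auto simp: strict_mono_def fps_nth_compose_stretch elim!: dvdE)
  then show ?thesis
    using assms by (simp add: eval_fps_def fps_nth_compose_stretch power_mult)
qed

lemma eval_fps_twist: "eval_fps (twist \<zeta> f) t = eval_fps f (\<zeta> * t)"
  unfolding eval_fps_def fps_nth_compose_linear by (simp add: power_mult_distrib mult_ac)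

text \<open>A rotation of the parameter that fixes both coordinates would map t and \<zeta> t to the
  same point, against injectivity near 0.\<close>

lemma parametrization_primitive:
  assumes "parametrization (a, b)" "twist \<zeta> a = a" "twist \<zeta> b = b" "norm \<zeta> = 1"
  shows "\<zeta> = 1"
proof -
  obtain r where r: "r > 0" "inj_on (germ_eval (a, b)) (ball 0 r)"
    using assms(1) by (auto simp: parametrization_def)
  define t :: complex where "t = of_real (r / 2)"
  have t: "norm t = r / 2" "t \<noteq> 0"
    using r by (simp_all add: t_def)
  have "germ_eval (a, b) (\<zeta> * t) = germ_eval (a, b) t"
    using eval_fps_twist[of a \<zeta> t] eval_fps_twist[of b \<zeta> t] assms(2,3) by (simp add: germ_eval_def)
  moreover have "\<zeta> * t \<in> ball 0 r" "t \<in> ball 0 r"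
    using r t assms(4) by (simp_all add: norm_mult)
  ultimately have "\<zeta> * t = t"
    using r(2) by (auto dest: inj_onD)
  then show ?thesis
    using t by simp
qed

lemma same_branch_sym: "same_branch \<phi> \<psi> \<Longrightarrow> same_branch \<psi> \<phi>"
  unfolding same_branch_def by blast

text \<open>The hypothesis says \<psi>(u^m) = \<phi>(\<zeta> u^n). Small parameters have small
  roots, so near the origin each image is contained in the other.\<close>

lemma same_branch_of_common_cover:
  assumes "0 < m" "0 < n" "norm \<zeta> = 1"
    and eq: "fst \<psi> oo fps_X ^ m = twist \<zeta> (fst \<phi>) oo fps_X ^ n" "snd \<psi> oo fps_X ^ m = twist \<zeta> (snd \<phi>) oo fps_X ^ n"
  shows "same_branch \<phi> \<psi>"
proof -
  have ev: "germ_eval \<psi> (u ^ m) = germ_eval \<phi> (\<zeta> * u ^ n)" for u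
    unfolding germ_eval_def eval_fps_stretch[OF assms(1), symmetric] eq eval_fps_stretch[OF assms(2)] eval_fps_twist ..
  have "\<zeta> \<noteq> 0"
    using assms(3) by auto
  show ?thesis
    unfolding same_branch_def
  proof (intro allI impI)
    fix r :: real assume "r > 0"
    define e where "e = min 1 r"
    have e: "0 < e" "e \<le> 1" "e \<le> r"
      using \<open>r > 0\<close> by (auto simp: e_def)
    have small: "norm (u ^ k) < r" if "norm u ^ l < e ^ l" "0 < k" for u :: complex and k l
    proof -
      have u: "norm u < e"
        using power_less_imp_less_base[OF that(1)] e by simp
      have "norm u ^ k \<le> norm u ^ 1"
        using u e that by (intro power_decreasing) auto
      then show ?thesis
        using u e by (simp add: norm_power)
    qed
    \<comment> \<open>A parameter of norm below e^l has an l-th root of norm below e, and all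
      positive powers of that root stay below r because e is at most 1.\<close>
    define s where "s = min (e ^ n) (e ^ m)"
    have "s > 0"
      using e by (simp add: s_def)
    moreover have "germ_eval \<phi> ` ball 0 s \<subseteq> germ_eval \<psi> ` ball 0 r"
    proof
      fix p assume "p \<in> germ_eval \<phi> ` ball 0 s"
      then obtain t where t: "norm t < s" "p = germ_eval \<phi> t"
        by auto
      obtain u where u: "u ^ n = t / \<zeta>"
        using complex_root_exists[OF assms(2)] by blast
      have "norm u ^ n = norm t"
        by (simp add: norm_power[symmetric] u norm_divide assms(3))
      then have "norm (u ^ m) < r"
        using small[of u n m] t assms by (simp add: s_def)
      moreover have "p = germ_eval \<psi> (u ^ m)"
        using t \<open>\<zeta> \<noteq> 0\<close> by (simp add: ev u)
      ultimately show "p \<in> germ_eval \<psi> ` ball 0 r"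
        by simp
    qed
    moreover have "germ_eval \<psi> ` ball 0 s \<subseteq> germ_eval \<phi> ` ball 0 r"
    proof
      fix p assume "p \<in> germ_eval \<psi> ` ball 0 s"
      then obtain t where t: "norm t < s" "p = germ_eval \<psi> t"
        by auto
      obtain u where u: "u ^ m = t"
        using complex_root_exists[OF assms(1)] by blast
      have "norm u ^ m = norm t"
        by (simp add: norm_power[symmetric] u)
      then have "norm (u ^ n) < r"
        using small[of u m n] t assms by (simp add: s_def)
      then have "norm (\<zeta> * u ^ n) < r"
        by (simp add: norm_mult assms(3))
      moreover have "p = germ_eval \<phi> (\<zeta> * u ^ n)"
        using t by (simp add: ev[symmetric] u)
      ultimately show "p \<in> germ_eval \<phi> ` ball 0 r"
        by simp
    qed
    ultimately show "\<exists>s>0. germ_eval \<phi> ` ball 0 s \<subseteq> germ_eval \<psi> ` ball 0 r \<and> germ_eval \<psi> ` ball 0 s \<subseteq> germ_eval \<phi> ` ball 0 r"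
      by blast
  qed
qed

lemma twist_X_power: "\<zeta> ^ m = 1 \<Longrightarrow> twist \<zeta> (fps_X ^ m) = fps_X ^ m"
  by (rule fps_ext) simp

text \<open>Turns the geometric content of a bigerm, injectivity and distinct images, into the
  conditions on Puiseux series that \<open>finite_determinacy_puiseux\<close> asks for.\<close>

lemma is_bigerm_puiseux_pair:
  assumes m: "0 < m1" "0 < m2" and b: "is_bigerm (puiseux_pair \<delta> m1 m2 s1 s2)"
  shows "\<And>\<zeta>. \<zeta> ^ m1 = 1 \<Longrightarrow> \<zeta> \<noteq> 1 \<Longrightarrow> twist \<zeta> s1 \<noteq> s1"
    and "\<And>\<zeta>. \<zeta> ^ m2 = 1 \<Longrightarrow> \<zeta> \<noteq> 1 \<Longrightarrow> twist \<zeta> s2 \<noteq> s2"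
    and "\<And>\<zeta>. \<delta> \<noteq> 1 \<Longrightarrow> \<zeta> ^ m1 = 1 \<Longrightarrow> s2 oo fps_X ^ m1 \<noteq> twist \<zeta> s1 oo fps_X ^ m2"
    and "\<And>\<zeta>. \<delta> \<noteq> 1 \<Longrightarrow> \<zeta> ^ m2 = 1 \<Longrightarrow> s1 oo fps_X ^ m2 \<noteq> twist \<zeta> s2 oo fps_X ^ m1"
proof -
  have norm1: "norm \<zeta> = 1" if "\<zeta> ^ k = 1" "0 < k" for \<zeta> :: complex and k
    using power_eq_1_iff[OF that(1)] that(2) by simp
  have p1: "parametrization (fps_X ^ m1, s1)"
    using b by (simp add: is_bigerm_def puiseux_pair_def)
  have p2: "if \<delta> = 1 then parametrization (s2, fps_X ^ m2) else parametrization (fps_X ^ m2, s2)"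
    using b by (simp add: is_bigerm_def puiseux_pair_def split: if_splits)
  show "twist \<zeta> s1 \<noteq> s1" if "\<zeta> ^ m1 = 1" "\<zeta> \<noteq> 1" for \<zeta>
    using parametrization_primitive[OF p1 twist_X_power[OF that(1)]] norm1[OF that(1) m(1)] that(2) by blast
  show "twist \<zeta> s2 \<noteq> s2" if "\<zeta> ^ m2 = 1" "\<zeta> \<noteq> 1" for \<zeta>
    using parametrization_primitive[of _ _ \<zeta>] p2 twist_X_power[OF that(1)] norm1[OF that(1) m(2)] that(2)
    by (auto split: if_splits)
  have comm: "fps_X ^ m2 oo fps_X ^ m1 = fps_X ^ m1 oo (fps_X ^ m2 :: complex fps)"
  proof -
    have "(fps_X ^ m1 :: complex fps) $ 0 = 0" "(fps_X ^ m2 :: complex fps) $ 0 = 0"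
      using m by simp_all
    then show ?thesis
      by (simp only: fps_X_power_compose power_mult[symmetric] mult.commute[of m1])
  qed
  have nsb: "\<not> same_branch (fps_X ^ m1, s1) (fps_X ^ m2, s2)" if "\<delta> \<noteq> 1"
    using b that by (simp add: is_bigerm_def puiseux_pair_def)
  show "s2 oo fps_X ^ m1 \<noteq> twist \<zeta> s1 oo fps_X ^ m2" if "\<delta> \<noteq> 1" "\<zeta> ^ m1 = 1" for \<zeta>
    using same_branch_of_common_cover[OF m norm1[OF that(2) m(1)], of "(fps_X ^ m2, s2)" "(fps_X ^ m1, s1)"]
      nsb[OF that(1)] comm twist_X_power[OF that(2)] by auto
  show "s1 oo fps_X ^ m2 \<noteq> twist \<zeta> s2 oo fps_X ^ m1" if "\<delta> \<noteq> 1" "\<zeta> ^ m2 = 1" for \<zeta>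
    using same_branch_of_common_cover[OF m(2,1) norm1[OF that(2) m(2)], of "(fps_X ^ m1, s1)" "(fps_X ^ m2, s2)"]
      nsb[OF that(1)] same_branch_sym comm twist_X_power[OF that(2)] by auto
qed

section \<open>Values of convergent series on germs\<close>

lemma norm_eval_fps_le:
  assumes "majorized r C (fps_const f)" "norm t \<le> r"
  shows "norm (eval_fps f t) \<le> C"
proof -
  have r: "0 \<le> r"
    using assms(2) norm_ge_zero order_trans by blast
  have s: "summable (\<lambda>n. norm (f $ n) * r ^ n)" "(\<Sum>n. norm (f $ n) * r ^ n) \<le> C"
    using majorized_fps_const_summable[OF assms(1) r] by auto
  have le: "norm (f $ n * t ^ n) \<le> norm (f $ n) * r ^ n" for n
    using assms(2) by (simp add: norm_mult norm_power mult_left_mono power_mono)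
  have s': "summable (\<lambda>n. norm (f $ n * t ^ n))"
    using s(1) le by (intro summable_comparison_test[OF _ s(1)]) auto
  have "norm (eval_fps f t) \<le> (\<Sum>n. norm (f $ n * t ^ n))"
    unfolding eval_fps_def using s' by (rule summable_norm)
  also have "\<dots> \<le> (\<Sum>n. norm (f $ n) * r ^ n)"
    using le s' s(1) by (rule suminf_le)
  finally show ?thesis
    using s(2) by simp
qed

lemma eval_fps_small:
  assumes "f \<in> conv1" "f $ 0 = 0" "0 < e"
  shows "\<exists>r>0. \<forall>t. norm t < r \<longrightarrow> norm (eval_fps f t) < e"
proof -
  have "order_ge 1 (fps_const f)"
    using assms(2) by (simp add: order_ge_fps_const fps_X_dvd_iff)
  then obtain r where r: "r > 0" "majorized r (e / 2) (fps_const f)"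
    using majorized_small[of "fps_const f" "fps_const f" "e / 2"] assms by (force simp: conv2_fps_const_iff)
  have "norm (eval_fps f t) < e" if "norm t < r" for t
    using norm_eval_fps_le[OF r(2), of t] that assms(3) by simp
  then show ?thesis
    using r(1) by blast
qed

lemma eval_fps_polynomial:
  assumes "norm t < fps_conv_radius a" "norm t < fps_conv_radius (b :: complex fps)"
  shows "eval_fps (\<Sum>i\<in>I. \<Sum>j\<in>J. fps_const (c i j) * (a ^ i * b ^ j)) t =
      (\<Sum>i\<in>I. \<Sum>j\<in>J. c i j * eval_fps a t ^ i * eval_fps b t ^ j)"
proof -
  define good where "good f \<longleftrightarrow> ereal (norm t) < fps_conv_radius f" for f :: "complex fps"
  have good_sum: "good (sum f A) \<and> eval_fps (sum f A) t = (\<Sum>x\<in>A. eval_fps (f x) t)"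
    if "\<And>x. x \<in> A \<Longrightarrow> good (f x)" for A :: "nat set" and f
    using that
  proof (induction A rule: infinite_finite_induct)
    case (insert x A)
    then have "good (f x)" "good (sum f A)"
      by auto
    then have "good (f x + sum f A)"
      unfolding good_def using fps_conv_radius_add[of "f x" "sum f A"] by (metis less_le_trans min_less_iff_conj)
    then show ?case
      using insert by (simp add: eval_fps_add good_def)
  qed (simp_all add: good_def)
  have good_mult: "good (f * g)" if "good f" "good g" for f g
    using that fps_conv_radius_mult[of f g] unfolding good_def by (metis less_le_trans min_less_iff_conj)
  have good_power: "good (f ^ n)" if "good f" for f n
    using that fps_conv_radius_power[of f n] unfolding good_def by (rule less_le_trans)
  have ab: "good a" "good b"
    using assms by (simp_all add: good_def)
  have const: "good (fps_const x)" for x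
    by (simp add: good_def)
  have term_good: "good (fps_const x * (a ^ i * b ^ j))" for x i j
    by (intro good_mult good_power ab const)
  have term_eval: "eval_fps (fps_const x * (a ^ i * b ^ j)) t = x * eval_fps a t ^ i * eval_fps b t ^ j" for x i j
  proof -
    have "good (a ^ i)" "good (b ^ j)" "good (a ^ i * b ^ j)"
      by (intro good_mult good_power ab)+
    then show ?thesis
      using ab const[of x] by (simp add: good_def eval_fps_mult eval_fps_power)
  qed
  have inner: "good (\<Sum>j\<in>J. fps_const (c i j) * (a ^ i * b ^ j))"
     "eval_fps (\<Sum>j\<in>J. fps_const (c i j) * (a ^ i * b ^ j)) t = (\<Sum>j\<in>J. c i j * eval_fps a t ^ i * eval_fps b t ^ j)" for i
    using good_sum[of J "\<lambda>j. fps_const (c i j) * (a ^ i * b ^ j)"] term_good term_eval by auto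
  show ?thesis
    using good_sum[of I "\<lambda>i. \<Sum>j\<in>J. fps_const (c i j) * (a ^ i * b ^ j)"] inner by auto
qed

definition box_sum :: "fps2 \<Rightarrow> complex \<times> complex \<Rightarrow> nat \<Rightarrow> complex" where
  "box_sum F p K = (\<Sum>i\<le>K. \<Sum>j\<le>K. coef2 F i j * fst p ^ i * snd p ^ j)"

text \<open>Near 0 the value of F along a germ is a limit of polynomials evaluated at the point, so
  it depends on the point and not on the germ passing through it.\<close>

lemma box_sum_tendsto_eval:
  assumes F: "F \<in> conv2" and \<phi>: "fst \<phi> \<in> conv1" "snd \<phi> \<in> conv1" "centered \<phi>"
  shows "\<exists>r>0. \<forall>t. norm t < r \<longrightarrow> box_sum F (germ_eval \<phi> t) \<longlonglongrightarrow> eval_fps (subst1 F \<phi>) t"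
proof -
  obtain R C where R: "R > 0" "majorized R C F"
    using F by (auto simp: conv2_iff_majorized)
  have C: "0 \<le> C"
    using R(2) by (rule majorized_nonneg)
  have nc: "no_const (germ2 \<phi>)"
    using \<phi>(3) by (simp add: no_const_germ2)
  \<comment> \<open>Keeping the germ within half the radius of F makes a remainder of order K + 1
    gain the factor (1/2)^(K+1).\<close>
  obtain r where r: "r > 0" "majorized r (R / 2) (fst (germ2 \<phi>))" "majorized r (R / 2) (snd (germ2 \<phi>))"
    using majorized_small[of "fst (germ2 \<phi>)" "snd (germ2 \<phi>)" "R / 2"] \<phi> nc R(1)
    by (force simp: no_const_def germ2_def conv2_fps_const_iff)
  have rad: "ereal r \<le> fps_conv_radius (fst \<phi>)" "ereal r \<le> fps_conv_radius (snd \<phi>)"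
    using r by (auto simp: germ2_def intro: majorized_fps_const_conv_radius)
  have "box_sum F (germ_eval \<phi> t) \<longlonglongrightarrow> eval_fps (subst1 F \<phi>) t" if t: "norm t < r" for t
  proof -
    have t': "ereal (norm t) < fps_conv_radius (fst \<phi>)" "ereal (norm t) < fps_conv_radius (snd \<phi>)"
      using rad t by (auto intro: less_le_trans[of _ "ereal r"])
    have maj: "majorized r C (fps_const (subst1 F \<phi>))"
      using majorized_subst2[OF majorized_smaller_radius[OF R(2), of "R / 2"] r(2,3) nc] R(1) r(1)
      by (simp add: subst2_germ2)
    have bound: "norm (box_sum F (germ_eval \<phi> t) K - eval_fps (subst1 F \<phi>) t) \<le> C * (1 / 2) ^ K" for K
    proof -
      have "majorized R C (F - trunc2 K F)"
        using R(2) by (rule majorized_coef_le) (use R(1) in \<open>auto simp: coef2_trunc2\<close>)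
      then have "majorized (R / 2) (C * (R / 2 / R) ^ Suc K) (F - trunc2 K F)"
        using order_ge_diff_trunc2 R(1) by (intro majorized_order_ge) auto
      then have "majorized (R / 2) (C * (1 / 2) ^ K) (F - trunc2 K F)"
        using R(1) C by (elim majorized_mono) (auto intro!: mult_left_mono)
      then have "majorized r (C * (1 / 2) ^ K) (fps_const (subst1 (F - trunc2 K F) \<phi>))"
        using majorized_subst2[OF _ r(2,3) nc] r(1) by (simp add: subst2_germ2)
      then have le: "norm (eval_fps (subst1 (F - trunc2 K F) \<phi>) t) \<le> C * (1 / 2) ^ K"
        using t by (intro norm_eval_fps_le) auto
      have tr: "subst1 (trunc2 K F) \<phi> = (\<Sum>i\<le>K. \<Sum>j\<le>K. fps_const (coef2 F i j) * (fst \<phi> ^ i * snd \<phi> ^ j))"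
        by (simp add: trunc2_def subst1_sum subst1_monom2[OF \<phi>(3)])
      have box: "eval_fps (subst1 (trunc2 K F) \<phi>) t = box_sum F (germ_eval \<phi> t) K"
        unfolding tr eval_fps_polynomial[OF t'] by (simp add: box_sum_def germ_eval_def)
      have "ereal r \<le> fps_conv_radius (subst1 (trunc2 K F) \<phi>)"
      proof -
        have "majorized R C (trunc2 K F)"
          using R(2) by (rule majorized_coef_le) (use R(1) in \<open>auto simp: coef2_trunc2\<close>)
        then have "majorized r C (fps_const (subst1 (trunc2 K F) \<phi>))"
          using majorized_subst2[OF majorized_smaller_radius[of R C _ "R / 2"] r(2,3) nc] R(1) r(1)
          by (simp add: subst2_germ2)
        then show ?thesis
          using r(1) by (intro majorized_fps_const_conv_radius) auto
      qed
      then have "eval_fps (subst1 (F - trunc2 K F) \<phi>) t = eval_fps (subst1 F \<phi>) t - box_sum F (germ_eval \<phi> t) K"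
        unfolding subst1_diff box[symmetric] using majorized_fps_const_conv_radius[OF maj] r(1) t
        by (intro eval_fps_diff) (auto intro: less_le_trans[of _ "ereal r"])
      then show ?thesis
        using le by (simp add: norm_minus_commute)
    qed
    have lim: "(\<lambda>K. C * (1 / 2) ^ K) \<longlonglongrightarrow> 0"
      by (intro tendsto_mult_right_zero LIMSEQ_power_zero) simp
    have "(\<lambda>K. box_sum F (germ_eval \<phi> t) K - eval_fps (subst1 F \<phi>) t) \<longlonglongrightarrow> 0"
      by (rule Lim_null_comparison[OF eventuallyI lim]) (rule bound)
    then show ?thesis
      by (simp add: LIM_zero_iff)
  qed
  then show ?thesis
    using r(1) by blast
qed

text \<open>The case of \<open>box_sum_tendsto_eval\<close> in which the series is f(x) and the germ
  is (\<kappa>, 0).\<close>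

lemma eval_fps_compose_near_0:
  assumes "f \<in> conv1" "\<kappa> \<in> conv1" "\<kappa> $ 0 = 0"
  shows "\<exists>r>0. \<forall>t. norm t < r \<longrightarrow> eval_fps (f oo \<kappa>) t = eval_fps f (eval_fps \<kappa> t)"
proof -
  define \<phi> where "\<phi> = (\<kappa>, 0 :: complex fps)"
  have c: "centered \<phi>"
    using assms by (simp add: \<phi>_def)
  have "(0 :: complex fps) \<in> conv1"
    by (simp add: conv1_def)
  then obtain r where r: "r > 0"
    "\<And>t. norm t < r \<Longrightarrow> box_sum (fps_const f) (germ_eval \<phi> t) \<longlonglongrightarrow> eval_fps (subst1 (fps_const f) \<phi>) t"
    using box_sum_tendsto_eval[of "fps_const f" \<phi>] assms c by (auto simp: conv2_fps_const_iff \<phi>_def)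
  obtain R where R: "0 < ereal R" "ereal R < fps_conv_radius f"
    using ereal_dense2[of 0 "fps_conv_radius f"] assms(1) by (auto simp: conv1_def)
  then obtain r' where r': "r' > 0" "\<And>t. norm t < r' \<Longrightarrow> norm (eval_fps \<kappa> t) < R"
    using eval_fps_small[OF assms(2,3), of R] by auto
  have "eval_fps (f oo \<kappa>) t = eval_fps f (eval_fps \<kappa> t)" if "norm t < min r r'" for t
  proof (rule LIMSEQ_unique)
    have box: "box_sum (fps_const f) (germ_eval \<phi> t) = (\<lambda>K. \<Sum>i\<le>K. f $ i * eval_fps \<kappa> t ^ i)"
    proof
      fix K
      have "box_sum (fps_const f) (germ_eval \<phi> t) K = (\<Sum>i\<le>K. \<Sum>j\<le>K. if j = 0 then f $ i * eval_fps \<kappa> t ^ i else 0)"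
        unfolding box_sum_def by (intro sum.cong refl) (simp add: coef2_fps_const germ_eval_def \<phi>_def)
      then show "box_sum (fps_const f) (germ_eval \<phi> t) K = (\<Sum>i\<le>K. f $ i * eval_fps \<kappa> t ^ i)"
        by (simp add: sum.delta)
    qed
    show "(\<lambda>K. \<Sum>i\<le>K. f $ i * eval_fps \<kappa> t ^ i) \<longlonglongrightarrow> eval_fps (f oo \<kappa>) t"
      using r(2)[of t] that c unfolding box by (simp add: subst1_fps_const) (simp add: \<phi>_def)
    have "ereal (norm (eval_fps \<kappa> t)) < fps_conv_radius f"
      using r'(2)[of t] that R(2) by (auto intro: less_trans[of _ "ereal R"])
    then have "(\<lambda>n. f $ n * eval_fps \<kappa> t ^ n) sums eval_fps f (eval_fps \<kappa> t)"
      by (rule sums_eval_fps)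
    then show "(\<lambda>K. \<Sum>i\<le>K. f $ i * eval_fps \<kappa> t ^ i) \<longlonglongrightarrow> eval_fps f (eval_fps \<kappa> t)"
      by (simp add: sums_def_le)
  qed
  then show ?thesis
    using r(1) r'(1) by (intro exI[of _ "min r r'"]) auto
qed


section \<open>Bigerms under convergent coordinate changes\<close>

text \<open>The plane map (\<rho>(x), y) is a shear with b = 0. Its convergent inverse, restricted
  to the x-axis, inverts \<rho>.\<close>

lemma conv1_fps_inv:
  assumes "reparam \<rho>" "\<rho> \<in> conv1"
  shows "fps_inv \<rho> \<in> conv1"
proof -
  have "fps_X ^ 2 dvd \<rho> - fps_X"
    using assms(1) unfolding fps_X_power_dvd_iff reparam_def by (auto simp: less_2_cases_iff)
  then have "order_ge 2 (fps_const \<rho> - var_x)"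
    by (simp add: order_ge_fps_const var_x_def)
  then have "shear 0 (fps_const \<rho>, var_y)"
    by (simp add: shear_def)
  then obtain \<tau> where \<tau>: "shear 0 \<tau>" "comp2 (fps_const \<rho>, var_y) \<tau> = (var_x, var_y)" "fst \<tau> \<in> conv2" "snd \<tau> \<in> conv2"
    using shear_inverse[of 0 "(fps_const \<rho>, var_y)"] assms(2) by (auto simp: conv2_fps_const_iff)
  define \<phi> :: germ where "\<phi> = (fps_X, 0)"
  have c: "centered \<phi>"
    by (simp add: \<phi>_def)
  note nc = shear_no_const[OF \<tau>(1)]
  define \<kappa> where "\<kappa> = subst1 (fst \<tau>) \<phi>"
  have cim: "centered (germ_image \<tau> \<phi>)"
    using nc c by (rule centered_germ_image)
  then have \<kappa>0: "\<kappa> $ 0 = 0"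
    by (simp add: centered_def germ_image_def \<kappa>_def)
  have "subst1 (subst2 (fps_const \<rho>) \<tau>) \<phi> = \<rho> oo \<kappa>"
    using nc c cim by (simp add: subst1_subst2 subst1_fps_const) (simp add: germ_image_def \<kappa>_def)
  moreover have "subst2 (fps_const \<rho>) \<tau> = var_x"
    using \<tau>(2) by (simp add: comp2_def)
  ultimately have "\<rho> oo \<kappa> = fps_X"
    using subst1_var[OF c] by (simp add: \<phi>_def)
  then have "fps_inv \<rho> = (fps_inv \<rho> oo \<rho>) oo \<kappa>"
    using fps_compose_assoc[OF \<kappa>0, of \<rho> "fps_inv \<rho>"] assms(1) by (simp add: reparam_def)
  then have "fps_inv \<rho> = \<kappa>"
    using reparam_inv(1)[OF assms(1)] \<kappa>0 by simp
  moreover have "\<kappa> \<in> conv1"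
    unfolding \<kappa>_def using \<tau>(3) c by (intro conv1_subst1) (simp_all add: \<phi>_def conv1_def)
  ultimately show ?thesis
    by simp
qed

definition conv_germ :: "germ \<Rightarrow> bool" where
  "conv_germ \<phi> \<longleftrightarrow> fst \<phi> \<in> conv1 \<and> snd \<phi> \<in> conv1 \<and> centered \<phi>"

lemma ex_common_radius:
  assumes "\<exists>r>0. \<forall>t. norm t < r \<longrightarrow> P t" "\<exists>r>0. \<forall>t. norm t < r \<longrightarrow> Q t"
  shows "\<exists>r>(0::real). \<forall>t. norm t < r \<longrightarrow> P t \<and> Q t"
proof -
  obtain r r' where "r > 0" "r' > 0" "\<forall>t. norm t < r \<longrightarrow> P t" "\<forall>t. norm t < r' \<longrightarrow> Q t"
    using assms by blast
  then show ?thesis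
    by (intro exI[of _ "min r r'"]) auto
qed

text \<open>The values of \<open>\<tau> \<circ> \<chi>\<close> depend only on the values of \<open>\<chi>\<close>, because \<open>\<tau>\<close> is given by a
  convergent series.\<close>

lemma germ_image_eval_cong:
  assumes \<tau>: "fst \<tau> \<in> conv2" "snd \<tau> \<in> conv2" and \<chi>: "conv_germ \<chi>" "conv_germ \<chi>'"
  shows "\<exists>r>0. \<forall>t t'. norm t < r \<longrightarrow> norm t' < r \<longrightarrow> germ_eval \<chi> t = germ_eval \<chi>' t' \<longrightarrow>
    germ_eval (germ_image \<tau> \<chi>) t = germ_eval (germ_image \<tau> \<chi>') t'"
proof -
  have "\<exists>r>0. \<forall>t. norm t < r \<longrightarrow> box_sum (fst \<tau>) (germ_eval \<phi> t) \<longlonglongrightarrow> eval_fps (subst1 (fst \<tau>) \<phi>) t \<and>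
      box_sum (snd \<tau>) (germ_eval \<phi> t) \<longlonglongrightarrow> eval_fps (subst1 (snd \<tau>) \<phi>) t" if "conv_germ \<phi>" for \<phi>
    using that \<tau> unfolding conv_germ_def by (intro ex_common_radius box_sum_tendsto_eval) auto
  from this[OF \<chi>(1)] this[OF \<chi>(2)] obtain r r' where r: "r > 0" "r' > 0"
    "\<forall>t. norm t < r \<longrightarrow> box_sum (fst \<tau>) (germ_eval \<chi> t) \<longlonglongrightarrow> eval_fps (subst1 (fst \<tau>) \<chi>) t \<and>
      box_sum (snd \<tau>) (germ_eval \<chi> t) \<longlonglongrightarrow> eval_fps (subst1 (snd \<tau>) \<chi>) t"
    "\<forall>t. norm t < r' \<longrightarrow> box_sum (fst \<tau>) (germ_eval \<chi>' t) \<longlonglongrightarrow> eval_fps (subst1 (fst \<tau>) \<chi>') t \<and>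
      box_sum (snd \<tau>) (germ_eval \<chi>' t) \<longlonglongrightarrow> eval_fps (subst1 (snd \<tau>) \<chi>') t"
    by blast
  have "germ_eval (germ_image \<tau> \<chi>) t = germ_eval (germ_image \<tau> \<chi>') t'"
    if "norm t < min r r'" "norm t' < min r r'" "germ_eval \<chi> t = germ_eval \<chi>' t'" for t t'
  proof -
    have "eval_fps (subst1 (fst \<tau>) \<chi>) t = eval_fps (subst1 (fst \<tau>) \<chi>') t'"
      using r(3)[rule_format, of t] r(4)[rule_format, of t'] that by (auto intro: LIMSEQ_unique)
    moreover have "eval_fps (subst1 (snd \<tau>) \<chi>) t = eval_fps (subst1 (snd \<tau>) \<chi>') t'"
      using r(3)[rule_format, of t] r(4)[rule_format, of t'] that by (auto intro: LIMSEQ_unique)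
    ultimately show ?thesis
      by (simp add: germ_eval_def germ_image_def)
  qed
  then show ?thesis
    using r(1,2) by (intro exI[of _ "min r r'"]) auto
qed

lemma germ_comp_eval:
  assumes "conv_germ \<phi>" "\<kappa> \<in> conv1" "\<kappa> $ 0 = 0"
  shows "\<exists>r>0. \<forall>t. norm t < r \<longrightarrow> germ_eval (germ_comp \<phi> \<kappa>) t = germ_eval \<phi> (eval_fps \<kappa> t)"
proof -
  have "\<exists>r>0. \<forall>t. norm t < r \<longrightarrow> eval_fps (fst \<phi> oo \<kappa>) t = eval_fps (fst \<phi>) (eval_fps \<kappa> t) \<and>
      eval_fps (snd \<phi> oo \<kappa>) t = eval_fps (snd \<phi>) (eval_fps \<kappa> t)"
    using assms unfolding conv_germ_def by (intro ex_common_radius eval_fps_compose_near_0) auto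
  then show ?thesis
    by (simp add: germ_eval_def germ_comp_def)
qed

lemma reparam_eval_inverse:
  assumes "reparam \<rho>" "\<rho> \<in> conv1"
  shows "\<exists>r>0. \<forall>t. norm t < r \<longrightarrow> eval_fps (fps_inv \<rho>) (eval_fps \<rho> t) = t"
    and "\<exists>r>0. \<forall>t. norm t < r \<longrightarrow> eval_fps \<rho> (eval_fps (fps_inv \<rho>) t) = t"
proof -
  have inverse: "\<exists>r>0. \<forall>t. norm t < r \<longrightarrow> eval_fps f (eval_fps g t) = t"
    if "f \<in> conv1" "g \<in> conv1" "g $ 0 = 0" "f oo g = fps_X" for f g
    using eval_fps_compose_near_0[OF that(1-3)] unfolding that(4) eval_fps_X by metis
  show "\<exists>r>0. \<forall>t. norm t < r \<longrightarrow> eval_fps (fps_inv \<rho>) (eval_fps \<rho> t) = t"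
    "\<exists>r>0. \<forall>t. norm t < r \<longrightarrow> eval_fps \<rho> (eval_fps (fps_inv \<rho>) t) = t"
    using conv1_fps_inv[OF assms] assms reparam_inv[OF assms(1)] by (auto simp: reparam_def intro!: inverse)
qed

text \<open>If \<chi> takes one value at two parameters, \<tau> carries this to a coincidence of
  \<phi> composed with the inverse of \<rho>, which is injective near 0.\<close>

lemma parametrization_transfer:
  assumes \<tau>: "fst \<tau> \<in> conv2" "snd \<tau> \<in> conv2" and \<chi>: "conv_germ \<chi>" and \<phi>: "parametrization \<phi>"
    and \<rho>: "reparam \<rho>" "\<rho> \<in> conv1" and eq: "germ_image \<tau> \<chi> = germ_comp \<phi> (fps_inv \<rho>)"
  shows "parametrization \<chi>"
proof -
  have \<kappa>: "fps_inv \<rho> \<in> conv1" "fps_inv \<rho> $ 0 = 0"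
    using conv1_fps_inv[OF \<rho>] reparam_inv(3)[OF \<rho>(1)] by (simp_all add: reparam_def)
  have c\<phi>: "conv_germ \<phi>"
    using \<phi> by (simp add: parametrization_def conv_germ_def centered_def)
  obtain r0 where r0: "r0 > 0" "inj_on (germ_eval \<phi>) (ball 0 r0)"
    using \<phi> by (auto simp: parametrization_def)
  obtain r1 where r1: "r1 > 0" "\<forall>t t'. norm t < r1 \<longrightarrow> norm t' < r1 \<longrightarrow> germ_eval \<chi> t = germ_eval \<chi> t' \<longrightarrow>
    germ_eval (germ_image \<tau> \<chi>) t = germ_eval (germ_image \<tau> \<chi>) t'"
    using germ_image_eval_cong[OF \<tau> \<chi> \<chi>] by blast
  have "\<exists>r>0. \<forall>t. norm t < r \<longrightarrow> (germ_eval (germ_comp \<phi> (fps_inv \<rho>)) t = germ_eval \<phi> (eval_fps (fps_inv \<rho>) t) \<and>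
      eval_fps \<rho> (eval_fps (fps_inv \<rho>) t) = t) \<and> norm (eval_fps (fps_inv \<rho>) t) < r0"
    by (intro ex_common_radius germ_comp_eval c\<phi> \<kappa> reparam_eval_inverse \<rho> eval_fps_small r0)
  then obtain r2 where r2: "r2 > 0" "\<And>t. norm t < r2 \<Longrightarrow> germ_eval (germ_comp \<phi> (fps_inv \<rho>)) t = germ_eval \<phi> (eval_fps (fps_inv \<rho>) t)"
    "\<And>t. norm t < r2 \<Longrightarrow> eval_fps \<rho> (eval_fps (fps_inv \<rho>) t) = t" "\<And>t. norm t < r2 \<Longrightarrow> norm (eval_fps (fps_inv \<rho>) t) < r0"
    by blast
  have inj: "t = t'" if "norm t < min r1 r2" "norm t' < min r1 r2" "germ_eval \<chi> t = germ_eval \<chi> t'" for t t'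
  proof -
    have "germ_eval (germ_image \<tau> \<chi>) t = germ_eval (germ_image \<tau> \<chi>) t'"
      using r1(2) that by simp
    then have "germ_eval \<phi> (eval_fps (fps_inv \<rho>) t) = germ_eval \<phi> (eval_fps (fps_inv \<rho>) t')"
      unfolding eq using r2(2) that by simp
    moreover have "eval_fps (fps_inv \<rho>) t \<in> ball 0 r0" "eval_fps (fps_inv \<rho>) t' \<in> ball 0 r0"
      using r2(4) that by auto
    ultimately have "eval_fps (fps_inv \<rho>) t = eval_fps (fps_inv \<rho>) t'"
      using r0(2) by (auto dest: inj_onD)
    then have "eval_fps \<rho> (eval_fps (fps_inv \<rho>) t) = eval_fps \<rho> (eval_fps (fps_inv \<rho>) t')"
      by simp
    then show "t = t'"
      using r2(3) that by simp
  qed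
  have "0 < min (fps_conv_radius (fst \<chi>)) (fps_conv_radius (snd \<chi>))"
    using \<chi> by (simp add: conv_germ_def conv1_def)
  then obtain r3 where r3: "0 < ereal r3" "ereal r3 < min (fps_conv_radius (fst \<chi>)) (fps_conv_radius (snd \<chi>))"
    using ereal_dense2 by blast
  define r where "r = min (min r1 r2) r3"
  have "r > 0" "ereal r \<le> ereal r3"
    using r1(1) r2(1) r3(1) by (auto simp: r_def)
  moreover from this have "ereal r \<le> fps_conv_radius (fst \<chi>)" "ereal r \<le> fps_conv_radius (snd \<chi>)"
    using r3(2) by (auto intro: order_trans[of _ "ereal r3"] less_imp_le)
  moreover have "inj_on (germ_eval \<chi>) (ball 0 r)"
    using inj by (intro inj_onI) (simp add: r_def)
  ultimately show ?thesis
    using \<chi> unfolding parametrization_def conv_germ_def centered_def by blast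
qed

text \<open>A parameter t of \<phi>1 gives u = \<rho>1(t) on \<chi>1; the inclusion supplies u' on
  \<chi>2 with the same image, and \<tau> sends this common point to \<phi>1 at t and to \<phi>2 at
  the parameter that the inverse of \<rho>2 assigns to u'.\<close>

lemma branch_image_transfer:
  assumes \<tau>: "fst \<tau> \<in> conv2" "snd \<tau> \<in> conv2" and \<chi>: "conv_germ \<chi>1" "conv_germ \<chi>2"
    and \<phi>: "conv_germ \<phi>1" "conv_germ \<phi>2" and \<rho>: "reparam \<rho>1" "\<rho>1 \<in> conv1" "reparam \<rho>2" "\<rho>2 \<in> conv1"
    and eq: "germ_image \<tau> \<chi>1 = germ_comp \<phi>1 (fps_inv \<rho>1)" "germ_image \<tau> \<chi>2 = germ_comp \<phi>2 (fps_inv \<rho>2)"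
    and sub: "\<And>r. r > 0 \<Longrightarrow> \<exists>s>0. germ_eval \<chi>1 ` ball 0 s \<subseteq> germ_eval \<chi>2 ` ball 0 r"
    and "r > 0"
  shows "\<exists>s>0. germ_eval \<phi>1 ` ball 0 s \<subseteq> germ_eval \<phi>2 ` ball 0 r"
proof -
  have \<kappa>: "fps_inv \<rho>1 \<in> conv1" "fps_inv \<rho>1 $ 0 = 0" "fps_inv \<rho>2 \<in> conv1" "fps_inv \<rho>2 $ 0 = 0"
    using conv1_fps_inv \<rho> reparam_inv(3) by (simp_all add: reparam_def)
  have \<rho>0: "\<rho>1 $ 0 = 0"
    using \<rho>(1) by (simp add: reparam_def)
  obtain r1 where r1: "r1 > 0" "\<forall>t t'. norm t < r1 \<longrightarrow> norm t' < r1 \<longrightarrow> germ_eval \<chi>1 t = germ_eval \<chi>2 t' \<longrightarrow>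
    germ_eval (germ_image \<tau> \<chi>1) t = germ_eval (germ_image \<tau> \<chi>2) t'"
    using germ_image_eval_cong[OF \<tau> \<chi>] by blast
  obtain r2 where r2: "r2 > 0" "\<And>t. norm t < r2 \<Longrightarrow> germ_eval (germ_comp \<phi>1 (fps_inv \<rho>1)) t = germ_eval \<phi>1 (eval_fps (fps_inv \<rho>1) t)"
    using germ_comp_eval[OF \<phi>(1) \<kappa>(1,2)] by blast
  have "\<exists>r'>0. \<forall>t. norm t < r' \<longrightarrow> germ_eval (germ_comp \<phi>2 (fps_inv \<rho>2)) t = germ_eval \<phi>2 (eval_fps (fps_inv \<rho>2) t) \<and>
      norm (eval_fps (fps_inv \<rho>2) t) < r"
    by (intro ex_common_radius germ_comp_eval \<phi> \<kappa> eval_fps_small \<open>r > 0\<close>)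
  then obtain r3 where r3: "r3 > 0" "\<And>t. norm t < r3 \<Longrightarrow> germ_eval (germ_comp \<phi>2 (fps_inv \<rho>2)) t = germ_eval \<phi>2 (eval_fps (fps_inv \<rho>2) t)"
    "\<And>t. norm t < r3 \<Longrightarrow> norm (eval_fps (fps_inv \<rho>2) t) < r"
    by blast
  obtain s0 where s0: "s0 > 0" "germ_eval \<chi>1 ` ball 0 s0 \<subseteq> germ_eval \<chi>2 ` ball 0 (min r1 r3)"
    using sub[of "min r1 r3"] r1(1) r3(1) by auto
  have "\<exists>s>0. \<forall>t. norm t < s \<longrightarrow> norm (eval_fps \<rho>1 t) < min s0 (min r1 r2) \<and> eval_fps (fps_inv \<rho>1) (eval_fps \<rho>1 t) = t"
    using s0(1) r1(1) r2(1) by (intro ex_common_radius eval_fps_small reparam_eval_inverse \<rho> \<rho>0) simp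
  then obtain s where s: "s > 0" "\<And>t. norm t < s \<Longrightarrow> norm (eval_fps \<rho>1 t) < min s0 (min r1 r2)"
     "\<And>t. norm t < s \<Longrightarrow> eval_fps (fps_inv \<rho>1) (eval_fps \<rho>1 t) = t"
    by blast
  have "germ_eval \<phi>1 t \<in> germ_eval \<phi>2 ` ball 0 r" if t: "norm t < s" for t
  proof -
    define u where "u = eval_fps \<rho>1 t"
    have u: "norm u < s0" "norm u < r1" "norm u < r2" "eval_fps (fps_inv \<rho>1) u = t"
      using s(2,3)[OF t] by (simp_all add: u_def)
    have "germ_eval \<chi>1 u \<in> germ_eval \<chi>1 ` ball 0 s0"
      using u(1) by simp
    then have "germ_eval \<chi>1 u \<in> germ_eval \<chi>2 ` ball 0 (min r1 r3)"
      using s0(2) by (rule rev_subsetD)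
    then obtain u' where "germ_eval \<chi>1 u = germ_eval \<chi>2 u'" "u' \<in> ball 0 (min r1 r3)"
      by (rule imageE)
    then have u': "norm u' < min r1 r3" "germ_eval \<chi>1 u = germ_eval \<chi>2 u'"
      by simp_all
    have "germ_eval \<phi>1 t = germ_eval (germ_image \<tau> \<chi>1) u"
      unfolding eq using r2(2)[OF u(3)] u(4) by simp
    also have "\<dots> = germ_eval (germ_image \<tau> \<chi>2) u'"
      using r1(2) u u' by simp
    also have "\<dots> = germ_eval \<phi>2 (eval_fps (fps_inv \<rho>2) u')"
      unfolding eq using r3(2) u' by simp
    finally show ?thesis
      using r3(3)[of u'] u' by auto
  qed
  then show ?thesis
    using s(1) by (intro exI[of _ s]) auto
qed

text \<open>Gives each inclusion its own radius, so that \<open>branch_image_transfer\<close> can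
  treat them one at a time.\<close>

lemma same_branch_iff:
  "same_branch \<phi> \<psi> \<longleftrightarrow> (\<forall>r>0. \<exists>s>0. germ_eval \<phi> ` ball 0 s \<subseteq> germ_eval \<psi> ` ball 0 r) \<and>
    (\<forall>r>0. \<exists>s>0. germ_eval \<psi> ` ball 0 s \<subseteq> germ_eval \<phi> ` ball 0 r)" (is "?L \<longleftrightarrow> ?R")
proof
  assume R: ?R
  show ?L
    unfolding same_branch_def
  proof (intro allI impI)
    fix r :: real assume "r > 0"
    then obtain s s' where s: "s > 0" "s' > 0" "germ_eval \<phi> ` ball 0 s \<subseteq> germ_eval \<psi> ` ball 0 r"
        "germ_eval \<psi> ` ball 0 s' \<subseteq> germ_eval \<phi> ` ball 0 r"
      using R by meson
    have "germ_eval \<phi> ` ball 0 (min s s') \<subseteq> germ_eval \<phi> ` ball 0 s" "germ_eval \<psi> ` ball 0 (min s s') \<subseteq> germ_eval \<psi> ` ball 0 s'"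
      by (intro image_mono; simp add: subset_ball)+
    then show "\<exists>s>0. germ_eval \<phi> ` ball 0 s \<subseteq> germ_eval \<psi> ` ball 0 r \<and> germ_eval \<psi> ` ball 0 s \<subseteq> germ_eval \<phi> ` ball 0 r"
      using s by (intro exI[of _ "min s s'"]) (meson min_less_iff_conj order_trans)
  qed
qed (unfold same_branch_def, meson)

text \<open>Both properties are checked by going back to \<phi> with the inverse \<tau> of \<sigma>:
  a failure of injectivity, or a coincidence of branches, would appear there as well.\<close>

lemma is_bigerm_transfer:
  assumes \<phi>: "is_bigerm \<phi>" and \<chi>: "conv_germ (fst \<chi>)" "conv_germ (snd \<chi>)"
    and \<sigma>: "shear b \<sigma>" "fst \<sigma> \<in> conv2" "snd \<sigma> \<in> conv2"
    and \<rho>: "reparam \<rho>1" "\<rho>1 \<in> conv1" "reparam \<rho>2" "\<rho>2 \<in> conv1"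
    and eq: "germ_image \<sigma> (fst \<phi>) = germ_comp (fst \<chi>) \<rho>1" "germ_image \<sigma> (snd \<phi>) = germ_comp (snd \<chi>) \<rho>2"
  shows "is_bigerm \<chi>"
proof -
  have p: "parametrization (fst \<phi>)" "parametrization (snd \<phi>)" "\<not> same_branch (fst \<phi>) (snd \<phi>)"
    using \<phi> by (simp_all add: is_bigerm_def)
  have c\<phi>: "conv_germ (fst \<phi>)" "conv_germ (snd \<phi>)"
    using p by (simp_all add: parametrization_def conv_germ_def centered_def)
  obtain \<tau> where \<tau>: "shear (- b) \<tau>" "comp2 \<tau> \<sigma> = (var_x, var_y)" "fst \<tau> \<in> conv2" "snd \<tau> \<in> conv2"
    using shear_inverse[OF \<sigma>(1)] \<sigma>(2,3) by blast
  have eq': "germ_image \<tau> \<chi>' = germ_comp \<phi>' (fps_inv \<rho>)"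
    if "conv_germ \<phi>'" "conv_germ \<chi>'" "reparam \<rho>" "germ_image \<sigma> \<phi>' = germ_comp \<chi>' \<rho>" for \<phi>' \<chi>' \<rho>
  proof -
    have c: "centered \<phi>'" "centered \<chi>'"
      using that by (simp_all add: conv_germ_def)
    have "\<phi>' = germ_image \<tau> (germ_image \<sigma> \<phi>')"
      using c(1) shear_no_const[OF \<sigma>(1)] by (simp only: germ_image_comp2[symmetric] \<tau>(2) germ_image_id)
    also have "\<dots> = germ_comp (germ_image \<tau> \<chi>') \<rho>"
      using that c by (simp add: germ_image_germ_comp reparam_def)
    finally have "germ_comp \<phi>' (fps_inv \<rho>) = germ_comp (germ_comp (germ_image \<tau> \<chi>') \<rho>) (fps_inv \<rho>)"
      by simp
    then show ?thesis
      by (simp add: germ_comp_def reparam_compose_inv_cancel[OF that(3)])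
  qed
  note e1 = eq'[OF c\<phi>(1) \<chi>(1) \<rho>(1) eq(1)] and e2 = eq'[OF c\<phi>(2) \<chi>(2) \<rho>(3) eq(2)]
  have "\<not> same_branch (fst \<chi>) (snd \<chi>)"
  proof
    assume "same_branch (fst \<chi>) (snd \<chi>)"
    then have sub: "\<exists>s>0. germ_eval (fst \<chi>) ` ball 0 s \<subseteq> germ_eval (snd \<chi>) ` ball 0 r"
       "\<exists>s>0. germ_eval (snd \<chi>) ` ball 0 s \<subseteq> germ_eval (fst \<chi>) ` ball 0 r" if "r > 0" for r
      using that unfolding same_branch_iff by simp_all
    have "same_branch (fst \<phi>) (snd \<phi>)"
      unfolding same_branch_iff
    proof (intro conjI allI impI)
      fix r :: real assume "r > 0"
      show "\<exists>s>0. germ_eval (fst \<phi>) ` ball 0 s \<subseteq> germ_eval (snd \<phi>) ` ball 0 r"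
        by (rule branch_image_transfer[OF \<tau>(3,4) \<chi> c\<phi> \<rho> e1 e2 sub(1) \<open>r > 0\<close>])
      show "\<exists>s>0. germ_eval (snd \<phi>) ` ball 0 s \<subseteq> germ_eval (fst \<phi>) ` ball 0 r"
        by (rule branch_image_transfer[OF \<tau>(3,4) \<chi>(2,1) c\<phi>(2,1) \<rho>(3,4,1,2) e2 e1 sub(2) \<open>r > 0\<close>])
    qed
    then show False
      using p(3) by simp
  qed
  then show ?thesis
    using parametrization_transfer[OF \<tau>(3,4) \<chi>(1) p(1) \<rho>(1,2) e1]
      parametrization_transfer[OF \<tau>(3,4) \<chi>(2) p(2) \<rho>(3,4) e2]
    by (simp add: is_bigerm_def)
qed


section \<open>Truncation of a formal equivalence\<close>

lemma conv1_eventually_0: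
  assumes "\<And>i. N \<le> i \<Longrightarrow> f $ i = 0"
  shows "f \<in> conv1"
proof -
  have "conv_radius (fps_nth f) = conv_radius (\<lambda>_. 0 :: complex)"
    using assms by (intro conv_radius_cong') (auto simp: eventually_sequentially)
  then show ?thesis
    by (simp add: conv1_def fps_conv_radius_def)
qed

lemma conv1_fps_cutoff: "fps_cutoff N f \<in> conv1"
  by (rule conv1_eventually_0[of N]) simp

lemma conv1_diff: "f \<in> conv1 \<Longrightarrow> g \<in> conv1 \<Longrightarrow> f - g \<in> conv1"
  using fps_conv_radius_diff[of f g] by (auto simp: conv1_def min_def split: if_splits intro: less_le_trans)

lemma dvd_diff_fps_cutoff: "fps_X ^ N dvd fps_cutoff N f - (f :: complex fps)"
  unfolding fps_X_power_dvd_iff by simp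

lemma dvd_compose_diff_both:
  fixes f g :: "complex fps"
  assumes "fps_X ^ d dvd f - g" "fps_X ^ d dvd \<theta> - \<theta>'" "\<theta> $ 0 = 0" "\<theta>' $ 0 = 0"
  shows "fps_X ^ d dvd (f oo \<theta>) - (g oo \<theta>')"
proof (rule dvd_diff_trans)
  show "fps_X ^ d dvd (f oo \<theta>) - (g oo \<theta>)"
    using fps_X_power_dvd_compose[OF assms(3,1)] by (simp add: fps_compose_sub_distrib)
  show "fps_X ^ d dvd (g oo \<theta>) - (g oo \<theta>')"
    using assms by (intro dvd_compose_diff_0)
qed

lemma Aut1_reparam:
  assumes "reparam \<rho>" "\<rho> \<in> conv1"
  shows "\<rho> \<in> Aut1" "jet1 1 \<rho> = fps_X"
proof -
  show "\<rho> \<in> Aut1"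
    unfolding Aut1_def using assms conv1_fps_inv[OF assms] reparam_inv[OF assms(1)]
    by (auto simp: reparam_def intro!: bexI[of _ "fps_inv \<rho>"])
  show "jet1 1 \<rho> = fps_X"
    using assms(1) by (intro fps_ext) (auto simp: jet1_def reparam_def less_2_cases_iff numeral_2_eq_2[symmetric] split: nat.splits)
qed

lemma jet2_1_eqI:
  assumes "order_ge 2 (F - G)" "\<And>i j. 1 < i + j \<Longrightarrow> coef2 G i j = 0"
  shows "jet2 1 F = G"
  by (rule fps2_eqI) (use assms in \<open>auto simp: jet2_def order_ge_def not_le\<close>)

lemma Aut2_shear:
  assumes "shear b \<sigma>" "fst \<sigma> \<in> conv2" "snd \<sigma> \<in> conv2"
  shows "\<sigma> \<in> Aut2" "jet2 1 (fst \<sigma>) = var_x + const2 b * var_y" "jet2 1 (snd \<sigma>) = var_y"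
proof -
  have end2: "\<tau> \<in> end2" if "no_const \<tau>" "fst \<tau> \<in> conv2" "snd \<tau> \<in> conv2" for \<tau>
    using that by (cases \<tau>) (simp add: end2_def max_ideal_pow_iff)
  obtain \<tau> where "shear (- b) \<tau>" "comp2 \<sigma> \<tau> = (var_x, var_y)" "comp2 \<tau> \<sigma> = (var_x, var_y)"
      "fst \<tau> \<in> conv2" "snd \<tau> \<in> conv2"
    using shear_inverse[OF assms(1)] assms(2,3) by blast
  then show "\<sigma> \<in> Aut2"
    unfolding Aut2_def using end2 shear_no_const assms by blast
  have var: "coef2 (const2 c * var_x) i j = (if i = 1 \<and> j = 0 then c else 0)"
     "coef2 (const2 c * var_y) i j = (if i = 0 \<and> j = 1 then c else 0)" for c i j
    using coef2_monom2[of c 1 0 i j] coef2_monom2[of c 0 1 i j] by (simp_all add: monom2_def)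
  show "jet2 1 (fst \<sigma>) = var_x + const2 b * var_y"
    using assms(1) var(1)[of 1] var(2)[of b] by (intro jet2_1_eqI) (auto simp: shear_def)
  show "jet2 1 (snd \<sigma>) = var_y"
    using assms(1) var(2)[of 1] by (intro jet2_1_eqI) (auto simp: shear_def)
qed

lemma A_equiv_truncate:
  assumes \<phi>: "is_bigerm \<phi>" and eq: "formal_equiv \<delta> \<phi> \<psi>"
    and c\<psi>: "centered (fst \<psi>)" "centered (snd \<psi>)" and \<chi>: "conv_germ (fst \<chi>)" "conv_germ (snd \<chi>)"
    and N: "2 \<le> N"
    and close: "fps_X ^ N dvd fst (fst \<chi>) - fst (fst \<psi>)" "fps_X ^ N dvd snd (fst \<chi>) - snd (fst \<psi>)"
      "fps_X ^ N dvd fst (snd \<chi>) - fst (snd \<psi>)" "fps_X ^ N dvd snd (snd \<chi>) - snd (snd \<psi>)"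
    and det: "\<And>r1 r2. r1 \<in> conv1 \<Longrightarrow> r2 \<in> conv1 \<Longrightarrow> fps_X ^ N dvd r1 \<Longrightarrow> fps_X ^ N dvd r2 \<Longrightarrow>
      \<exists>\<eta>\<in>max_ideal_pow 2. subst1 \<eta> (fst \<phi>) = r1 \<and> subst1 \<eta> (snd \<phi>) = r2"
  shows "A_equiv \<delta> \<phi> \<chi>"
proof -
  obtain b \<sigma> \<rho>1 \<rho>2 where 1: "\<delta> = 1 \<longrightarrow> b = 0" "shear b \<sigma>" "reparam \<rho>1" "reparam \<rho>2"
      "germ_image \<sigma> (fst \<phi>) = germ_comp (fst \<psi>) \<rho>1" "germ_image \<sigma> (snd \<phi>) = germ_comp (snd \<psi>) \<rho>2"
    using eq unfolding formal_equiv_def by blast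
  have c\<phi>: "conv_germ (fst \<phi>)" "conv_germ (snd \<phi>)"
    using \<phi> by (simp_all add: is_bigerm_def parametrization_def conv_germ_def centered_def)
  define \<theta>1 \<theta>2 where "\<theta>1 = fps_cutoff N \<rho>1" and "\<theta>2 = fps_cutoff N \<rho>2"
  have \<theta>: "reparam \<theta>1" "reparam \<theta>2" "\<theta>1 \<in> conv1" "\<theta>2 \<in> conv1"
    using 1(3,4) N by (simp_all add: \<theta>1_def \<theta>2_def reparam_def conv1_fps_cutoff)
  have d\<theta>: "fps_X ^ N dvd \<theta>1 - \<rho>1" "fps_X ^ N dvd \<theta>2 - \<rho>2"
    by (simp_all add: \<theta>1_def \<theta>2_def dvd_diff_fps_cutoff)
  define S where "S F = trunc2 N F" for F
  have S: "order_ge N (F - S F)" for F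
    using order_ge_diff_trunc2[of N F] by (auto simp: S_def elim: order_ge_mono)
  \<comment> \<open>After truncation everything in the equation of the equivalence converges, and
    each replacement changes it in order N or higher only.\<close>
  have residue: "(h oo \<theta>) - subst1 (S F) \<phi>' \<in> conv1 \<and> fps_X ^ N dvd (h oo \<theta>) - subst1 (S F) \<phi>'"
    if "conv_germ \<phi>'" "h \<in> conv1" "\<theta> \<in> conv1" "reparam \<theta>" "reparam \<rho>" "fps_X ^ N dvd \<theta> - \<rho>" "fps_X ^ N dvd h - g"
      "subst1 F \<phi>' = g oo \<rho>" for h g \<theta> \<rho> :: "complex fps" and F \<phi>'
  proof
    show "(h oo \<theta>) - subst1 (S F) \<phi>' \<in> conv1"
      using that by (intro conv1_diff conv1_compose conv1_subst1) (auto simp: reparam_def conv_germ_def S_def conv2_trunc2)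
    have "fps_X ^ N dvd (h oo \<theta>) - (g oo \<rho>)"
      using that by (intro dvd_compose_diff_both) (auto simp: reparam_def)
    moreover have "fps_X ^ N dvd subst1 (F - S F) \<phi>'"
      using that S by (intro fps_X_power_dvd_subst1) (auto simp: conv_germ_def)
    ultimately show "fps_X ^ N dvd (h oo \<theta>) - subst1 (S F) \<phi>'"
      using dvd_diff_trans[of "fps_X ^ N" "h oo \<theta>" "g oo \<rho>" "subst1 (S F) \<phi>'"] that(8) by (simp add: subst1_diff)
  qed
  have im: "subst1 (fst \<sigma>) (fst \<phi>) = fst (fst \<psi>) oo \<rho>1" "subst1 (snd \<sigma>) (fst \<phi>) = snd (fst \<psi>) oo \<rho>1"
     "subst1 (fst \<sigma>) (snd \<phi>) = fst (snd \<psi>) oo \<rho>2" "subst1 (snd \<sigma>) (snd \<phi>) = snd (snd \<psi>) oo \<rho>2"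
    using 1(5,6) by (simp_all add: germ_image_def germ_comp_def)
  have cv: "fst (fst \<chi>) \<in> conv1" "snd (fst \<chi>) \<in> conv1" "fst (snd \<chi>) \<in> conv1" "snd (snd \<chi>) \<in> conv1"
    using \<chi> by (simp_all add: conv_germ_def)
  note res = residue[OF c\<phi>(1) cv(1) \<theta>(3,1) 1(3) d\<theta>(1) close(1) im(1)] residue[OF c\<phi>(1) cv(2) \<theta>(3,1) 1(3) d\<theta>(1) close(2) im(2)]
    residue[OF c\<phi>(2) cv(3) \<theta>(4,2) 1(4) d\<theta>(2) close(3) im(3)] residue[OF c\<phi>(2) cv(4) \<theta>(4,2) 1(4) d\<theta>(2) close(4) im(4)]
  \<comment> \<open>A single series has to correct the first component of \<sigma> on both branches
    at once; this is what \<open>det\<close> provides.\<close>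
  obtain \<eta>1 where \<eta>1: "\<eta>1 \<in> max_ideal_pow 2" "subst1 \<eta>1 (fst \<phi>) = (fst (fst \<chi>) oo \<theta>1) - subst1 (S (fst \<sigma>)) (fst \<phi>)"
     "subst1 \<eta>1 (snd \<phi>) = (fst (snd \<chi>) oo \<theta>2) - subst1 (S (fst \<sigma>)) (snd \<phi>)"
    using det res(1,3) by blast
  obtain \<eta>2 where \<eta>2: "\<eta>2 \<in> max_ideal_pow 2" "subst1 \<eta>2 (fst \<phi>) = (snd (fst \<chi>) oo \<theta>1) - subst1 (S (snd \<sigma>)) (fst \<phi>)"
     "subst1 \<eta>2 (snd \<phi>) = (snd (snd \<chi>) oo \<theta>2) - subst1 (S (snd \<sigma>)) (snd \<phi>)"
    using det res(2,4) by blast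
  define \<sigma>' where "\<sigma>' = (S (fst \<sigma>) + \<eta>1, S (snd \<sigma>) + \<eta>2)"
  have conv\<sigma>': "fst \<sigma>' \<in> conv2" "snd \<sigma>' \<in> conv2"
    using \<eta>1(1) \<eta>2(1) by (simp_all add: \<sigma>'_def S_def max_ideal_pow_iff conv2_add conv2_trunc2)
  \<comment> \<open>As N is at least 2, truncation keeps the linear part, and the corrections have
    order 2; so the 1-jet is still that of \<sigma>.\<close>
  have "shear b \<sigma>'"
  proof -
    have close2: "order_ge 2 (S F + \<eta> - G)" if "order_ge 2 (F - G)" "\<eta> \<in> max_ideal_pow 2" for F G \<eta>
    proof -
      have "order_ge 2 ((F - G) - (F - S F) + \<eta>)"
        by (rule order_ge_add[OF order_ge_diff[OF that(1) order_ge_mono[OF S[of F] N]]])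
           (use that(2) in \<open>simp add: max_ideal_pow_iff\<close>)
      then show ?thesis
        by (simp add: algebra_simps)
    qed
    show ?thesis
      using 1(2) \<eta>1(1) \<eta>2(1) unfolding shear_def \<sigma>'_def fst_conv snd_conv by (intro conjI close2) auto
  qed
  have im': "germ_image \<sigma>' (fst \<phi>) = germ_comp (fst \<chi>) \<theta>1" "germ_image \<sigma>' (snd \<phi>) = germ_comp (snd \<chi>) \<theta>2"
    by (simp_all add: germ_image_def \<sigma>'_def subst1_add \<eta>1 \<eta>2 germ_comp_def)
  have big: "is_bigerm \<chi>"
    using is_bigerm_transfer[OF \<phi> \<chi> \<open>shear b \<sigma>'\<close> conv\<sigma>' \<theta>(1,3,2,4) im'] .
  have act: "act_germ \<theta> \<sigma>' \<phi>' = \<chi>'" if "germ_image \<sigma>' \<phi>' = germ_comp \<chi>' \<theta>" "reparam \<theta>" for \<phi>' \<chi>' \<theta>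
  proof -
    have "act_germ \<theta> \<sigma>' \<phi>' = germ_comp (germ_comp \<chi>' \<theta>) (fps_inv \<theta>)"
      unfolding that(1)[symmetric] by (simp add: act_germ_def germ_comp_def germ_image_def)
    then show ?thesis
      by (simp add: germ_comp_def reparam_compose_inv_cancel[OF that(2)])
  qed
  have "(\<theta>1, \<theta>2, \<sigma>') \<in> A_sub \<delta>"
    unfolding A_sub_def A_group_def
    using Aut1_reparam[OF \<theta>(1,3)] Aut1_reparam[OF \<theta>(2,4)] Aut2_shear[OF \<open>shear b \<sigma>'\<close> conv\<sigma>'] 1(1)
    by auto
  moreover have "\<chi> = (act_germ \<theta>1 \<sigma>' (fst \<phi>), act_germ \<theta>2 \<sigma>' (snd \<phi>))"
    using act[OF im'(1) \<theta>(1)] act[OF im'(2) \<theta>(2)] by simp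
  ultimately show ?thesis
    unfolding A_equiv_def using \<phi> big by (intro conjI bexI[of _ "(\<theta>1, \<theta>2, \<sigma>')"]) simp_all
qed


section \<open>The normal form\<close>

theorem theorem6:
  fixes \<delta> m1 m2 :: nat and \<Gamma> \<Lambda> :: "(enat \<times> enat) set" and \<phi> :: bigerm
  assumes "\<delta> \<in> {1, 2}"
    and "\<phi> \<in> Sigma_set \<delta> \<Gamma> \<Lambda>"
    and "m1 = mult_germ (fst \<phi>)" and "m2 = mult_germ (snd \<phi>)"
  shows "\<exists>\<psi> :: bigerm. A_equiv \<delta> \<phi> \<psi> \<and>
    (\<exists>(a1 :: nat \<Rightarrow> complex) (a2 :: nat \<Rightarrow> complex).
       let s1 = Abs_fps (\<lambda>j. if j > m1 \<and> (j, j) \<notin> maximal_points \<Lambda> \<and> fiber1 \<Lambda> (j, j) = {}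
                             then a1 j else 0);
           s2 = Abs_fps (\<lambda>j. if j > m2 \<and> fiber2 \<Lambda> (j, j) = {} then a2 j else 0)
       in fst \<psi> = (fps_X ^ m1, s1) \<and>
          snd \<psi> = (if \<delta> = 1 then (s2, fps_X ^ m2) else (fps_X ^ m2, s2)))"
proof -
  have big: "is_bigerm \<phi>" and \<Lambda>: "\<Lambda> = Lambda \<delta> \<phi>" and puiseux: "puiseux_form \<delta> \<phi>"
    and c: "\<exists>c. terms_upto c (fst \<phi>) \<and> terms_upto c (snd \<phi>)"
    using assms(2) by (auto simp: Sigma_set_def Let_def)
  from puiseux obtain s1 s2 where z: "\<forall>i\<le>m1. s1 $ i = 0" "\<forall>i\<le>m2. s2 $ i = 0"
    and "fst \<phi> = (fps_X ^ m1, s1)" "snd \<phi> = (if \<delta> = 1 then (s2, fps_X ^ m2) else (fps_X ^ m2, s2))"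
    unfolding puiseux_form_def assms(3,4)[symmetric] by blast
  then have \<phi>: "\<phi> = puiseux_pair \<delta> m1 m2 s1 s2"
    by (simp add: puiseux_pair_def prod_eq_iff)
  obtain c where c: "terms_upto c (fst \<phi>)" "terms_upto c (snd \<phi>)"
    using c by blast
  have s: "fps_X ^ Suc m1 dvd s1" "fps_X ^ Suc m2 dvd s2"
    using z by (simp_all add: fps_X_power_dvd_iff del: power_Suc)
  have conv: "s1 \<in> conv1" "s2 \<in> conv1"
  proof -
    have "s1 $ i = 0 \<and> s2 $ i = 0" if "Suc c \<le> i" for i
      using c(1)[unfolded terms_upto_def, rule_format, of i] c(2)[unfolded terms_upto_def, rule_format, of i] that
      unfolding \<phi> puiseux_pair_def by (cases "\<delta> = 1") simp_all
    then show "s1 \<in> conv1" "s2 \<in> conv1"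
      by (auto intro: conv1_eventually_0[of "Suc c"])
  qed
  \<comment> \<open>Parametrizations have no constant term, which excludes the exponent 0.\<close>
  have "(fps_X ^ m1 :: complex fps) $ 0 = 0" "(fps_X ^ m2 :: complex fps) $ 0 = 0"
    using big by (auto simp: \<phi> puiseux_pair_def is_bigerm_def parametrization_def split: if_splits)
  then have m: "0 < m1" "0 < m2"
    by (auto intro: gr0I)
  note prim = is_bigerm_puiseux_pair[OF m big[unfolded \<phi>]]
  obtain N0 where N0: "\<forall>r1\<in>conv1. \<forall>r2\<in>conv1. fps_X ^ N0 dvd r1 \<longrightarrow> fps_X ^ N0 dvd r2 \<longrightarrow>
      (\<exists>\<eta>\<in>max_ideal_pow 2. subst1 \<eta> (fst \<phi>) = r1 \<and> subst1 \<eta> (snd \<phi>) = r2)"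
    using finite_determinacy_puiseux[OF m s conv prim] unfolding \<phi> by blast
  \<comment> \<open>N0 makes the correcting series available, and 2 protects the 1-jets.\<close>
  define N where "N = max N0 2"
  \<comment> \<open>Above the multiplicities, E1 and E2 are exactly the degrees missing from the two
    sums of the normal form.\<close>
  define E1 where "E1 = {j. m1 < j \<and> ((j, j) \<in> maximal_points \<Lambda> \<or> fiber1 \<Lambda> (j, j) \<noteq> {})}"
  define E2 where "E2 = {j. m2 < j \<and> fiber2 \<Lambda> (j, j) \<noteq> {}}"
  have in_\<Lambda>: "\<exists>\<omega>. formal_form \<delta> \<omega> \<and> p = (nu_form (fst \<phi>) \<omega> - enat m1, nu_form (snd \<phi>) \<omega> - enat m2)" if "p \<in> \<Lambda>" for p
    using that Omega_imp_formal_form unfolding \<Lambda> Lambda_def assms(3,4) by blast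
  have weaker: "fps_X ^ (j + (m - 1)) dvd f" if "fps_X ^ (Suc j + (m - 1)) dvd f" for j m and f :: "complex fps"
    using that by (rule power_le_dvd) simp
  have H1: "\<exists>\<omega>. formal_form \<delta> \<omega> \<and>
      fps_X ^ (j + (m1 - 1)) dvd pullback_form \<omega> (fst \<phi>) \<and> \<not> fps_X ^ (Suc j + (m1 - 1)) dvd pullback_form \<omega> (fst \<phi>) \<and>
      fps_X ^ (j + (m2 - 1)) dvd pullback_form \<omega> (snd \<phi>) \<and>
      (j \<in> E2 \<longrightarrow> fps_X ^ (Suc j + (m2 - 1)) dvd pullback_form \<omega> (snd \<phi>))" if j: "j \<in> E1" for j
  proof -
    have "0 < j"
      using j by (simp add: E1_def)
    show ?thesis
    proof (cases "fiber1 \<Lambda> (j, j) = {}")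
      case True
      then have max: "(j, j) \<in> maximal_points \<Lambda>"
        using j by (simp add: E1_def)
      \<comment> \<open>A maximal point has an empty second fiber, so degree j is not to be cleared
        on the second branch and the simultaneous shift there does no harm.\<close>
      then have "(enat j, enat j) \<in> \<Lambda>" "j \<notin> E2"
        by (auto simp: maximal_points_def E2_def)
      then obtain \<omega> where "formal_form \<delta> \<omega>" "nu_form (fst \<phi>) \<omega> - enat m1 = enat j" "nu_form (snd \<phi>) \<omega> - enat m2 = enat j"
        using in_\<Lambda>[of "(enat j, enat j)"] by auto
      then show ?thesis
        using \<open>j \<notin> E2\<close> unfolding nu_form_eq_iff[OF m(1) \<open>0 < j\<close>] nu_form_eq_iff[OF m(2) \<open>0 < j\<close>] by blast
    next
      case False
      then obtain p where "p \<in> \<Lambda>" "fst p = enat j" "snd p > enat j"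
        by (auto simp: fiber1_def)
      then obtain \<omega> where "formal_form \<delta> \<omega>" "nu_form (fst \<phi>) \<omega> - enat m1 = enat j" "enat j < nu_form (snd \<phi>) \<omega> - enat m2"
        using in_\<Lambda>[of p] by auto
      then show ?thesis
        using weaker unfolding nu_form_eq_iff[OF m(1) \<open>0 < j\<close>] nu_form_gt_iff[OF m(2)] by blast
    qed
  qed
  have H2: "\<exists>\<omega>. formal_form \<delta> \<omega> \<and>
      fps_X ^ (Suc j + (m1 - 1)) dvd pullback_form \<omega> (fst \<phi>) \<and>
      fps_X ^ (j + (m2 - 1)) dvd pullback_form \<omega> (snd \<phi>) \<and> \<not> fps_X ^ (Suc j + (m2 - 1)) dvd pullback_form \<omega> (snd \<phi>)"
    if j: "j \<in> E2" for j
  proof -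
    have "0 < j"
      using j by (simp add: E2_def)
    obtain p where "p \<in> \<Lambda>" "snd p = enat j" "fst p > enat j"
      using j by (auto simp: fiber2_def E2_def)
    then obtain \<omega> where "formal_form \<delta> \<omega>" "nu_form (snd \<phi>) \<omega> - enat m2 = enat j" "enat j < nu_form (fst \<phi>) \<omega> - enat m1"
      using in_\<Lambda>[of p] by auto
    then show ?thesis
      unfolding nu_form_eq_iff[OF m(2) \<open>0 < j\<close>] nu_form_gt_iff[OF m(1)] by blast
  qed
  obtain t1 t2 where t: "formal_equiv \<delta> \<phi> (puiseux_pair \<delta> m1 m2 t1 t2)" "fps_X ^ Suc m1 dvd t1" "fps_X ^ Suc m2 dvd t2"
      "\<forall>k<N. (k \<in> E1 \<longrightarrow> t1 $ k = 0) \<and> (k \<in> E2 \<longrightarrow> t2 $ k = 0)"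
    using formal_normal_form[where N = N, OF \<phi> m s H1 H2] by blast
  \<comment> \<open>From degree N on nothing has been normalized; the cutoff sets these coefficients
    to zero, which the normal form permits.\<close>
  define \<chi> where "\<chi> = puiseux_pair \<delta> m1 m2 (fps_cutoff N t1) (fps_cutoff N t2)"
  have t0: "\<forall>i\<le>m1. t1 $ i = 0" "\<forall>i\<le>m2. t2 $ i = 0"
    using t(2,3) unfolding fps_X_power_dvd_iff by auto
  have v1: "t1 $ n = 0" if "n < N" "\<not> (n > m1 \<and> (n, n) \<notin> maximal_points \<Lambda> \<and> fiber1 \<Lambda> (n, n) = {})" for n
    using t(4) t0(1) that by (cases "n \<le> m1") (simp_all add: E1_def not_le)
  have v2: "t2 $ n = 0" if "n < N" "\<not> (n > m2 \<and> fiber2 \<Lambda> (n, n) = {})" for n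
    using t(4) t0(2) that by (cases "n \<le> m2") (simp_all add: E2_def not_le)
  have "A_equiv \<delta> \<phi> \<chi>"
  proof (rule A_equiv_truncate[OF big t(1) centered_puiseux_pair[OF m t(2,3)]])
    show "2 \<le> N"
      by (simp add: N_def)
    show "conv_germ (fst \<chi>)" "conv_germ (snd \<chi>)"
      using m t0 by (auto simp: \<chi>_def puiseux_pair_def conv_germ_def conv1_fps_cutoff conv1_X_power)
    show "\<exists>\<eta>\<in>max_ideal_pow 2. subst1 \<eta> (fst \<phi>) = r1 \<and> subst1 \<eta> (snd \<phi>) = r2"
      if "r1 \<in> conv1" "r2 \<in> conv1" "fps_X ^ N dvd r1" "fps_X ^ N dvd r2" for r1 r2
    proof -
      have "fps_X ^ N0 dvd r1" "fps_X ^ N0 dvd r2"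
        using that(3,4) by (auto elim: power_le_dvd simp: N_def)
      then show ?thesis
        using N0 that(1,2) by blast
    qed
  qed (auto simp: \<chi>_def puiseux_pair_def dvd_diff_fps_cutoff)
  moreover have "fps_cutoff N t1 = Abs_fps (\<lambda>j. if j > m1 \<and> (j, j) \<notin> maximal_points \<Lambda> \<and> fiber1 \<Lambda> (j, j) = {}
      then fps_cutoff N t1 $ j else 0)"
    using v1 by (intro fps_ext) (simp only: fps_nth_Abs_fps fps_cutoff_nth split: if_split, blast)
  moreover have "fps_cutoff N t2 = Abs_fps (\<lambda>j. if j > m2 \<and> fiber2 \<Lambda> (j, j) = {} then fps_cutoff N t2 $ j else 0)"
    using v2 by (intro fps_ext) (simp only: fps_nth_Abs_fps fps_cutoff_nth split: if_split, blast)
  ultimately show ?thesis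
    unfolding Let_def
    by (intro exI[of _ \<chi>] conjI exI[of _ "fps_nth (fps_cutoff N t1)"] exI[of _ "fps_nth (fps_cutoff N t2)"])
       (simp_all only: \<chi>_def puiseux_pair_def fst_conv snd_conv)
qed

end
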